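(* Let $F$ be a field with $\operatorname{char}(F)\neq 2,3$ and let $f=\sum_{\sigma\in S_d}\lambda_\sigma x_{\sigma(1)}\cdots x_{\sigma(d)}\in F\langle X\rangle$ be a multilinear polynomial of degree $d\ge 2$ such that $\sum_{\sigma\in S_d}\lambda_\sigma=0$ and $f(x,x,\ldots,x,y)\neq 0$ in $F\langle X\rangle$ (here $x,y$ are two distinct indeterminates, $x$ substituted for $x_1,\ldots,x_{d-1}$ and $y$ for $x_d$). Let $\mathcal A$ be a centrally closed prime (unital) $F$-algebra with $\dim_F\mathcal A>d^2$. If $\phi:\mathcal A\to\mathcal A$ is a bijective linear map that preserves zeros of $f$, then there exist $\alpha\in F$, an automorphism or antiautomorphism $\theta$ of $\mathcal A$, and a linear functional $\omega$ on $\mathcal A$ such that $\phi(a)=\alpha\theta(a)+\omega(a)1$ for all $a\in\mathcal A$.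
   Context: $F\langle X\rangle$ is the free algebra over $F$ in noncommuting indeterminates $x_1,x_2,\ldots$. A map $\phi$ on an $F$-algebra $\mathcal A$ preserves zeros of $f$ if for all $a_1,\ldots,a_d\in\mathcal A$, $f(a_1,\ldots,a_d)=0$ implies $f(\phi(a_1),\ldots,\phi(a_d))=0$. A prime $F$-algebra is centrally closed (over $F$) if its extended centroid equals $F$ (identified with $F\cdot 1$). *)

theory Defs
  imports Complex_Main "HOL-Combinatorics.Permutations"
begin

definition F_algebra :: "('f::field \<Rightarrow> 'b::ring_1 \<Rightarrow> 'b) \<Rightarrow> bool" where
  "F_algebra sc \<longleftrightarrow> Vector_Spaces.vector_space sc \<and>
     (\<forall>c a b. sc c (a * b) = sc c a * b \<and> sc c (a * b) = a * sc c b)"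

definition prime_ring :: "'b::ring_1 itself \<Rightarrow> bool" where
  "prime_ring _ \<longleftrightarrow> (\<forall>a b::'b. (\<forall>r. a * r * b = 0) \<longrightarrow> a = 0 \<or> b = 0)"

definition nonzero_ideal :: "'b::ring_1 set \<Rightarrow> bool" where
  "nonzero_ideal I \<longleftrightarrow> 0 \<in> I \<and> I \<noteq> {0} \<and>
     (\<forall>x\<in>I. \<forall>y\<in>I. x + y \<in> I) \<and> (\<forall>x\<in>I. - x \<in> I) \<and>
     (\<forall>x\<in>I. \<forall>r. r * x \<in> I \<and> x * r \<in> I)"

text \<open>Centrally closed over F: every element of the extended centroid (represented by an
  A-bimodule map from a nonzero ideal into A) is a scalar from F.\<close>
definition centrally_closed :: "('f::field \<Rightarrow> 'b::ring_1 \<Rightarrow> 'b) \<Rightarrow> bool" where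
  "centrally_closed sc \<longleftrightarrow>
     (\<forall>I (g::'b \<Rightarrow> 'b). nonzero_ideal I \<and>
        (\<forall>x\<in>I. \<forall>y\<in>I. g (x + y) = g x + g y) \<and>
        (\<forall>x\<in>I. \<forall>r. g (r * x) = r * g x \<and> g (x * r) = g x * r)
        \<longrightarrow> (\<exists>c. \<forall>x\<in>I. g x = sc c x))"

definition dim_gt :: "('f::field \<Rightarrow> 'b::ring_1 \<Rightarrow> 'b) \<Rightarrow> nat \<Rightarrow> bool" where
  "dim_gt sc n \<longleftrightarrow> (\<exists>B. module.independent sc B \<and> infinite B) \<or> vector_space.dim sc UNIV > n"

definition ml_eval :: "('f::field \<Rightarrow> 'b::ring_1 \<Rightarrow> 'b) \<Rightarrow> nat \<Rightarrow> ((nat \<Rightarrow> nat) \<Rightarrow> 'f)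
    \<Rightarrow> (nat \<Rightarrow> 'b) \<Rightarrow> 'b" where
  "ml_eval sc d lam a = (\<Sum>\<sigma>\<in>{\<sigma>. \<sigma> permutes {0..<d}}. sc (lam \<sigma>) (prod_list (map (a \<circ> \<sigma>) [0..<d])))"

text \<open>Elements of the free algebra F<x,y> are finitely supported coefficient functions on words
  (lists over the alphabet, x = 0, y = 1). This is f(x,...,x,y): the monomial
  x_sigma(0)...x_sigma(d-1) becomes the word with y at the position where sigma takes value d-1.\<close>
definition subst_xy :: "nat \<Rightarrow> ((nat \<Rightarrow> nat) \<Rightarrow> 'f::field) \<Rightarrow> nat list \<Rightarrow> 'f" where
  "subst_xy d lam w = (\<Sum>\<sigma>\<in>{\<sigma>. \<sigma> permutes {0..<d} \<and>
       map (\<lambda>i. if \<sigma> i = d - 1 then 1 else 0) [0..<d] = w}. lam \<sigma>)"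

definition preserves_zeros :: "('f::field \<Rightarrow> 'b::ring_1 \<Rightarrow> 'b) \<Rightarrow> nat \<Rightarrow> ((nat \<Rightarrow> nat) \<Rightarrow> 'f)
    \<Rightarrow> ('b \<Rightarrow> 'b) \<Rightarrow> bool" where
  "preserves_zeros sc d lam \<phi> \<longleftrightarrow>
     (\<forall>a. ml_eval sc d lam a = 0 \<longrightarrow> ml_eval sc d lam (\<phi> \<circ> a) = 0)"

end

theory Submission
  imports Defs "HOL-Computational_Algebra.Formal_Power_Series" "HOL-Library.Nat_Bijection"
begin

text \<open>
Putting x, ..., x, y with xy = yx into f gives, for X = \<phi>(x), an identity
\<open>\<Sum>\<^sub>i \<lambda>\<^sub>i X\<^sup>i \<phi>(y) X\<^sup>n\<^sup>-\<^sup>i = 0\<close> with n = d - 1 and not all \<open>\<lambda>\<^sub>i\<close> zero. For y = 1 and y = x^2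
it is polarized to a multilinear identity, from which the outer variables are peeled off one at a time:
the substitution of Tx for x, minus T times the original, kills a left factor x, while a right factor x
turns into a commutator with T. What remains says that \<phi>(1) is a scalar and that \<phi>(x^2) commutes with
\<phi>(x). Peeling needs identities with the variable on one side to have only the trivial solution. If no
wAb with w, b nonzero is finite-dimensional, this holds by Amitsur's lemma. Otherwise A has
an idempotent e with eAe a division algebra, and by density on Ae (of dimension more than d over
a maximal commuting L, since dim A > d^2) every element is the constant term of a power series T for
which 1, T, ..., T^d are independent over the scalar series; the peeling is done over power series.

After normalising \<phi>(1) = 1, B(X, Z) = \<phi>(xz + zx) is a symmetric bilinear map with a vanishing cyclic sum
of commutators [B(X, Y), Z]. As dim A > 4, some t is not quadratic over F. Comparing the identities for x, tx, z and tz
gives a tensor relation; a functional vanishing on 1 and t but not on t^2 turns it into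
\<open>B(X, Z) = k (XZ + ZX) + \<mu>(Z) X + \<mu>(X) Z\<close> modulo F. So an affine modification \<theta> of \<phi> is a Jordan
homomorphism modulo scalars, the scalar error vanishes by the Jordan identity, and a
Jordan automorphism of a prime ring is an automorphism or an antiautomorphism.
\<close>

subsection \<open>Tensor relations over a centrally closed prime algebra\<close>

text \<open>The identity coming from f has d - 1 outer factors and a middle map of at most two
  arguments, so peeling meets up to d + 1 variables. In the presence of finite-dimensional
  \<open>w A b\<close>, freeness in that many variables is derived from the independence of 1, T,
  ..., T^d for a single T, because every variable can be traded for one more power of T. The peeling
  only yields commutation with T, so every s has to be reached in the role of T, although s may be
  algebraic of small degree. Therefore s is perturbed to a power series with constant term s and
  independent powers, and the constant coefficient of the outcome is read off. The perturbation is
  found on Ae. Density provides a shift operator x -> s x + \<Sum> a_i x l_i with l_i in L, whose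
  powers are independent, but right multiplications by the l_i are not left multiplications.
  Replacing each l_i by a power of the central indeterminate makes the operator a left
  multiplication by a series, and for suitable exponents the independence survives.\<close>

definition fam_indep :: "('f::field \<Rightarrow> 'b::ab_group_add \<Rightarrow> 'b) \<Rightarrow> 'i set \<Rightarrow> ('i \<Rightarrow> 'b) \<Rightarrow> bool" where
  "fam_indep sc I b \<longleftrightarrow> (\<forall>c. (\<Sum>i\<in>I. sc (c i) (b i)) = 0 \<longrightarrow> (\<forall>i\<in>I. c i = 0))"

lemma fam_indepD: "fam_indep sc I b \<Longrightarrow> (\<Sum>i\<in>I. sc (c i) (b i)) = 0 \<Longrightarrow> i \<in> I \<Longrightarrow> c i = 0"
  unfolding fam_indep_def by blast

definition functional :: "('f::field \<Rightarrow> 'b::ab_group_add \<Rightarrow> 'b) \<Rightarrow> ('b \<Rightarrow> 'f) \<Rightarrow> bool" where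
  "functional sc w \<longleftrightarrow> (\<forall>x y. w (x + y) = w x + w y) \<and> (\<forall>c x. w (sc c x) = c * w x)"

locale falg = vector_space sc for sc :: "'f::field \<Rightarrow> 'b::ring_1 \<Rightarrow> 'b" +
  assumes sc_mult_left: "sc c (a * b) = sc c a * b"
    and sc_mult_right: "sc c (a * b) = a * sc c b"
begin

lemma functional_simps:
  assumes "functional sc w"
  shows "w (x + y) = w x + w y" "w (sc c x) = c * w x" "w 0 = 0" "w (- x) = - w x"
    "w (x - y) = w x - w y" "w (sum g A) = (\<Sum>a\<in>A. w (g a))"
proof -
  have add: "w (x + y) = w x + w y" for x y using assms by (simp add: functional_def)
  interpret additive w by standard (rule add)
  show "w (x + y) = w x + w y" "w (sc c x) = c * w x" "w 0 = 0" "w (- x) = - w x"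
    "w (x - y) = w x - w y" "w (sum g A) = (\<Sum>a\<in>A. w (g a))"
    using assms by (simp_all add: functional_def zero minus diff sum)
qed

lemma fam_indep_independent:
  assumes "finite I" "fam_indep sc I b"
  shows "inj_on b I" "independent (b ` I)"
proof -
  show inj: "inj_on b I"
  proof (rule inj_onI, rule ccontr)
    fix i j assume ij: "i \<in> I" "j \<in> I" "b i = b j" "i \<noteq> j"
    let ?c = "\<lambda>k. if k = i then 1 else if k = j then - 1 else (0::'f)"
    have "(\<Sum>k\<in>I. sc (?c k) (b k)) = (\<Sum>k\<in>{i, j}. sc (?c k) (b k))"
      by (rule sum.mono_neutral_right) (use assms ij in auto)
    also have "\<dots> = 0" using ij by (simp add: scale_minus_left)
    finally have "?c i = 0" by (rule fam_indepD[OF assms(2) _ ij(1)])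
    then show False by simp
  qed
  show "independent (b ` I)"
  proof (rule independent_if_scalars_zero)
    show "finite (b ` I)" using assms by simp
    fix f x assume f: "(\<Sum>x\<in>b ` I. sc (f x) x) = 0" and x: "x \<in> b ` I"
    have "(\<Sum>i\<in>I. sc ((f \<circ> b) i) (b i)) = 0" using f by (simp add: sum.reindex[OF inj])
    then have "\<forall>i\<in>I. (f \<circ> b) i = 0" using assms(2) unfolding fam_indep_def by blast
    then show "f x = 0" using x by auto
  qed
qed

lemma independent_fam_indep:
  assumes "finite B" "independent B"
  shows "fam_indep sc B (\<lambda>x. x)"
  unfolding fam_indep_def using assms independentD[OF assms(2,1) order_refl] by blast

lemma dual_functional:
  assumes "finite I" "fam_indep sc I b" "j \<in> I"
  obtains w where "functional sc w" "\<And>i. i \<in> I \<Longrightarrow> w (b i) = (if i = j then 1 else 0)"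
proof -
  interpret F: vector_space "(*) :: 'f \<Rightarrow> 'f \<Rightarrow> 'f" by standard (auto simp: algebra_simps)
  interpret vector_space_pair sc "(*) :: 'f \<Rightarrow> 'f \<Rightarrow> 'f" ..
  note inj = fam_indep_independent[OF assms(1,2)]
  obtain w where w: "Vector_Spaces.linear sc (*) w"
      "\<forall>x\<in>b ` I. w x = (if x = b j then 1 else 0)"
    using linear_independent_extend[OF inj(2), of "\<lambda>x. if x = b j then 1 else 0"] by blast
  show ?thesis
  proof (rule that)
    show "functional sc w" using w(1) unfolding functional_def Vector_Spaces.linear_iff by blast
    show "w (b i) = (if i = j then 1 else 0)" if "i \<in> I" for i
      using w(2) that inj(1) assms(3) by (auto dest: inj_onD)
  qed
qed

lemma separating_functional:
  assumes "v \<noteq> 0"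
  obtains w where "functional sc w" "w v \<noteq> 0"
proof -
  have "fam_indep sc {0::nat} (\<lambda>_. v)" using assms by (simp add: fam_indep_def)
  then obtain w where "functional sc w" "\<And>i. i \<in> {0::nat} \<Longrightarrow> w v = (if i = 0 then 1 else 0)"
    by (rule dual_functional[rotated, where j = 0]) auto
  then show ?thesis using that[of w] by simp
qed

lemma sc_one_mult: "sc c 1 * x = sc c x"
  using sc_mult_left[of c 1 x] by simp

lemma sc_one_commute: "x * sc c 1 = sc c 1 * x"
  using sc_mult_left[of c 1 x] sc_mult_right[of c x 1] by simp

lemma mult_sc: "a * sc c b = sc c (a * b)" and sc_mult: "sc c a * b = sc c (a * b)"
  by (simp_all only: sc_mult_left[symmetric] sc_mult_right[symmetric])

end

locale cc_prime = falg sc for sc :: "'f::field \<Rightarrow> 'b::ring_1 \<Rightarrow> 'b" +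
  assumes prime: "prime_ring TYPE('b)" and cc: "centrally_closed sc"
begin

lemma primeD: "(\<And>r. a * r * b = 0) \<Longrightarrow> a = 0 \<or> b = (0::'b)"
  using prime unfolding prime_ring_def by blast

text \<open>By \<open>wd\<close>, sending \<Sum> r e s to \<Sum> r f s is a well defined bimodule
  map on the ideal generated by \<open>e\<close>. Such a map is an element of the extended centroid,
  hence a scalar.\<close>

lemma proportional_if_bimodule_map:
  fixes e f :: 'b
  assumes e: "e \<noteq> 0"
    and wd: "\<And>xs. (\<Sum>(r, s)\<leftarrow>xs. r * e * s) = 0 \<Longrightarrow> (\<Sum>(r, s)\<leftarrow>xs. r * f * s) = 0"
  obtains c where "f = sc c e"
proof -
  define E F where "E xs = (\<Sum>(r, s)\<leftarrow>xs. r * e * s)" and "F xs = (\<Sum>(r, s)\<leftarrow>xs. r * f * s)" for xs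
  define I where "I = range E"
  define g where "g x = F (SOME xs. E xs = x)" for x
  have app: "E (xs @ ys) = E xs + E ys" "F (xs @ ys) = F xs + F ys" for xs ys
    by (simp_all add: E_def F_def)
  have lm: "E (map (\<lambda>(r, s). (a * r, s)) xs) = a * E xs" "F (map (\<lambda>(r, s). (a * r, s)) xs) = a * F xs" for a xs
    unfolding E_def F_def by (induction xs) (auto simp: algebra_simps)
  have rm: "E (map (\<lambda>(r, s). (r, s * a)) xs) = E xs * a" "F (map (\<lambda>(r, s). (r, s * a)) xs) = F xs * a" for a xs
    unfolding E_def F_def by (induction xs) (auto simp: algebra_simps)
  have eqF: "F xs = F ys" if "E xs = E ys" for xs ys
  proof -
    have "E (xs @ map (\<lambda>(r, s). (- 1 * r, s)) ys) = 0" unfolding app lm using that by simp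
    then have "F (xs @ map (\<lambda>(r, s). (- 1 * r, s)) ys) = 0" using wd unfolding E_def F_def by blast
    then show ?thesis unfolding app lm by simp
  qed
  have gE: "g (E xs) = F xs" for xs
    unfolding g_def by (rule eqF) (rule someI, rule refl)
  have E1: "E [(1, 1)] = e" and F1: "F [(1, 1)] = f" by (simp_all add: E_def F_def)
  have E0: "E [] = 0" by (simp add: E_def)
  have ideal: "nonzero_ideal I"
    unfolding nonzero_ideal_def I_def
  proof (intro conjI ballI allI)
    show "0 \<in> range E" using E0 by (metis rangeI)
    show "range E \<noteq> {0}" using E1 e by (metis rangeI singletonD)
    fix x assume "x \<in> range E"
    then obtain xs where x: "x = E xs" by auto
    show "- x \<in> range E" using lm(1)[of "- 1" xs] x by (metis mult_minus1 rangeI)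
    show "r * x \<in> range E" for r using lm(1)[of r xs] x by (metis rangeI)
    show "x * r \<in> range E" for r using rm(1)[of r xs] x by (metis rangeI)
    fix y assume "y \<in> range E"
    then obtain ys where y: "y = E ys" by auto
    show "x + y \<in> range E" using app(1)[of xs ys] x y by (metis rangeI)
  qed
  have "\<exists>c. \<forall>x\<in>I. g x = sc c x"
  proof (rule cc[unfolded centrally_closed_def, rule_format], intro conjI ballI allI ideal)
    fix x y r assume "x \<in> I"
    then obtain xs where x: "x = E xs" by (auto simp: I_def)
    show "g (r * x) = r * g x" using lm[of r xs] gE x by metis
    show "g (x * r) = g x * r" using rm[of r xs] gE x by metis
    assume "y \<in> I"
    then obtain ys where y: "y = E ys" by (auto simp: I_def)
    show "g (x + y) = g x + g y" using app[of xs ys] gE x y by metis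
  qed
  then obtain c where "\<forall>x\<in>I. g x = sc c x" by blast
  then have "f = sc c e" using gE[of "[(1,1)]"] E1 F1 by (metis I_def rangeI)
  then show ?thesis using that by blast
qed

text \<open>Over a centrally closed prime algebra, tensors act faithfully. Induction on the number
  of terms: if an operation \<Sum> r _ s annihilates \<open>e i\<close>, it turns the relation into
  a shorter one and so annihilates every \<open>e k\<close>; hence each \<open>e k\<close> is a
  scalar multiple of \<open>e i\<close>. The relation becomes e_i a b = 0 with b a combination of
  the right factors, and primeness applies.\<close>

lemma tensor_indep_zero:
  assumes "finite I" "fam_indep sc I b" "\<And>a. (\<Sum>i\<in>I. e i * a * b i) = 0" "i \<in> I"
  shows "e i = 0"
  using assms
proof (induction "card I" arbitrary: I e i)
  case 0
  then show ?case by simp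
next
  case (Suc n)
  show ?case
  proof (rule ccontr)
    assume nz: "e i \<noteq> 0"
    let ?J = "I - {i}"
    have J: "n = card ?J" "finite ?J" using Suc by auto
    have indJ: "fam_indep sc ?J b"
      unfolding fam_indep_def
    proof (intro allI impI)
      fix c assume "(\<Sum>k\<in>?J. sc (c k) (b k)) = 0"
      moreover have "(\<Sum>k\<in>I. sc ((c(i := 0)) k) (b k)) = (\<Sum>k\<in>?J. sc (c k) (b k))"
        using Suc.prems(1,4) by (subst sum.remove[of _ i]) (auto intro!: sum.cong)
      ultimately have "(c(i := 0)) k = 0" if "k \<in> I" for k
        using fam_indepD[OF Suc.prems(2) _ that, of "c(i := 0)"] by simp
      then show "\<forall>k\<in>?J. c k = 0" by (metis DiffE fun_upd_other insertCI)
    qed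
    have "\<exists>c. e k = sc c (e i)" if "k \<in> I" for k
    proof (cases "k = i")
      case False
      then have k: "k \<in> ?J" using that by simp
      show ?thesis
      proof (rule proportional_if_bimodule_map[OF nz, of "e k"])
        fix xs assume 0: "(\<Sum>(r, s)\<leftarrow>xs. r * e i * s) = 0"
        let ?e = "\<lambda>k. \<Sum>(r, s)\<leftarrow>xs. r * e k * s"
        have tot: "(\<Sum>k\<in>I. ?e k * a * b k) = 0" for a
        proof -
          have "(\<Sum>k\<in>I. ?e k * a * b k) = (\<Sum>(r, s)\<leftarrow>xs. r * (\<Sum>k\<in>I. e k * (s * a) * b k))"
            by (induction xs) (auto simp: algebra_simps sum.distrib sum_distrib_left)
          then show ?thesis using Suc.prems(3) by (simp add: case_prod_unfold)
        qed
        have "(\<Sum>k\<in>?J. ?e k * a * b k) = 0" for a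
          using tot[of a] 0 Suc.prems(1,4) by (simp add: sum.remove[of I i])
        from Suc.hyps(1)[OF J indJ this k] show "?e k = 0" .
      qed blast
    qed (metis scale_one)
    then obtain c where c: "\<And>k. k \<in> I \<Longrightarrow> e k = sc (c k) (e i)" by metis
    have "e i * a * (\<Sum>k\<in>I. sc (c k) (b k)) = (\<Sum>k\<in>I. e k * a * b k)" for a
      unfolding sum_distrib_left by (rule sum.cong) (auto simp: c mult_sc sc_mult)
    then have "(\<Sum>k\<in>I. sc (c k) (b k)) = 0"
      using primeD[of "e i"] nz Suc.prems(3) by metis
    then have "c i = 0" by (rule fam_indepD[OF Suc.prems(2) _ Suc.prems(4)])
    then show False using c[OF Suc.prems(4)] nz by simp
  qed
qed

text \<open>A tensor that acts as zero is zero, so a functional may be applied to its left factors.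
  If the right factors are independent, all left factors vanish; otherwise one \<open>b j\<close> is
  a combination of the others, and its term is absorbed into their left factors.\<close>

lemma tensor_functional:
  assumes "finite I" "\<And>a. (\<Sum>i\<in>I. e i * a * b i) = 0" "functional sc w"
  shows "(\<Sum>i\<in>I. sc (w (e i)) (b i)) = 0"
  using assms(1,2)
proof (induction "card I" arbitrary: I e)
  case 0
  then show ?case by simp
next
  case (Suc n)
  show ?case
  proof (cases "fam_indep sc I b")
    case True
    show ?thesis
      using tensor_indep_zero[OF Suc.prems(1) True, of e] Suc.prems(2) functional_simps(3)[OF assms(3)]
      by simp
  next
    case False
    then obtain c j where c: "(\<Sum>i\<in>I. sc (c i) (b i)) = 0" and j: "j \<in> I" "c j \<noteq> 0"
      unfolding fam_indep_def by blast
    let ?J = "I - {j}"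
    let ?d = "\<lambda>i. - c i / c j"
    have bj: "b j = (\<Sum>i\<in>?J. sc (?d i) (b i))"
    proof -
      have "sc (c j) (b j) = - (\<Sum>i\<in>?J. sc (c i) (b i))"
        using c Suc.prems(1) j(1) by (simp add: sum.remove[of I j] add_eq_0_iff2)
      then have "sc (1 / c j) (sc (c j) (b j)) = (\<Sum>i\<in>?J. sc (?d i) (b i))"
        by (simp add: scale_sum_right sum_negf scale_minus_left)
      then show ?thesis using j(2) by simp
    qed
    have rw: "(\<Sum>i\<in>I. e i * a * b i) = (\<Sum>i\<in>?J. (e i + sc (?d i) (e j)) * a * b i)" for a
    proof -
      have "e j * a * b j = (\<Sum>i\<in>?J. sc (?d i) (e j) * a * b i)"
        by (subst bj) (simp add: sum_distrib_left mult_sc sc_mult)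
      then show ?thesis
        using Suc.prems(1) j(1)
        by (simp only: sum.remove[of I j] distrib_right sum.distrib add.commute)
    qed
    have "(\<Sum>i\<in>?J. sc (w (e i + sc (?d i) (e j))) (b i)) = 0"
      by (rule Suc.hyps(1)) (use Suc rw j in auto)
    moreover have "(\<Sum>i\<in>?J. sc (w (e i + sc (?d i) (e j))) (b i))
        = (\<Sum>i\<in>?J. sc (w (e i)) (b i)) + sc (w (e j)) (b j)"
    proof -
      have "sc (w (e j)) (b j) = (\<Sum>i\<in>?J. sc (?d i * w (e j)) (b i))"
        by (subst bj) (simp add: scale_sum_right mult.commute)
      then show ?thesis
        unfolding functional_simps(1,2)[OF assms(3)] by (simp only: scale_left_distrib sum.distrib)
    qed
    ultimately show ?thesis using Suc.prems(1) j(1) by (simp add: sum.remove[of I j] add.commute)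
  qed
qed

text \<open>Functionals on the two sides commute: a functional detecting the left-hand side would
  contradict \<open>tensor_functional\<close>.\<close>

lemma tensor_functional_left:
  assumes "finite I" "\<And>a. (\<Sum>i\<in>I. e i * a * b i) = 0" "functional sc w"
  shows "(\<Sum>i\<in>I. sc (w (b i)) (e i)) = 0"
proof (rule ccontr)
  assume "(\<Sum>i\<in>I. sc (w (b i)) (e i)) \<noteq> 0"
  then obtain u where u: "functional sc u" "u (\<Sum>i\<in>I. sc (w (b i)) (e i)) \<noteq> 0"
    using separating_functional by blast
  have "w (\<Sum>i\<in>I. sc (u (e i)) (b i)) = 0"
    using tensor_functional[OF assms(1,2) u(1)] functional_simps(3)[OF assms(3)] by simp
  then show False
    using u(2) unfolding functional_simps(2,6)[OF assms(3)] functional_simps(2,6)[OF u(1)]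
    by (simp add: mult.commute)
qed

text \<open>Multiplication by a central element is a bimodule map on the ideal A itself.\<close>

lemma central_imp_scalar:
  assumes "\<And>a. x * a = a * x"
  obtains c where "x = sc c 1"
proof -
  have "\<exists>c. \<forall>y\<in>UNIV. x * y = sc c y"
  proof (rule cc[unfolded centrally_closed_def, rule_format], intro conjI ballI allI)
    have "(1::'b) \<noteq> 0" by simp
    then show "nonzero_ideal (UNIV :: 'b set)" unfolding nonzero_ideal_def by (metis UNIV_I singletonD)
    fix y z r :: 'b
    show "x * (y + z) = x * y + x * z" by (rule distrib_left)
    show "x * (r * y) = r * (x * y)" by (metis assms mult.assoc)
    show "x * (y * r) = x * y * r" by (simp add: mult.assoc)
  qed
  then show ?thesis using that by (metis UNIV_I mult_1_right)
qed

end

subsection \<open>Peeling multilinear identities\<close>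

text \<open>The coefficient maps of the functional identities are arbitrary maps; the only thing
  recorded is which variables they may involve, tested by changing one outside variable at a
  time.\<close>

definition local_on :: "nat set \<Rightarrow> ((nat \<Rightarrow> 'r) \<Rightarrow> 'c) \<Rightarrow> bool" where
  "local_on S G \<longleftrightarrow> (\<forall>x k y. k \<notin> S \<longrightarrow> G (x(k := y)) = G x)"

lemma local_onD: "local_on S G \<Longrightarrow> k \<notin> S \<Longrightarrow> G (x(k := y)) = G x"
  unfolding local_on_def by blast

text \<open>The complete linearization of X^i b(X) X^j, where \<open>\<beta>\<close> is that of b:
  the sum over all ways to put i of the variables in order on the left and j on the right, the
  remaining ones entering \<open>\<beta>\<close>. Outer factors are chosen first, the left ones
  before the right ones, so peeling undoes one recursion step at a time.\<close>

fun words :: "(nat set \<Rightarrow> (nat \<Rightarrow> 'r) \<Rightarrow> 'r) \<Rightarrow> nat \<Rightarrow> nat \<Rightarrow> nat set \<Rightarrow> (nat \<Rightarrow> 'r) \<Rightarrow> 'r::ring_1" where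
  "words \<beta> 0 0 S x = \<beta> S x"
| "words \<beta> 0 (Suc j) S x = (\<Sum>k\<in>S. words \<beta> 0 j (S - {k}) x * x k)"
| "words \<beta> (Suc i) j S x = (\<Sum>k\<in>S. x k * words \<beta> i j (S - {k}) x)"

lemma local_on_words:
  assumes "\<And>S. local_on S (\<beta> S)"
  shows "local_on S (words \<beta> i j S)"
proof -
  have base: "words \<beta> 0 j S (x(k := y)) = words \<beta> 0 j S x" if "k \<notin> S" for j x k y S
    using that
  proof (induction j arbitrary: S)
    case 0
    then show ?case unfolding words.simps by (rule local_onD[OF assms])
  next
    case (Suc j)
    then show ?case by (auto intro!: sum.cong)
  qed
  have "words \<beta> i j S (x(k := y)) = words \<beta> i j S x" if "k \<notin> S" for x k y
    using that by (induction i arbitrary: S) (auto intro!: sum.cong simp: base)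
  then show ?thesis unfolding local_on_def by blast
qed

section \<open>Operators annihilating left factors\<close>

definition lsub :: "'r::ring_1 \<Rightarrow> nat set \<Rightarrow> (nat \<Rightarrow> 'r) \<Rightarrow> nat \<Rightarrow> 'r" where
  "lsub T U x k = (if k \<in> U then T * x k else x k)"

text \<open>This is the composition, over k in S, of the commuting operators sending G to
  the map x \<mapsto> G (x with T * x k in place of x k) - T * G x.\<close>
definition kill :: "'r::ring_1 \<Rightarrow> nat set \<Rightarrow> ((nat \<Rightarrow> 'r) \<Rightarrow> 'r) \<Rightarrow> (nat \<Rightarrow> 'r) \<Rightarrow> 'r" where
  "kill T S G x = (\<Sum>U\<in>Pow S. (- T) ^ card (S - U) * G (lsub T U x))"

lemma local_on_lsub:
  assumes "local_on S G" "finite S" "x' = lsub T (insert k U) x" "k \<notin> S"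
  shows "G x' = G (lsub T U x)"
proof -
  have "x' = (lsub T U x)(k := T * x k)" using assms(3) by (auto simp: lsub_def fun_eq_iff)
  then show ?thesis using local_onD[OF assms(1,4)] by metis
qed

text \<open>The subsets with k and those without k give the two terms of the operator for k, applied
  together with the operators for S.\<close>

lemma kill_insert:
  assumes "finite S" "k \<notin> S"
  shows "kill T (insert k S) G x =
    (\<Sum>U\<in>Pow S. (- T) ^ card (S - U) * G (lsub T (insert k U) x)) - T * kill T S G x"
proof -
  have "kill T (insert k S) G x = (\<Sum>U\<in>Pow S. (- T) ^ card (insert k S - U) * G (lsub T U x))
      + (\<Sum>U\<in>insert k ` Pow S. (- T) ^ card (insert k S - U) * G (lsub T U x))"
    unfolding kill_def Pow_insert using assms by (intro sum.union_disjoint) auto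
  also have "(\<Sum>U\<in>insert k ` Pow S. (- T) ^ card (insert k S - U) * G (lsub T U x))
      = (\<Sum>U\<in>Pow S. (- T) ^ card (S - U) * G (lsub T (insert k U) x))"
  proof (subst sum.reindex)
    show "inj_on (insert k) (Pow S)" using assms by (auto simp: inj_on_def)
    show "sum ((\<lambda>U. (- T) ^ card (insert k S - U) * G (lsub T U x)) \<circ> insert k) (Pow S) =
      (\<Sum>U\<in>Pow S. (- T) ^ card (S - U) * G (lsub T (insert k U) x))"
    proof (rule sum.cong)
      fix U assume "U \<in> Pow S"
      have "insert k S - insert k U = S - U" using assms(2) by auto
      then show "((\<lambda>U. (- T) ^ card (insert k S - U) * G (lsub T U x)) \<circ> insert k) U =
        (- T) ^ card (S - U) * G (lsub T (insert k U) x)" by simp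
    qed simp
  qed
  also have "(\<Sum>U\<in>Pow S. (- T) ^ card (insert k S - U) * G (lsub T U x)) = - T * kill T S G x"
    unfolding kill_def sum_distrib_left
  proof (rule sum.cong)
    fix U assume "U \<in> Pow S"
    then have "insert k S - U = insert k (S - U)" "k \<notin> S - U" using assms(2) by auto
    then show "(- T) ^ card (insert k S - U) * G (lsub T U x) = - T * ((- T) ^ card (S - U) * G (lsub T U x))"
      using assms(1) by (simp add: mult.assoc)
  qed simp
  finally show ?thesis by simp
qed

lemma local_on_kill:
  assumes "local_on S G"
  shows "local_on S (kill T S' G)"
  unfolding local_on_def
proof (intro allI impI)
  fix x k y assume k: "k \<notin> S"
  have "lsub T U (x(k := y)) = (lsub T U x)(k := lsub T U (x(k := y)) k)" for U
    by (auto simp: lsub_def fun_eq_iff)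
  then have "G (lsub T U (x(k := y))) = G (lsub T U x)" for U
    using local_onD[OF assms k] by metis
  then show "kill T S' G (x(k := y)) = kill T S' G x" unfolding kill_def by simp
qed

text \<open>As \<open>F\<close> does not involve x_k, replacing x_k by T x_k multiplies x_k F by T
  from the left, and the operator for k subtracts exactly this. The powers of -T in front commute
  with T.\<close>

lemma kill_left_mult:
  assumes "finite S" "k \<in> S" "local_on (S - {k}) F"
  shows "kill T S (\<lambda>x. x k * F x) x = 0"
proof -
  let ?S = "S - {k}"
  have S: "S = insert k ?S" "finite ?S" "k \<notin> ?S" using assms by auto
  have "(- T) ^ n * T = T * (- T) ^ n" for n
    using power_commutes[of "- T" n] by simp
  then have comm: "(- T) ^ n * (T * z) = T * ((- T) ^ n * z)" for n z by (metis mult.assoc)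
  have "kill T S (\<lambda>x. x k * F x) x =
    (\<Sum>U\<in>Pow ?S. (- T) ^ card (?S - U) * (T * x k * F (lsub T (insert k U) x)))
      - T * (\<Sum>U\<in>Pow ?S. (- T) ^ card (?S - U) * (lsub T U x k * F (lsub T U x)))"
    by (subst S(1), subst kill_insert[OF S(2,3)]) (simp add: kill_def lsub_def)
  also have "\<dots> = 0"
    unfolding sum_distrib_left right_minus_eq
  proof (rule sum.cong)
    fix U assume "U \<in> Pow ?S"
    then have "lsub T U x k = x k" by (auto simp: lsub_def)
    moreover have "F (lsub T (insert k U) x) = F (lsub T U x)"
      by (rule local_on_lsub[OF assms(3) S(2) refl S(3)])
    ultimately show "(- T) ^ card (?S - U) * (T * x k * F (lsub T (insert k U) x)) =
        T * ((- T) ^ card (?S - U) * (lsub T U x k * F (lsub T U x)))"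
      by (simp add: mult.assoc comm)
  qed simp
  finally show ?thesis .
qed

text \<open>On E x_k the operator for k gives E T x_k - T E x_k: the variable stays on the right,
  behind a commutator with T.\<close>

lemma kill_right_mult:
  assumes "finite S" "k \<in> S" "local_on (S - {k}) E"
  shows "kill T S (\<lambda>x. E x * x k) x =
    (kill T (S - {k}) E x * T - T * kill T (S - {k}) E x) * x k"
proof -
  let ?S = "S - {k}"
  have S: "S = insert k ?S" "finite ?S" "k \<notin> ?S" using assms by auto
  have "kill T S (\<lambda>x. E x * x k) x =
    (\<Sum>U\<in>Pow ?S. (- T) ^ card (?S - U) * (E (lsub T (insert k U) x) * (T * x k)))
      - T * (\<Sum>U\<in>Pow ?S. (- T) ^ card (?S - U) * (E (lsub T U x) * lsub T U x k))"
    by (subst S(1), subst kill_insert[OF S(2,3)]) (simp add: kill_def lsub_def)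
  also have "(\<Sum>U\<in>Pow ?S. (- T) ^ card (?S - U) * (E (lsub T (insert k U) x) * (T * x k))) =
      kill T ?S E x * (T * x k)"
    unfolding kill_def sum_distrib_right
    by (rule sum.cong) (auto simp: mult.assoc local_on_lsub[OF assms(3) S(2) refl S(3)])
  also have "(\<Sum>U\<in>Pow ?S. (- T) ^ card (?S - U) * (E (lsub T U x) * lsub T U x k)) = kill T ?S E x * x k"
    unfolding kill_def sum_distrib_right
    by (rule sum.cong) (auto simp: mult.assoc lsub_def)
  finally show ?thesis by (simp add: algebra_simps)
qed

lemma kill_sum: "kill T S (\<lambda>x. \<Sum>i\<in>A. G i x) x = (\<Sum>i\<in>A. kill T S (G i) x)"
  unfolding kill_def sum_distrib_left by (rule sum.swap)

lemma kill_central_mult: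
  assumes "\<And>z. c * z = z * c"
  shows "kill T S (\<lambda>x. c * G x) x = c * kill T S G x"
proof -
  have "a * (c * b) = c * (a * b)" for a b by (metis assms mult.assoc)
  then show ?thesis unfolding kill_def sum_distrib_left by (simp only:)
qed

section \<open>Functional identities with only the trivial solution\<close>

definition right_free :: "nat \<Rightarrow> 'r::ring_1 itself \<Rightarrow> bool" where
  "right_free m _ \<longleftrightarrow> (\<forall>(S::nat set) (E :: nat \<Rightarrow> (nat \<Rightarrow> 'r) \<Rightarrow> 'r). finite S \<longrightarrow> card S \<le> m \<longrightarrow>
     (\<forall>k\<in>S. local_on (S - {k}) (E k)) \<longrightarrow> (\<forall>x. (\<Sum>k\<in>S. E k x * x k) = 0) \<longrightarrow> (\<forall>k\<in>S. \<forall>x. E k x = 0))"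

definition left_free :: "nat \<Rightarrow> 'r::ring_1 itself \<Rightarrow> bool" where
  "left_free m _ \<longleftrightarrow> (\<forall>(S::nat set) (F :: nat \<Rightarrow> (nat \<Rightarrow> 'r) \<Rightarrow> 'r). finite S \<longrightarrow> card S \<le> m \<longrightarrow>
     (\<forall>k\<in>S. local_on (S - {k}) (F k)) \<longrightarrow> (\<forall>x. (\<Sum>k\<in>S. x k * F k x) = 0) \<longrightarrow> (\<forall>k\<in>S. \<forall>x. F k x = 0))"

text \<open>The commutator of T with a sum \<Sum> C_k x_k contains both C_k x_k T and - T C_k x_k;
  this is why right factors x_k and x_k T are allowed side by side.\<close>

definition right_free_at :: "nat \<Rightarrow> 'r::ring_1 \<Rightarrow> bool" where
  "right_free_at m T \<longleftrightarrow> (\<forall>(S::nat set) (E :: nat \<Rightarrow> (nat \<Rightarrow> 'r) \<Rightarrow> 'r) E'. finite S \<longrightarrow> card S \<le> m \<longrightarrow>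
     (\<forall>k\<in>S. local_on (S - {k}) (E k) \<and> local_on (S - {k}) (E' k)) \<longrightarrow>
     (\<forall>x. (\<Sum>k\<in>S. E k x * x k + E' k x * x k * T) = 0) \<longrightarrow> (\<forall>k\<in>S. \<forall>x. E k x = 0 \<and> E' k x = 0))"

lemma right_freeD:
  assumes "right_free m TYPE('r::ring_1)" "finite S" "card S \<le> m"
    "\<And>k. k \<in> S \<Longrightarrow> local_on (S - {k}) (E k)" "\<And>x. (\<Sum>k\<in>S. E k x * x k) = (0::'r)" "k \<in> S"
  shows "E k x = 0"
  by (rule assms(1)[unfolded right_free_def, rule_format, OF assms(2,3,4,5,6)])

lemma left_freeD:
  assumes "left_free m TYPE('r::ring_1)" "finite S" "card S \<le> m"
    "\<And>k. k \<in> S \<Longrightarrow> local_on (S - {k}) (F k)" "\<And>x. (\<Sum>k\<in>S. x k * F k x) = (0::'r)" "k \<in> S"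
  shows "F k x = 0"
  by (rule assms(1)[unfolded left_free_def, rule_format, OF assms(2,3,4,5,6)])

lemma right_free_atD:
  assumes "right_free_at m (T::'r::ring_1)" "finite S" "card S \<le> m"
    "\<And>k. k \<in> S \<Longrightarrow> local_on (S - {k}) (E k)" "\<And>k. k \<in> S \<Longrightarrow> local_on (S - {k}) (E' k)"
    "\<And>x. (\<Sum>k\<in>S. E k x * x k + E' k x * x k * T) = 0" "k \<in> S"
  shows "E k x = 0" "E' k x = 0"
  using assms(1)[unfolded right_free_at_def, rule_format, OF assms(2,3) conjI[OF assms(4,5)] assms(6) assms(7), of x]
  by simp_all

lemma kill_words_right:
  assumes "\<And>S. local_on S (\<beta> S)" "finite S"
  shows "kill T S (words \<beta> 0 (Suc j) S) x =
    (\<Sum>k\<in>S. (kill T (S - {k}) (words \<beta> 0 j (S - {k})) x * T - T * kill T (S - {k}) (words \<beta> 0 j (S - {k})) x) * x k)"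
proof -
  have "kill T S (words \<beta> 0 (Suc j) S) x = (\<Sum>k\<in>S. kill T S (\<lambda>x. words \<beta> 0 j (S - {k}) x * x k) x)"
    by (subst kill_sum[symmetric]) (simp add: kill_def)
  also have "\<dots> = (\<Sum>k\<in>S. (kill T (S - {k}) (words \<beta> 0 j (S - {k})) x * T - T * kill T (S - {k}) (words \<beta> 0 j (S - {k})) x) * x k)"
    by (rule sum.cong) (auto intro!: kill_right_mult assms(2) local_on_words assms(1))
  finally show ?thesis .
qed

lemma kill_words_left:
  assumes "\<And>S. local_on S (\<beta> S)" "finite S"
  shows "kill T S (words \<beta> (Suc i) j S) x = 0"
proof -
  have "kill T S (words \<beta> (Suc i) j S) x = (\<Sum>k\<in>S. kill T S (\<lambda>x. x k * words \<beta> i j (S - {k}) x) x)"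
    by (subst kill_sum[symmetric]) (simp add: kill_def)
  also have "\<dots> = 0"
    by (rule sum.neutral) (auto intro!: kill_left_mult assms(2) local_on_words assms(1))
  finally show ?thesis .
qed

text \<open>Descent on j. By \<open>kill_words_right\<close>, commutation with T for j + 1 reads
  \<Sum> (C_l x_l T - T C_l x_l) = 0, where C_l is the commutator for j; freeness at T gives C_l =
  0.\<close>

lemma kill_words_commutes:
  assumes loc: "\<And>S. local_on S (\<beta> S)"
    and ru: "right_free_at (m - 1) T" and jm: "j + r \<le> m - 1"
    and comm: "\<And>S x. finite S \<Longrightarrow> card S = j + r \<Longrightarrow>
        kill T S (words \<beta> 0 j S) x * T = T * kill T S (words \<beta> 0 j S) x"
    and S: "finite S" "card S = r"
  shows "kill T S (\<beta> S) x * T = T * kill T S (\<beta> S) x"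
  using jm comm
proof (induction j)
  case 0
  then show ?case using S by (simp add: kill_def)
next
  case (Suc j)
  show ?case
  proof (rule Suc.IH)
    show "j + r \<le> m - 1" using Suc.prems by simp
    fix S :: "nat set" and x assume S: "finite S" "card S = j + r"
    \<comment> \<open>A fresh variable enlarges S to a set to which the hypothesis for j + 1
      applies; the coefficient of this variable is the commutator wanted for S.\<close>
    obtain k where k: "k \<notin> S" using S(1) ex_new_if_finite infinite_UNIV_nat by blast
    let ?S = "insert k S"
    define C where "C l x = kill T (?S - {l}) (words \<beta> 0 j (?S - {l})) x * T
        - T * kill T (?S - {l}) (words \<beta> 0 j (?S - {l})) x" for l x
    have locC: "local_on (?S - {l}) (C l)" for l
      using local_on_kill[OF local_on_words[of \<beta>, OF loc]] unfolding C_def local_on_def by simp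
    have "C k x = 0"
    proof (rule right_free_atD(2)[OF ru, of ?S "\<lambda>l x. - T * C l x" C])
      show "finite ?S" "card ?S \<le> m - 1" using S k Suc.prems by auto
      show "local_on (?S - {l}) (\<lambda>x. - T * C l x)" "local_on (?S - {l}) (C l)" for l
        using locC[of l] unfolding local_on_def by simp_all
      fix x
      have "kill T ?S (words \<beta> 0 (Suc j) ?S) x * T = T * kill T ?S (words \<beta> 0 (Suc j) ?S) x"
        by (rule Suc.prems(2)) (use S k in auto)
      then show "(\<Sum>l\<in>?S. - T * C l x * x l + C l x * x l * T) = 0"
        unfolding kill_words_right[OF loc finite.insertI[OF S(1)]] C_def[symmetric]
        by (simp only: sum_distrib_left sum_distrib_right sum.distrib mult.assoc)
          (simp add: sum_negf)
    qed simp
    then show "kill T S (words \<beta> 0 j S) x * T = T * kill T S (words \<beta> 0 j S) x"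
      using k unfolding C_def by simp
  qed
qed

text \<open>Terms with i > 0 begin with a variable and are killed, so only the term with i = 0
  survives, and its coefficient can be cancelled. Its last right factor is removed by plain freeness
  in up to m variables. From then on only commutation with T is known, in at most m - 1 variables,
  which is why freeness at T is asked for m - 1.\<close>

lemma peel_nonzero_left:
  assumes loc: "\<And>S. local_on S (\<beta> S)"
    and ru0: "right_free m TYPE('r::ring_1)" and ru: "right_free_at (m - 1) (T::'r)"
    and nr: "n + r \<le> m"
    and central: "\<And>i z. c i * z = z * c i" and c0: "\<And>z. c 0 * z = 0 \<Longrightarrow> z = 0"
    and id: "\<And>S x. finite S \<Longrightarrow> card S = n + r \<Longrightarrow> (\<Sum>i\<le>n. c i * words \<beta> i (n - i) S x) = 0"
    and S: "finite S" "card S = r"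
  shows "kill T S (\<beta> S) x * T = T * kill T S (\<beta> S) x"
proof -
  have K: "kill T S (words \<beta> 0 n S) x = 0" if "finite S" "card S = n + r" for S x
  proof -
    have "0 = kill T S (\<lambda>x. \<Sum>i\<le>n. c i * words \<beta> i (n - i) S x) x"
      unfolding id[OF that] by (simp add: kill_def)
    also have "\<dots> = (\<Sum>i\<le>n. c i * kill T S (words \<beta> i (n - i) S) x)"
      unfolding kill_sum by (rule sum.cong) (auto intro!: kill_central_mult central)
    also have "\<dots> = c 0 * kill T S (words \<beta> 0 n S) x"
    proof -
      have "c i * kill T S (words \<beta> i (n - i) S) x = 0" if "i \<noteq> 0" for i
        using kill_words_left[OF loc \<open>finite S\<close>] that by (cases i) auto
      then show ?thesis by (subst sum.remove[of _ 0]) (auto intro!: sum.neutral)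
    qed
    finally show ?thesis using c0 by simp
  qed
  show ?thesis
  proof (cases n)
    case 0
    then show ?thesis using K[OF S(1)] S(2) by (simp add: kill_def)
  next
    case (Suc j)
    show ?thesis
    proof (rule kill_words_commutes[OF loc ru _ _ S])
      show "j + r \<le> m - 1" using nr Suc by simp
      fix S :: "nat set" and x assume S: "finite S" "card S = j + r"
      obtain k where k: "k \<notin> S" using S(1) ex_new_if_finite infinite_UNIV_nat by blast
      let ?S = "insert k S"
      define C where "C l x = kill T (?S - {l}) (words \<beta> 0 j (?S - {l})) x * T
          - T * kill T (?S - {l}) (words \<beta> 0 j (?S - {l})) x" for l x
      have locC: "local_on (?S - {l}) (C l)" for l
        using local_on_kill[OF local_on_words[of \<beta>, OF loc]] unfolding C_def local_on_def by simp
      have "C k x = 0"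
      proof (rule right_freeD[OF ru0, of ?S C])
        show "finite ?S" "card ?S \<le> m" using S k nr Suc by auto
        show "local_on (?S - {l}) (C l)" for l by (rule locC)
        show "(\<Sum>l\<in>?S. C l x * x l) = 0" for x
          using K[of ?S x] S k Suc kill_words_right[OF loc finite.insertI[OF S(1)], where j = j]
          unfolding C_def by simp
      qed simp
      then show "kill T S (words \<beta> 0 j S) x * T = T * kill T S (words \<beta> 0 j S) x"
        using k unfolding C_def by simp
    qed
  qed
qed

text \<open>If c 0 = 0, every term begins with a variable, left freeness strips it and the
  coefficients shift by one. Since some coefficient is nonzero, the shift ends in the situation of
  \<open>peel_nonzero_left\<close>.\<close>

theorem peel:
  assumes loc: "\<And>S. local_on S (\<beta> S)"
    and ru0: "right_free m TYPE('r::ring_1)" and lu0: "left_free m TYPE('r)"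
    and ru: "right_free_at (m - 1) (T::'r)"
    and nr: "n + r \<le> m"
    and central: "\<And>i z. c i * z = z * c i"
    and c: "\<And>i. c i = 0 \<or> (\<forall>z. c i * z = 0 \<longrightarrow> z = 0)" and nz: "\<exists>i\<le>n. c i \<noteq> 0"
    and id: "\<And>S x. finite S \<Longrightarrow> card S = n + r \<Longrightarrow> (\<Sum>i\<le>n. c i * words \<beta> i (n - i) S x) = 0"
    and S: "finite S" "card S = r"
  shows "kill T S (\<beta> S) x * T = T * kill T S (\<beta> S) x"
  using nr central c nz id
proof (induction n arbitrary: c)
  case 0
  then show ?case
    by (intro peel_nonzero_left[OF loc ru0 ru, where n = 0 and c = c and r = r]) (use S in auto)
next
  case (Suc n)
  show ?case
  proof (cases "c 0 = 0")
    case False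
    then show ?thesis
      using Suc.prems S
      by (intro peel_nonzero_left[OF loc ru0 ru, where n = "Suc n" and c = c and r = r]) blast+
  next
    case True
    show ?thesis
    proof (rule Suc.IH[where c = "\<lambda>i. c (Suc i)"])
      show "n + r \<le> m" using Suc.prems by simp
      show "\<exists>i\<le>n. c (Suc i) \<noteq> 0"
        using Suc.prems(4) True by (metis Suc_le_mono not0_implies_Suc)
      fix S :: "nat set" and x assume S: "finite S" "card S = n + r"
      obtain k where k: "k \<notin> S" using S(1) ex_new_if_finite infinite_UNIV_nat by blast
      let ?S = "insert k S"
      define F where "F l x = (\<Sum>i\<le>n. c (Suc i) * words \<beta> i (n - i) (?S - {l}) x)" for l x
      have "F k x = 0"
      proof (rule left_freeD[OF lu0, of ?S F])
        show "finite ?S" "card ?S \<le> m" using S k Suc.prems by auto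
        show "local_on (?S - {l}) (F l)" for l
          using local_on_words[of \<beta>, OF loc] unfolding F_def local_on_def by simp
        fix x
        have "0 = (\<Sum>i\<le>Suc n. c i * words \<beta> i (Suc n - i) ?S x)"
          by (rule Suc.prems(5)[symmetric]) (use S k in auto)
        also have "\<dots> = (\<Sum>i\<le>n. \<Sum>l\<in>?S. c (Suc i) * (x l * words \<beta> i (n - i) (?S - {l}) x))"
          using True unfolding sum.atMost_Suc_shift by (simp add: sum_distrib_left)
        also have "\<dots> = (\<Sum>l\<in>?S. x l * F l x)"
        proof -
          have "c (Suc i) * (a * b) = a * (c (Suc i) * b)" for i a b
            by (metis Suc.prems(2) mult.assoc)
          then show ?thesis unfolding F_def sum_distrib_left by (subst sum.swap) (simp only:)
        qed
        finally show "(\<Sum>l\<in>?S. x l * F l x) = 0" by simp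
      qed simp
      then show "(\<Sum>i\<le>n. c (Suc i) * words \<beta> i (n - i) S x) = 0"
        using k unfolding F_def by simp
    qed (use Suc.prems in blast)+
  qed
qed

subsection \<open>Polarization and extension to power series\<close>

text \<open>The mixed finite difference of p at 0 in the directions x_k, k in S. It is the complete
  linearization when p has degree card S, and zero when the degree is smaller; nothing is divided by
  factorials.\<close>

definition polarize :: "nat set \<Rightarrow> ('r::ring_1 \<Rightarrow> 'r) \<Rightarrow> (nat \<Rightarrow> 'r) \<Rightarrow> 'r" where
  "polarize S p x = (\<Sum>T\<in>Pow S. (- 1) ^ card (S - T) * p (sum x T))"

lemma local_on_polarize: "local_on S (polarize S p)"
  unfolding local_on_def polarize_def
proof (intro allI impI sum.cong refl)
  fix x :: "nat \<Rightarrow> 'a" and k y T assume "k \<notin> S" "T \<in> Pow S"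
  then have "sum (x(k := y)) T = sum x T" by (intro sum.cong) auto
  then show "(- 1) ^ card (S - T) * p (sum (x(k := y)) T) = (- 1) ^ card (S - T) * p (sum x T)" by simp
qed

lemma neg_one_power_commute: "(- 1) ^ n * (z::'r::ring_1) = z * (- 1) ^ n"
  by (cases "even n") auto

lemma polarize_left: "polarize S (\<lambda>X. a * p X) x = a * polarize S p x"
  unfolding polarize_def sum_distrib_left
  by (rule sum.cong) (simp_all add: neg_one_power_commute mult.assoc)

lemma polarize_right: "polarize S (\<lambda>X. p X * a) x = polarize S p x * a"
  unfolding polarize_def sum_distrib_right by (simp add: mult.assoc)

lemma polarize_sum: "polarize S (\<lambda>X. \<Sum>i\<in>A. p i X) x = (\<Sum>i\<in>A. polarize S (p i) x)"
  unfolding polarize_def sum_distrib_left by (rule sum.swap)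

text \<open>One more direction is one more difference operator.\<close>

lemma polarize_insert:
  assumes "finite S" "k \<notin> S"
  shows "polarize (insert k S) p x = polarize S (\<lambda>X. p (x k + X)) x - polarize S p x"
proof -
  have "polarize (insert k S) p x = (\<Sum>T\<in>Pow S. (- 1) ^ card (insert k S - T) * p (sum x T))
      + (\<Sum>T\<in>insert k ` Pow S. (- 1) ^ card (insert k S - T) * p (sum x T))"
    unfolding polarize_def Pow_insert using assms by (intro sum.union_disjoint) auto
  also have "(\<Sum>T\<in>insert k ` Pow S. (- 1) ^ card (insert k S - T) * p (sum x T))
      = polarize S (\<lambda>X. p (x k + X)) x"
  proof (subst sum.reindex)
    show "inj_on (insert k) (Pow S)" using assms by (auto simp: inj_on_def)
    show "sum ((\<lambda>T. (- 1) ^ card (insert k S - T) * p (sum x T)) \<circ> insert k) (Pow S) =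
        polarize S (\<lambda>X. p (x k + X)) x"
      unfolding polarize_def
    proof (rule sum.cong)
      fix T assume T: "T \<in> Pow S"
      have "insert k S - insert k T = S - T" "finite T" "k \<notin> T"
        using assms T by (auto intro: finite_subset)
      then show "((\<lambda>T. (- 1) ^ card (insert k S - T) * p (sum x T)) \<circ> insert k) T =
          (- 1) ^ card (S - T) * p (x k + sum x T)" by simp
    qed simp
  qed
  also have "(\<Sum>T\<in>Pow S. (- 1) ^ card (insert k S - T) * p (sum x T)) = - polarize S p x"
    unfolding polarize_def sum_negf[symmetric]
  proof (rule sum.cong)
    fix T assume "T \<in> Pow S"
    then have "insert k S - T = insert k (S - T)" "k \<notin> S - T" using assms(2) by auto
    then show "(- 1) ^ card (insert k S - T) * p (sum x T) = - ((- 1) ^ card (S - T) * p (sum x T))"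
      using assms(1) by simp
  qed simp
  finally show ?thesis by simp
qed

lemma polarize_const:
  assumes "finite S" "S \<noteq> {}"
  shows "polarize S (\<lambda>_. c) x = 0"
proof -
  from assms(2) obtain k where k: "k \<in> S" by blast
  then have "S = insert k (S - {k})" by auto
  then show ?thesis using polarize_insert[of "S - {k}" k "\<lambda>_. c" x] assms(1) by simp
qed

text \<open>The Leibniz-type rule behind all computations of polarizations: an additive occurrence
  of the variable can be expanded first.\<close>
lemma polarize_additive:
  assumes S: "finite S" and add: "\<And>a b X. g (a + b) X = g a X + g b X"
  shows "polarize S (\<lambda>X. g X X) x = (\<Sum>k\<in>S. polarize S (g (x k)) x + polarize (S - {k}) (g (x k)) x)"
proof -
  have g0: "g 0 X = 0" for X using add[of 0 0 X] by simp
  have gs: "g (sum x T) X = (\<Sum>k\<in>T. g (x k) X)" if "finite T" for T X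
    using that by induction (auto simp: g0 add)
  have "polarize S (\<lambda>X. g X X) x = (\<Sum>T\<in>Pow S. \<Sum>k\<in>S. if k \<in> T then (- 1) ^ card (S - T) * g (x k) (sum x T) else 0)"
    unfolding polarize_def
  proof (rule sum.cong)
    fix T assume "T \<in> Pow S"
    then have T: "finite T" "{k \<in> S. k \<in> T} = T" using S by (auto intro: finite_subset)
    show "(- 1) ^ card (S - T) * g (sum x T) (sum x T) =
        (\<Sum>k\<in>S. if k \<in> T then (- 1) ^ card (S - T) * g (x k) (sum x T) else 0)"
      using S T by (simp add: gs sum_distrib_left flip: sum.inter_filter)
  qed simp
  also have "\<dots> = (\<Sum>k\<in>S. \<Sum>T\<in>Pow S. if k \<in> T then (- 1) ^ card (S - T) * g (x k) (sum x T) else 0)"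
    by (rule sum.swap)
  also have "\<dots> = (\<Sum>k\<in>S. polarize S (g (x k)) x + polarize (S - {k}) (g (x k)) x)"
  proof (rule sum.cong)
    fix k assume k: "k \<in> S"
    let ?g = "g (x k)" and ?S = "S - {k}"
    have fin: "finite ?S" "k \<notin> ?S" and ins: "S = insert k ?S" using S k by auto
    have "(\<Sum>T\<in>Pow S. if k \<in> T then (- 1) ^ card (S - T) * ?g (sum x T) else 0) =
        (\<Sum>T\<in>Pow ?S. if k \<in> T then (- 1) ^ card (S - T) * ?g (sum x T) else 0)
      + (\<Sum>T\<in>insert k ` Pow ?S. if k \<in> T then (- 1) ^ card (S - T) * ?g (sum x T) else 0)"
      using S by (subst (1) ins, subst Pow_insert, intro sum.union_disjoint) auto
    also have "(\<Sum>T\<in>Pow ?S. if k \<in> T then (- 1) ^ card (S - T) * ?g (sum x T) else 0) = 0"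
      by (rule sum.neutral) auto
    also have "(\<Sum>T\<in>insert k ` Pow ?S. if k \<in> T then (- 1) ^ card (S - T) * ?g (sum x T) else 0)
        = polarize ?S (\<lambda>X. ?g (x k + X)) x"
    proof (subst sum.reindex)
      show "inj_on (insert k) (Pow ?S)" by (auto simp: inj_on_def)
      show "sum ((\<lambda>T. if k \<in> T then (- 1) ^ card (S - T) * ?g (sum x T) else 0) \<circ> insert k) (Pow ?S) =
          polarize ?S (\<lambda>X. ?g (x k + X)) x"
        unfolding polarize_def
      proof (rule sum.cong)
        fix T assume T: "T \<in> Pow ?S"
        then have "S - insert k T = ?S - T" "finite T" "k \<notin> T"
          using S by (auto intro: finite_subset)
        then show "((\<lambda>T. if k \<in> T then (- 1) ^ card (S - T) * ?g (sum x T) else 0) \<circ> insert k) T =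
            (- 1) ^ card (?S - T) * ?g (x k + sum x T)" by simp
      qed simp
    qed
    also have "polarize ?S (\<lambda>X. ?g (x k + X)) x = polarize S ?g x + polarize ?S ?g x"
      using polarize_insert[OF fin, of ?g x] ins by simp
    finally show "(\<Sum>T\<in>Pow S. if k \<in> T then (- 1) ^ card (S - T) * ?g (sum x T) else 0) =
        polarize S ?g x + polarize ?S ?g x" by simp
  qed simp
  finally show ?thesis .
qed

text \<open>The hypothesis \<open>b\<close> means that b has degree at most r. When an outer X is
  split off by \<open>polarize_additive\<close>, S is too large for the remaining product, which has
  one factor less, so only the terms in which one variable has left S contribute.\<close>

lemma polarize_words:
  assumes b: "\<And>S x. finite S \<Longrightarrow> card S > r \<Longrightarrow> polarize S b x = 0"
    and S: "finite S" and c: "card S \<ge> i + j + r"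
  shows "polarize S (\<lambda>X. X ^ i * b X * X ^ j) x =
    (if card S = i + j + r then words (\<lambda>S. polarize S b) i j S x else 0)"
  using S c
proof (induction i arbitrary: S)
  case 0
  have "polarize S (\<lambda>X. b X * X ^ j) x = (if card S = j + r then words (\<lambda>S. polarize S b) 0 j S x else 0)"
    if "finite S" "card S \<ge> j + r" for S
    using that
  proof (induction j arbitrary: S)
    case 0
    then show ?case using b by auto
  next
    case (Suc j)
    let ?p = "\<lambda>X. b X * X ^ j"
    have "polarize S (\<lambda>X. b X * X ^ Suc j) x = polarize S (\<lambda>X. ?p X * X) x"
      by (simp add: power_commutes mult.assoc)
    also have "\<dots> = (\<Sum>k\<in>S. polarize S (\<lambda>X. ?p X * x k) x + polarize (S - {k}) (\<lambda>X. ?p X * x k) x)"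
      by (rule polarize_additive) (use Suc.prems in \<open>auto simp: distrib_left\<close>)
    also have "\<dots> = (\<Sum>k\<in>S. polarize S ?p x * x k + polarize (S - {k}) ?p x * x k)"
      by (simp only: polarize_right)
    also have "\<dots> = (\<Sum>k\<in>S. (if card S = Suc j + r then words (\<lambda>S. polarize S b) 0 j (S - {k}) x else 0) * x k)"
      by (rule sum.cong) (use Suc.prems in \<open>auto simp: Suc.IH\<close>)
    finally show ?case by simp
  qed
  from this[OF 0(1)] show ?case using 0(2) by simp
next
  case (Suc i)
  let ?p = "\<lambda>X. X ^ i * b X * X ^ j"
  have "polarize S (\<lambda>X. X ^ Suc i * b X * X ^ j) x = polarize S (\<lambda>X. X * ?p X) x"
    by (simp add: mult.assoc)
  also have "\<dots> = (\<Sum>k\<in>S. polarize S (\<lambda>X. x k * ?p X) x + polarize (S - {k}) (\<lambda>X. x k * ?p X) x)"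
    by (rule polarize_additive) (use Suc.prems in \<open>auto simp: distrib_right\<close>)
  also have "\<dots> = (\<Sum>k\<in>S. x k * polarize S ?p x + x k * polarize (S - {k}) ?p x)"
    by (simp only: polarize_left)
  also have "\<dots> = (\<Sum>k\<in>S. x k * (if card S = Suc i + j + r then words (\<lambda>S. polarize S b) i j (S - {k}) x else 0))"
    by (rule sum.cong) (use Suc.prems in \<open>auto simp: Suc.IH\<close>)
  finally show ?case by simp
qed

lemma polarize_biadditive_eq_0:
  assumes "finite S" "card S > 2"
    and "\<And>a b X. B (a + b) X = B a X + B b X" "\<And>a X Y. B a (X + Y) = B a X + B a Y"
  shows "polarize S (\<lambda>X. B X X) x = (0::'r::ring_1)"
proof -
  have lin: "polarize S l x = 0" if "finite S" "card S > 1" "\<And>X Y. l (X + Y) = l X + l Y" for S and l :: "'r \<Rightarrow> 'r"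
  proof -
    have "polarize S l x = (\<Sum>k\<in>S. polarize S (\<lambda>_. l (x k)) x + polarize (S - {k}) (\<lambda>_. l (x k)) x)"
      using polarize_additive[OF that(1), of "\<lambda>a _. l a"] that(3) by simp
    also have "\<dots> = 0"
    proof (rule sum.neutral, rule ballI)
      fix k assume "k \<in> S"
      then have "card (S - {k}) > 0" using that by simp
      then have "S - {k} \<noteq> {}" "S \<noteq> {}" by (metis card.empty less_irrefl, auto)
      then show "polarize S (\<lambda>_. l (x k)) x + polarize (S - {k}) (\<lambda>_. l (x k)) x = 0"
        using that by (simp add: polarize_const)
    qed
    finally show ?thesis .
  qed
  show ?thesis
    by (subst polarize_additive, fact, fact, rule sum.neutral, rule ballI)
      (use assms in \<open>simp add: lin\<close>)
qed

lemma polarized_identity: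
  assumes b: "\<And>S x. finite S \<Longrightarrow> card S > r \<Longrightarrow> polarize S b x = 0"
    and id: "\<And>X. (\<Sum>i\<le>n. c i * (X ^ i * b X * X ^ (n - i))) = 0"
    and S: "finite S" "card S = n + r"
  shows "(\<Sum>i\<le>n. c i * words (\<lambda>S. polarize S b) i (n - i) S x) = 0"
proof -
  have "(\<Sum>i\<le>n. c i * words (\<lambda>S. polarize S b) i (n - i) S x)
      = (\<Sum>i\<le>n. c i * polarize S (\<lambda>X. X ^ i * b X * X ^ (n - i)) x)"
    by (rule sum.cong) (use S in \<open>auto simp: polarize_words[OF b]\<close>)
  also have "\<dots> = polarize S (\<lambda>X. \<Sum>i\<le>n. c i * (X ^ i * b X * X ^ (n - i))) x"
    by (simp only: polarize_sum polarize_left)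
  also have "\<dots> = 0" unfolding id by (simp add: polarize_def)
  finally show ?thesis .
qed

section \<open>Extension of multilinear maps to power series\<close>

definition comps :: "nat set \<Rightarrow> nat \<Rightarrow> (nat \<Rightarrow> nat) set" where
  "comps S N = {\<nu>. (\<forall>k. k \<notin> S \<longrightarrow> \<nu> k = 0) \<and> sum \<nu> S = N}"

lemma finite_comps: "finite S \<Longrightarrow> finite (comps S N)"
proof -
  assume S: "finite S"
  have "comps S N \<subseteq> {\<nu>. \<forall>k. (k \<in> S \<longrightarrow> \<nu> k \<in> {..N}) \<and> (k \<notin> S \<longrightarrow> \<nu> k = 0)}"
    using S by (auto simp: comps_def member_le_sum)
  then show ?thesis using finite_set_of_finite_funs[OF S, of "{..N}" 0] finite_subset by blast
qed

text \<open>A weak composition of N over S is its value a at k together with a composition of N - a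
  over the other indices; this is the source of the Cauchy products below.\<close>

lemma sum_comps_split:
  fixes h :: "nat \<Rightarrow> (nat \<Rightarrow> nat) \<Rightarrow> 'a::comm_monoid_add"
  assumes S: "finite S" "k \<in> S"
  shows "(\<Sum>\<nu>\<in>comps S N. h (\<nu> k) (\<nu>(k := 0))) = (\<Sum>a=0..N. \<Sum>\<nu>\<in>comps (S - {k}) (N - a). h a \<nu>)"
proof -
  have sum_split: "sum \<nu> S = \<nu> k + sum \<nu> (S - {k})" for \<nu> :: "nat \<Rightarrow> nat"
    using S by (simp add: sum.remove)
  have "(\<Sum>a=0..N. \<Sum>\<nu>\<in>comps (S - {k}) (N - a). h a \<nu>) =
      (\<Sum>(a, \<nu>)\<in>Sigma {0..N} (\<lambda>a. comps (S - {k}) (N - a)). h a \<nu>)"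
    using S by (subst sum.Sigma) (auto intro: finite_comps)
  also have "\<dots> = (\<Sum>\<nu>\<in>comps S N. h (\<nu> k) (\<nu>(k := 0)))"
  proof (rule sum.reindex_bij_witness[of _ "\<lambda>\<nu>. (\<nu> k, \<nu>(k := 0))" "\<lambda>(a, \<nu>). \<nu>(k := a)"])
    fix p assume p: "p \<in> Sigma {0..N} (\<lambda>a. comps (S - {k}) (N - a))"
    obtain a \<nu> where [simp]: "p = (a, \<nu>)" by (cases p)
    have a: "a \<le> N" "\<And>l. l \<notin> S - {k} \<Longrightarrow> \<nu> l = 0" "sum \<nu> (S - {k}) = N - a"
      using p by (auto simp: comps_def)
    have \<nu>k: "\<nu>(k := 0) = \<nu>" using a(2)[of k] by auto
    then show "(((case p of (a, \<nu>) \<Rightarrow> \<nu>(k := a)) k), (case p of (a, \<nu>) \<Rightarrow> \<nu>(k := a))(k := 0)) = p" by simp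
    have "sum (\<nu>(k := a)) (S - {k}) = sum \<nu> (S - {k})" by (rule sum.cong) auto
    then show "(case p of (a, \<nu>) \<Rightarrow> \<nu>(k := a)) \<in> comps S N"
      using a S unfolding comps_def by (auto simp: sum_split)
    show "h ((case p of (a, \<nu>) \<Rightarrow> \<nu>(k := a)) k) ((case p of (a, \<nu>) \<Rightarrow> \<nu>(k := a))(k := 0)) = (case p of (a, \<nu>) \<Rightarrow> h a \<nu>)"
      using \<nu>k by simp
  next
    fix \<nu> assume \<nu>: "\<nu> \<in> comps S N"
    show "(case (\<nu> k, \<nu>(k := 0)) of (a, \<nu>) \<Rightarrow> \<nu>(k := a)) = \<nu>" by simp
    have "sum (\<nu>(k := 0)) (S - {k}) = sum \<nu> (S - {k})" by (rule sum.cong) auto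
    then show "(\<nu> k, \<nu>(k := 0)) \<in> Sigma {0..N} (\<lambda>a. comps (S - {k}) (N - a))"
      using \<nu> sum_split[of \<nu>] unfolding comps_def by auto
  qed
  finally show ?thesis by simp
qed

text \<open>For G multilinear in the variables indexed by S, this is its power-series-multilinear
  extension.\<close>
definition lift :: "nat set \<Rightarrow> ((nat \<Rightarrow> 'b::ring_1) \<Rightarrow> 'b) \<Rightarrow> (nat \<Rightarrow> 'b fps) \<Rightarrow> 'b fps" where
  "lift S G x = Abs_fps (\<lambda>N. \<Sum>\<nu>\<in>comps S N. G (\<lambda>k. fps_nth (x k) (\<nu> k)))"

lemma local_on_lift:
  assumes "local_on S G"
  shows "local_on S (lift S G)"
  unfolding local_on_def
proof (intro allI impI)
  fix x :: "nat \<Rightarrow> 'a fps" and k y assume k: "k \<notin> S"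
  have "(\<lambda>l. fps_nth ((x(k := y)) l) (\<nu> l)) = (\<lambda>l. fps_nth (x l) (\<nu> l))(k := fps_nth y (\<nu> k))" for \<nu>
    by auto
  then show "lift S G (x(k := y)) = lift S G x" unfolding lift_def using local_onD[OF assms k] by simp
qed

lemma lift_sum: "lift S (\<lambda>x. \<Sum>i\<in>A. G i x) x = (\<Sum>i\<in>A. lift S (G i) x)"
  by (rule fps_ext) (simp add: lift_def fps_sum_nth, rule sum.swap)

lemma lift_const_mult: "lift S (\<lambda>x. c * G x) x = fps_const c * lift S G x"
  by (rule fps_ext) (simp add: lift_def sum_distrib_left)

lemma lift_zero: "lift S (\<lambda>x. 0) x = 0"
  by (rule fps_ext) (simp add: lift_def)

lemma lift_left:
  assumes S: "finite S" "k \<in> S" and G: "local_on (S - {k}) G"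
  shows "lift S (\<lambda>x. x k * G x) x = x k * lift (S - {k}) G x"
proof (rule fps_ext)
  fix N
  \<comment> \<open>The index of a variable that \<open>G\<close> ignores may be reset to 0, after
    which \<open>G\<close> reads a composition over S - {k}.\<close>
  have upd: "G (\<lambda>l. fps_nth (x l) (\<nu> l)) = G (\<lambda>l. fps_nth (x l) ((\<nu>(k := 0)) l))" for \<nu>
  proof -
    have "(\<lambda>l. fps_nth (x l) ((\<nu>(k := 0)) l)) = (\<lambda>l. fps_nth (x l) (\<nu> l))(k := fps_nth (x k) 0)" by auto
    then show ?thesis using local_onD[OF G, of k] by simp
  qed
  have "fps_nth (lift S (\<lambda>x. x k * G x) x) N =
      (\<Sum>\<nu>\<in>comps S N. fps_nth (x k) (\<nu> k) * G (\<lambda>l. fps_nth (x l) ((\<nu>(k := 0)) l)))"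
    unfolding lift_def using upd by simp
  also have "\<dots> = (\<Sum>a=0..N. \<Sum>\<nu>\<in>comps (S - {k}) (N - a). fps_nth (x k) a * G (\<lambda>l. fps_nth (x l) (\<nu> l)))"
    by (rule sum_comps_split[OF S, of "\<lambda>a \<nu>. fps_nth (x k) a * G (\<lambda>l. fps_nth (x l) (\<nu> l))"])
  also have "\<dots> = fps_nth (x k * lift (S - {k}) G x) N"
    by (simp add: fps_mult_nth lift_def sum_distrib_left)
  finally show "fps_nth (lift S (\<lambda>x. x k * G x) x) N = fps_nth (x k * lift (S - {k}) G x) N" .
qed

lemma lift_right:
  assumes S: "finite S" "k \<in> S" and G: "local_on (S - {k}) G"
  shows "lift S (\<lambda>x. G x * x k) x = lift (S - {k}) G x * x k"
proof (rule fps_ext)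
  fix N
  have upd: "G (\<lambda>l. fps_nth (x l) (\<nu> l)) = G (\<lambda>l. fps_nth (x l) ((\<nu>(k := 0)) l))" for \<nu>
  proof -
    have "(\<lambda>l. fps_nth (x l) ((\<nu>(k := 0)) l)) = (\<lambda>l. fps_nth (x l) (\<nu> l))(k := fps_nth (x k) 0)" by auto
    then show ?thesis using local_onD[OF G, of k] by simp
  qed
  have "fps_nth (lift S (\<lambda>x. G x * x k) x) N =
      (\<Sum>\<nu>\<in>comps S N. G (\<lambda>l. fps_nth (x l) ((\<nu>(k := 0)) l)) * fps_nth (x k) (\<nu> k))"
    unfolding lift_def using upd by simp
  also have "\<dots> = (\<Sum>a=0..N. \<Sum>\<nu>\<in>comps (S - {k}) (N - a). G (\<lambda>l. fps_nth (x l) (\<nu> l)) * fps_nth (x k) a)"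
    by (rule sum_comps_split[OF S, of "\<lambda>a \<nu>. G (\<lambda>l. fps_nth (x l) (\<nu> l)) * fps_nth (x k) a"])
  also have "\<dots> = (\<Sum>a=0..N. \<Sum>\<nu>\<in>comps (S - {k}) a. G (\<lambda>l. fps_nth (x l) (\<nu> l)) * fps_nth (x k) (N - a))"
    by (rule sum.reindex_bij_witness[of _ "\<lambda>a. N - a" "\<lambda>a. N - a"]) auto
  also have "\<dots> = fps_nth (lift (S - {k}) G x * x k) N"
    by (simp add: fps_mult_nth lift_def sum_distrib_right)
  finally show "fps_nth (lift S (\<lambda>x. G x * x k) x) N = fps_nth (lift (S - {k}) G x * x k) N" .
qed

lemma lift_words:
  assumes loc: "\<And>S. local_on S (\<beta> S)" and S: "finite S"
  shows "lift S (words \<beta> i j S) x = words (\<lambda>S. lift S (\<beta> S)) i j S x"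
proof -
  have base: "lift S (words \<beta> 0 j S) x = words (\<lambda>S. lift S (\<beta> S)) 0 j S x" if "finite S" for j S
    using that
  proof (induction j arbitrary: S)
    case 0
    have "words \<beta> 0 0 S = \<beta> S" by (rule ext) simp
    then show ?case by simp
  next
    case (Suc j)
    have "words \<beta> 0 (Suc j) S = (\<lambda>x. \<Sum>k\<in>S. words \<beta> 0 j (S - {k}) x * x k)" by (rule ext) simp
    then have "lift S (words \<beta> 0 (Suc j) S) x = (\<Sum>k\<in>S. lift S (\<lambda>x. words \<beta> 0 j (S - {k}) x * x k) x)"
      by (simp only: lift_sum)
    also have "\<dots> = (\<Sum>k\<in>S. lift (S - {k}) (words \<beta> 0 j (S - {k})) x * x k)"
      by (rule sum.cong) (auto intro!: lift_right local_on_words loc Suc.prems)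
    also have "\<dots> = words (\<lambda>S. lift S (\<beta> S)) 0 (Suc j) S x" using Suc by simp
    finally show ?case .
  qed
  show ?thesis
    using S
  proof (induction i arbitrary: S)
    case 0
    then show ?case by (rule base)
  next
    case (Suc i)
    have "words \<beta> (Suc i) j S = (\<lambda>x. \<Sum>k\<in>S. x k * words \<beta> i j (S - {k}) x)" by (rule ext) simp
    then have "lift S (words \<beta> (Suc i) j S) x = (\<Sum>k\<in>S. lift S (\<lambda>x. x k * words \<beta> i j (S - {k}) x) x)"
      by (simp only: lift_sum)
    also have "\<dots> = (\<Sum>k\<in>S. x k * lift (S - {k}) (words \<beta> i j (S - {k})) x)"
      by (rule sum.cong) (auto intro!: lift_left local_on_words loc Suc.prems)
    also have "\<dots> = words (\<lambda>S. lift S (\<beta> S)) (Suc i) j S x" using Suc by simp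
    finally show ?case .
  qed
qed

text \<open>\<open>words\<close> is built from sums and outer multiplications by variables. All of
  these are respected by \<open>lift\<close>, so the identity passes to power series.\<close>

lemma lift_identity:
  assumes loc: "\<And>S. local_on S (\<beta> S)" and S: "finite S"
    and id: "\<And>x. (\<Sum>i\<le>n. c i * words \<beta> i (n - i) S x) = 0"
  shows "(\<Sum>i\<le>n. fps_const (c i) * words (\<lambda>S. lift S (\<beta> S)) i (n - i) S x) = 0"
proof -
  have "0 = lift S (\<lambda>x. \<Sum>i\<le>n. c i * words \<beta> i (n - i) S x) x" unfolding id by (simp add: lift_zero)
  also have "\<dots> = (\<Sum>i\<le>n. fps_const (c i) * lift S (words \<beta> i (n - i) S) x)"
    by (simp only: lift_sum lift_const_mult)
  finally show ?thesis by (simp add: lift_words[OF loc S])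
qed

subsection \<open>The identity of a zero preserver\<close>

text \<open>The coefficient of x^i y x^(d-1-i) in f(x, ..., x, y). Variables and positions are
  counted from 0, so y has index d - 1.\<close>

definition slot_coeff :: "nat \<Rightarrow> ((nat \<Rightarrow> nat) \<Rightarrow> 'f::field) \<Rightarrow> nat \<Rightarrow> 'f" where
  "slot_coeff d lam i = (\<Sum>\<sigma>\<in>{\<sigma>. \<sigma> permutes {0..<d} \<and> \<sigma> i = d - 1}. lam \<sigma>)"

text \<open>A word with nonzero coefficient comes from a permutation and so contains y exactly once.
  The permutations producing this word are those that put y in the same position.\<close>

lemma slot_coeff_nonzero:
  assumes "subst_xy d lam w \<noteq> 0" "d > 0"
  shows "\<exists>i<d. slot_coeff d lam i \<noteq> 0"
proof -
  let ?word = "\<lambda>\<sigma>. map (\<lambda>i. if \<sigma> i = d - 1 then 1 else 0) [0..<d] :: nat list"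
  have "{\<sigma>. \<sigma> permutes {0..<d} \<and> ?word \<sigma> = w} \<noteq> {}"
    using assms(1) unfolding subst_xy_def by (metis sum.empty)
  then obtain \<tau> where \<tau>: "\<tau> permutes {0..<d}" "?word \<tau> = w" by blast
  obtain i where i: "i < d" "\<tau> i = d - 1"
    using permutes_surj[OF \<tau>(1)] permutes_in_image[OF \<tau>(1)] assms(2)
    by (metis atLeastLessThan_iff diff_less surj_def zero_le zero_less_one)
  have "{\<sigma>. \<sigma> permutes {0..<d} \<and> ?word \<sigma> = w} = {\<sigma>. \<sigma> permutes {0..<d} \<and> \<sigma> i = d - 1}"
  proof (intro Collect_cong conj_cong refl)
    fix \<sigma> assume \<sigma>: "\<sigma> permutes {0..<d}"
    have "?word \<sigma> = w \<longleftrightarrow> (\<forall>j<d. (\<sigma> j = d - 1) = (\<tau> j = d - 1))"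
      unfolding \<tau>(2)[symmetric] by (auto simp: list_eq_iff_nth_eq split: if_splits)
    also have "\<dots> \<longleftrightarrow> \<sigma> i = d - 1"
      using i permutes_inj[OF \<sigma>] permutes_inj[OF \<tau>(1)] by (metis injD)
    finally show "?word \<sigma> = w \<longleftrightarrow> \<sigma> i = d - 1" .
  qed
  then show ?thesis using assms(1) i(1) unfolding subst_xy_def slot_coeff_def by auto
qed

context falg
begin

text \<open>The permutations are grouped by the position \<open>inv \<sigma> (d - 1)\<close> of
  y.\<close>

lemma ml_eval_two_values:
  assumes "d > 0"
  shows "ml_eval sc d lam (\<lambda>i. if i = d - 1 then y else x) =
    (\<Sum>i<d. sc (slot_coeff d lam i) (x ^ i * y * x ^ (d - 1 - i)))"
proof -
  let ?P = "{\<sigma>. \<sigma> permutes {0..<d}}" and ?a = "\<lambda>i. if i = d - 1 then y else x"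
  have fin: "finite ?P" by (rule finite_permutations) simp
  have slot: "inv \<sigma> (d - 1) = i \<longleftrightarrow> \<sigma> i = d - 1" if "\<sigma> permutes {0..<d}" for \<sigma> i
    using permutes_inv_eq[OF that] by blast
  have word: "prod_list (map (?a \<circ> \<sigma>) [0..<d]) = x ^ i * y * x ^ (d - 1 - i)"
    if \<sigma>: "\<sigma> permutes {0..<d}" and i: "i < d" "\<sigma> i = d - 1" for \<sigma> i
  proof -
    have split: "[0..<d] = [0..<i] @ i # [Suc i..<d]"
      using upt_add_eq_append[of 0 i "d - i"] upt_conv_Cons[OF i(1)] i(1) by simp
    have "j = i" if "\<sigma> j = d - 1" for j using permutes_inj[OF \<sigma>] i(2) that by (metis injD)
    then have "map (?a \<circ> \<sigma>) [0..<i] = map (\<lambda>_. x) [0..<i]" "map (?a \<circ> \<sigma>) [Suc i..<d] = map (\<lambda>_. x) [Suc i..<d]"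
      by (auto intro!: map_cong)
    then show ?thesis
      unfolding split using i by (simp add: map_replicate_const prod_list_replicate mult.assoc)
  qed
  have "ml_eval sc d lam ?a = (\<Sum>i<d. \<Sum>\<sigma>\<in>{\<sigma> \<in> ?P. inv \<sigma> (d - 1) = i}. sc (lam \<sigma>) (prod_list (map (?a \<circ> \<sigma>) [0..<d])))"
    unfolding ml_eval_def
  proof (rule sum.group[symmetric])
    show "finite ?P" "finite {..<d}" using fin by auto
    show "(\<lambda>\<sigma>. inv \<sigma> (d - 1)) ` ?P \<subseteq> {..<d}"
    proof (rule image_subsetI)
      fix \<sigma> assume "\<sigma> \<in> ?P"
      then have "inv \<sigma> (d - 1) \<in> {0..<d}"
        using permutes_in_image[OF permutes_inv, of \<sigma> "{0..<d}" "d - 1"] assms by auto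
      then show "inv \<sigma> (d - 1) \<in> {..<d}" by simp
    qed
  qed
  also have "\<dots> = (\<Sum>i<d. \<Sum>\<sigma>\<in>{\<sigma>. \<sigma> permutes {0..<d} \<and> \<sigma> i = d - 1}. sc (lam \<sigma>) (x ^ i * y * x ^ (d - 1 - i)))"
  proof (intro sum.cong)
    show "{\<sigma> \<in> ?P. inv \<sigma> (d - 1) = i} = {\<sigma>. \<sigma> permutes {0..<d} \<and> \<sigma> i = d - 1}" for i
      using slot by blast
    show "sc (lam \<sigma>) (prod_list (map (?a \<circ> \<sigma>) [0..<d])) = sc (lam \<sigma>) (x ^ i * y * x ^ (d - 1 - i))"
      if "i \<in> {..<d}" "\<sigma> \<in> {\<sigma>. \<sigma> permutes {0..<d} \<and> \<sigma> i = d - 1}" for i \<sigma>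
      using word[of \<sigma> i] that by simp
  qed simp
  also have "\<dots> = (\<Sum>i<d. sc (slot_coeff d lam i) (x ^ i * y * x ^ (d - 1 - i)))"
    by (simp add: slot_coeff_def scale_sum_left)
  finally show ?thesis .
qed

lemma sum_slot_coeff:
  assumes "d > 0"
  shows "(\<Sum>i<d. slot_coeff d lam i) = (\<Sum>\<sigma>\<in>{\<sigma>. \<sigma> permutes {0..<d}}. lam \<sigma>)"
proof -
  let ?P = "{\<sigma>. \<sigma> permutes {0..<d}}"
  have "(\<Sum>\<sigma>\<in>?P. lam \<sigma>) = (\<Sum>i<d. \<Sum>\<sigma>\<in>{\<sigma> \<in> ?P. inv \<sigma> (d - 1) = i}. lam \<sigma>)"
  proof (rule sum.group[symmetric])
    show "finite ?P" "finite {..<d}" by (auto intro: finite_permutations)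
    show "(\<lambda>\<sigma>. inv \<sigma> (d - 1)) ` ?P \<subseteq> {..<d}"
    proof (rule image_subsetI)
      fix \<sigma> assume "\<sigma> \<in> ?P"
      then have "inv \<sigma> (d - 1) \<in> {0..<d}"
        using permutes_in_image[OF permutes_inv, of \<sigma> "{0..<d}" "d - 1"] assms by auto
      then show "inv \<sigma> (d - 1) \<in> {..<d}" by simp
    qed
  qed
  also have "\<dots> = (\<Sum>i<d. slot_coeff d lam i)"
  proof -
    have "inv \<sigma> (d - 1) = i \<longleftrightarrow> \<sigma> i = d - 1" if "\<sigma> permutes {0..<d}" for \<sigma> i
      using permutes_inv_eq[OF that] by blast
    then have "{\<sigma> \<in> ?P. inv \<sigma> (d - 1) = i} = {\<sigma>. \<sigma> permutes {0..<d} \<and> \<sigma> i = d - 1}" for i by blast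
    then show ?thesis unfolding slot_coeff_def by simp
  qed
  finally show ?thesis by simp
qed

text \<open>For commuting x and y all monomials of f(x, ..., x, y) coincide, so its value is the sum
  of all coefficients times y x^(d-1), which is zero.\<close>

lemma preserver_identity:
  assumes d: "d > 0" and sum0: "(\<Sum>\<sigma>\<in>{\<sigma>. \<sigma> permutes {0..<d}}. lam \<sigma>) = 0"
    and pres: "preserves_zeros sc d lam \<phi>" and xy: "x * y = y * x"
  shows "(\<Sum>i<d. sc (slot_coeff d lam i) (\<phi> x ^ i * \<phi> y * \<phi> x ^ (d - 1 - i))) = 0"
proof -
  have comm: "x ^ i * y = y * x ^ i" for i
    using power_commuting_commutes[OF xy] .
  have "ml_eval sc d lam (\<lambda>i. if i = d - 1 then y else x) = (\<Sum>i<d. sc (slot_coeff d lam i) (y * x ^ (d - 1)))"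
    unfolding ml_eval_two_values[OF d]
    by (intro sum.cong refl) (simp add: comm mult.assoc flip: power_add)
  also have "\<dots> = 0" using sum_slot_coeff[OF d, of lam] sum0 by (simp flip: scale_sum_left)
  finally have "ml_eval sc d lam (\<phi> \<circ> (\<lambda>i. if i = d - 1 then y else x)) = 0"
    using pres unfolding preserves_zeros_def by blast
  moreover have "\<phi> \<circ> (\<lambda>i. if i = d - 1 then y else x) = (\<lambda>i. if i = d - 1 then \<phi> y else \<phi> x)" by auto
  ultimately show ?thesis using ml_eval_two_values[OF d] by metis
qed

end

subsection \<open>Free identities in algebras without socle\<close>

context falg
begin

text \<open>Induction on X. If the claim fails for \<open>insert k X\<close>, then wherever the maps
  of X have independent values modulo \<open>span R\<close>, the value of \<open>\<tau> k\<close> is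
  a combination of theirs modulo \<open>span R\<close>. Comparing the points y, u and y + u shows
  that the coefficients do not depend on the point, so a fixed nontrivial combination would map
  everything into \<open>span R\<close>.\<close>

lemma amitsur:
  fixes \<tau> :: "'i \<Rightarrow> 'b \<Rightarrow> 'b"
  assumes "finite X" "finite R"
    and add: "\<And>i x y. \<tau> i (x + y) = \<tau> i x + \<tau> i y"
    and inf: "\<And>c R. finite R \<Longrightarrow> \<exists>i\<in>X. c i \<noteq> 0 \<Longrightarrow> \<exists>r. (\<Sum>i\<in>X. sc (c i) (\<tau> i r)) \<notin> span R"
  shows "\<exists>r. \<forall>c. (\<Sum>i\<in>X. sc (c i) (\<tau> i r)) \<in> span R \<longrightarrow> (\<forall>i\<in>X. c i = 0)"
  using assms(1,2) inf
proof (induction X arbitrary: R)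
  case empty
  then show ?case by simp
next
  case (insert k X)
  define good where "good R r \<longleftrightarrow> (\<forall>c. (\<Sum>i\<in>X. sc (c i) (\<tau> i r)) \<in> span R \<longrightarrow> (\<forall>i\<in>X. c i = 0))" for R r
  have goodD: "good R r \<Longrightarrow> (\<Sum>i\<in>X. sc (c i) (\<tau> i r)) \<in> span R \<Longrightarrow> i \<in> X \<Longrightarrow> c i = 0" for R r c i
    unfolding good_def by blast
  have good_mono: "good R r \<Longrightarrow> R' \<subseteq> R \<Longrightarrow> good R' r" for R R' r
    unfolding good_def using span_mono by blast
  have infX: "\<exists>r. (\<Sum>i\<in>X. sc (c i) (\<tau> i r)) \<notin> span R" if "finite R" "\<exists>i\<in>X. c i \<noteq> 0" for c R
  proof -
    have "(\<Sum>i\<in>insert k X. sc ((c(k := 0)) i) (\<tau> i r)) = (\<Sum>i\<in>X. sc (c i) (\<tau> i r))" for r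
      using insert.hyps by (auto intro!: sum.cong)
    then show ?thesis
      using insert.prems(2)[OF that(1), of "c(k := 0)"] that(2) insert.hyps(2) by (metis fun_upd_other insertCI)
  qed
  have ex_good: "\<exists>r. good R r" if "finite R" for R
    unfolding good_def using insert.IH[OF that infX] by blast
  show ?case
  proof (rule ccontr)
    assume neg: "\<not> ?thesis"
    have rel: "\<exists>a. \<tau> k y - (\<Sum>i\<in>X. sc (a i) (\<tau> i y)) \<in> span R" if y: "good R y" for y
    proof -
      obtain c where c: "(\<Sum>i\<in>insert k X. sc (c i) (\<tau> i y)) \<in> span R" "\<not> (\<forall>i\<in>insert k X. c i = 0)"
        using neg by blast
      have ck: "c k \<noteq> 0"
      proof
        assume "c k = 0"
        then have "(\<Sum>i\<in>X. sc (c i) (\<tau> i y)) \<in> span R" using c(1) insert.hyps by simp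
        then show False using goodD[OF y] c(2) \<open>c k = 0\<close> by blast
      qed
      have "sc (1 / c k) (\<Sum>i\<in>insert k X. sc (c i) (\<tau> i y)) \<in> span R"
        using c(1) by (rule span_scale)
      also have "sc (1 / c k) (\<Sum>i\<in>insert k X. sc (c i) (\<tau> i y)) = \<tau> k y - (\<Sum>i\<in>X. sc (- c i / c k) (\<tau> i y))"
        using insert.hyps ck by (simp add: scale_right_distrib scale_sum_right sum_negf)
      finally show ?thesis by (rule exI[of _ "\<lambda>i. - c i / c k"])
    qed
    obtain y where y: "good R y" using ex_good insert.prems(1) by blast
    obtain a where a: "\<tau> k y - (\<Sum>i\<in>X. sc (a i) (\<tau> i y)) \<in> span R" using rel[OF y] by blast
    \<comment> \<open>The combination with the coefficients found at the one point y. By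
      \<open>inf\<close> it leaves \<open>span R\<close> at some z.\<close>
    define s where "s u = \<tau> k u - (\<Sum>i\<in>X. sc (a i) (\<tau> i u))" for u
    have s_add: "s (u + v) = s u + s v" for u v
      unfolding s_def by (simp add: add scale_right_distrib sum.distrib)
    have "\<exists>z. (\<Sum>i\<in>insert k X. sc (((\<lambda>i. - a i)(k := 1)) i) (\<tau> i z)) \<notin> span R"
      by (rule insert.prems(2)[OF insert.prems(1)]) auto
    moreover have "(\<Sum>i\<in>insert k X. sc (((\<lambda>i. - a i)(k := 1)) i) (\<tau> i z)) = s z" for z
    proof -
      have "(\<Sum>i\<in>X. sc (((\<lambda>i. - a i)(k := 1)) i) (\<tau> i z)) = (\<Sum>i\<in>X. - sc (a i) (\<tau> i z))"
        using insert.hyps by (intro sum.cong) auto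
      then show ?thesis using insert.hyps unfolding s_def by (simp add: sum_negf)
    qed
    ultimately obtain z where z: "s z \<notin> span R" by auto
    define R1 where "R1 = R \<union> (\<lambda>i. \<tau> i y) ` X"
    define R2 where "R2 = R1 \<union> (\<lambda>i. \<tau> i z) ` X"
    have sub: "R \<subseteq> R1" "R1 \<subseteq> R2" "finite R2"
      using insert unfolding R1_def R2_def by auto
    have comb: "(\<Sum>i\<in>X. sc (c i) (\<tau> i y)) \<in> span R1" "(\<Sum>i\<in>X. sc (c i) (\<tau> i z)) \<in> span R2" for c
      unfolding R1_def R2_def by (intro span_sum span_scale span_base; auto)+
    \<comment> \<open>At u the maps of X are independent even modulo their values at y. Comparing
      the relations at y, u and y + u therefore separates the u-part, giving a' = a'', and then the
      y-part, giving a = a''.\<close>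
    have key: "s u \<in> span R" if u: "good R1 u" for u
    proof -
      have uR: "good R u" using good_mono[OF u sub(1)] .
      have yu: "good R (y + u)"
        unfolding good_def
      proof (intro allI impI)
        fix c assume "(\<Sum>i\<in>X. sc (c i) (\<tau> i (y + u))) \<in> span R"
        then have "(\<Sum>i\<in>X. sc (c i) (\<tau> i y)) + (\<Sum>i\<in>X. sc (c i) (\<tau> i u)) \<in> span R1"
          using span_mono[OF sub(1)] by (auto simp: add scale_right_distrib sum.distrib)
        then have "(\<Sum>i\<in>X. sc (c i) (\<tau> i u)) \<in> span R1" using comb(1) by (simp add: span_add_eq)
        then show "\<forall>i\<in>X. c i = 0" using goodD[OF u] by blast
      qed
      obtain a' where a': "\<tau> k u - (\<Sum>i\<in>X. sc (a' i) (\<tau> i u)) \<in> span R" using rel[OF uR] by blast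
      obtain a'' where a'': "\<tau> k (y + u) - (\<Sum>i\<in>X. sc (a'' i) (\<tau> i (y + u))) \<in> span R" using rel[OF yu] by blast
      have d: "(\<tau> k y - (\<Sum>i\<in>X. sc (a'' i) (\<tau> i y))) + (\<Sum>i\<in>X. sc (a' i - a'' i) (\<tau> i u)) \<in> span R"
      proof -
        have "(p - q) + (r - s) = (p + t - (q + s)) - (t - r)" for p q r s t :: 'b by simp
        then show ?thesis
          using span_diff[OF a'' a']
          by (simp only: add scale_right_distrib sum.distrib scale_left_diff_distrib sum_subtractf)
      qed
      have "(\<tau> k y - (\<Sum>i\<in>X. sc (a'' i) (\<tau> i y))) \<in> span R1"
      proof -
        have "(\<tau> k y - (\<Sum>i\<in>X. sc (a i) (\<tau> i y))) + (\<Sum>i\<in>X. sc (a i - a'' i) (\<tau> i y)) \<in> span R1"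
          by (rule span_add[OF subsetD[OF span_mono[OF sub(1)] a] comb(1)])
        then show ?thesis by (simp add: scale_left_diff_distrib sum_subtractf)
      qed
      then have "(\<Sum>i\<in>X. sc (a' i - a'' i) (\<tau> i u)) \<in> span R1"
        using subsetD[OF span_mono[OF sub(1)] d] by (simp only: span_add_eq)
      then have eq1: "a' i = a'' i" if "i \<in> X" for i using goodD[OF u _ that, of "\<lambda>i. a' i - a'' i"] by simp
      then have "(\<Sum>i\<in>X. sc (a' i - a'' i) (\<tau> i u)) = 0" by simp
      with d have "(\<tau> k y - (\<Sum>i\<in>X. sc (a'' i) (\<tau> i y))) \<in> span R" by simp
      from span_diff[OF this a] have "(\<Sum>i\<in>X. sc (a i - a'' i) (\<tau> i y)) \<in> span R"
        by (simp add: scale_left_diff_distrib sum_subtractf)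
      then have "a i = a'' i" if "i \<in> X" for i using goodD[OF y _ that, of "\<lambda>i. a i - a'' i"] by simp
      then have "(\<Sum>i\<in>X. sc (a i) (\<tau> i u)) = (\<Sum>i\<in>X. sc (a' i) (\<tau> i u))" using eq1 by (intro sum.cong) auto
      then show ?thesis using a' unfolding s_def by simp
    qed
    \<comment> \<open>R2 absorbs the values at z, so both y' and y' + z are good modulo R1;
      additivity of s then puts s z into \<open>span R\<close>.\<close>
    obtain y' where y': "good R2 y'" using ex_good sub(3) by blast
    have "good R1 (y' + z)"
      unfolding good_def
    proof (intro allI impI)
      fix c assume "(\<Sum>i\<in>X. sc (c i) (\<tau> i (y' + z))) \<in> span R1"
      then have "(\<Sum>i\<in>X. sc (c i) (\<tau> i y')) + (\<Sum>i\<in>X. sc (c i) (\<tau> i z)) \<in> span R2"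
        using span_mono[OF sub(2)] by (auto simp: add scale_right_distrib sum.distrib)
      then have "(\<Sum>i\<in>X. sc (c i) (\<tau> i y')) \<in> span R2" using comb(2) by (simp add: span_add_eq2)
      then show "\<forall>i\<in>X. c i = 0" using goodD[OF y'] by blast
    qed
    from key[OF this] key[OF good_mono[OF y' sub(2)]] have "s z \<in> span R"
      unfolding s_add by (simp add: span_add_eq)
    then show False using z by blast
  qed
qed

text \<open>This is weaker than a zero socle: an infinite-dimensional division algebra satisfies it,
  as only finite-dimensional \<open>w A b\<close> are excluded.\<close>

definition no_socle :: bool where
  "no_socle \<longleftrightarrow> (\<forall>w b R. w \<noteq> 0 \<longrightarrow> b \<noteq> 0 \<longrightarrow> finite R \<longrightarrow> (\<exists>r. w * r * b \<notin> span R))"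

text \<open>Amitsur's lemma for the maps r -> w r b, w in a basis of \<open>span B\<close>. A
  nontrivial combination of them is r -> v r b with v nonzero, whose image \<open>no_socle\<close>
  keeps out of every finite-dimensional space.\<close>

lemma separating_multiplier:
  assumes ns: "no_socle" and B: "finite B" "b \<noteq> 0"
  obtains r where "\<And>v. v \<in> span B \<Longrightarrow> v * r * b \<in> span B \<Longrightarrow> v = 0"
proof -
  obtain B' where B': "B' \<subseteq> B" "independent B'" "B \<subseteq> span B'"
    using maximal_independent_subset[of B] by blast
  have fin: "finite B'" using B(1) B'(1) finite_subset by blast
  have span: "span B' = span B"
    by (metis B'(1,3) span_mono span_span subset_antisym)
  have sum: "(\<Sum>w\<in>B'. sc (c w) (w * r * b)) = (\<Sum>w\<in>B'. sc (c w) w) * r * b" for c :: "'b \<Rightarrow> 'f" and r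
    by (simp add: sum_distrib_right sc_mult)
  have "\<exists>r. \<forall>c. (\<Sum>w\<in>B'. sc (c w) (w * r * b)) \<in> span B \<longrightarrow> (\<forall>w\<in>B'. c w = 0)"
  proof (rule amitsur[OF fin B(1)])
    fix c :: "'b \<Rightarrow> 'f" and R assume R: "finite (R :: 'b set)" and c: "\<exists>w\<in>B'. c w \<noteq> 0"
    then have "(\<Sum>w\<in>B'. sc (c w) w) \<noteq> 0"
      using fam_indepD[OF independent_fam_indep[OF fin B'(2)]] by blast
    then show "\<exists>r. (\<Sum>w\<in>B'. sc (c w) (w * r * b)) \<notin> span R"
      unfolding sum using ns R B(2) unfolding no_socle_def by blast
  qed (simp add: algebra_simps)
  then obtain r where r: "\<And>c. (\<Sum>w\<in>B'. sc (c w) w) * r * b \<in> span B \<Longrightarrow> \<forall>w\<in>B'. c w = 0"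
    unfolding sum by blast
  show ?thesis
  proof (rule that)
    fix v assume v: "v \<in> span B" "v * r * b \<in> span B"
    obtain c where c: "v = (\<Sum>w\<in>B'. sc (c w) w)"
      using v(1) unfolding span[symmetric] span_finite[OF fin] by auto
    then have "\<forall>w\<in>B'. c w = 0" using r v(2) by blast
    then show "v = 0" using c by simp
  qed
qed

text \<open>The tensor \<Sum> y_j \<otimes> z_j stands for the operator G x = \<Sum> y_j x z_j.
  Induction on \<open>bs\<close>: if G b = \<beta> is nonzero, G is replaced by x -> G x r \<beta> -
  \<beta> r G x, which kills b and all that G kills. With r from
  \<open>separating_multiplier\<close> the products w z_j stay independent, and a left factor 1
  survives because the first term leaves the left factors alone.\<close>

lemma annihilating_tensor:
  assumes ns: "no_socle" and B: "finite B" "independent B"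
  shows "\<exists>J y z j0. finite (J :: nat set) \<and> j0 \<in> J \<and> y j0 = (1::'b) \<and>
    (\<forall>b\<in>set bs. (\<Sum>j\<in>J. y j * b * z j) = 0) \<and> fam_indep sc (B \<times> J) (\<lambda>(w, j). w * z j)"
proof (induction bs)
  case Nil
  have "fam_indep sc (B \<times> {0::nat}) (\<lambda>(w, j). w * 1)"
    unfolding fam_indep_def
  proof (intro allI impI)
    fix c assume "(\<Sum>p\<in>B \<times> {0::nat}. sc (c p) (case p of (w, j) \<Rightarrow> w * 1)) = 0"
    then have "(\<Sum>w\<in>B. sc (c (w, 0)) w) = 0" by (simp add: sum.cartesian_product')
    then show "\<forall>p\<in>B \<times> {0}. c p = 0" using fam_indepD[OF independent_fam_indep[OF B]] by auto
  qed
  then show ?case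
    by (intro exI[of _ "{0}"] exI[of _ "\<lambda>_. 1"] exI[of _ 0]) (simp add: case_prod_unfold)
next
  case (Cons b bs)
  then obtain J y z j0 where J: "finite (J :: nat set)" "j0 \<in> J" "y j0 = (1::'b)"
    "\<forall>b\<in>set bs. (\<Sum>j\<in>J. y j * b * z j) = 0" and ind: "fam_indep sc (B \<times> J) (\<lambda>(w, j). w * z j)" by blast
  define \<beta> where "\<beta> = (\<Sum>j\<in>J. y j * b * z j)"
  show ?case
  proof (cases "\<beta> = 0")
    case True
    then show ?thesis using J ind unfolding \<beta>_def
      by (intro exI[of _ J] exI[of _ y] exI[of _ z] exI[of _ j0]) simp
  next
    case False
    define W where "W = (\<lambda>(w, j). w * z j) ` (B \<times> J)"
    have "finite W" unfolding W_def using B J by simp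
    from separating_multiplier[OF ns this False] obtain r
      where r: "\<And>v. v \<in> span W \<Longrightarrow> v * r * \<beta> \<in> span W \<Longrightarrow> v = 0" by blast
    \<comment> \<open>Even indices carry the term G x r \<beta>, odd ones the term - \<beta> r G
      x.\<close>
    define J' where "J' = (\<lambda>j. 2 * j) ` J \<union> (\<lambda>j. 2 * j + 1) ` J"
    define y' where "y' n = (if even n then y (n div 2) else - \<beta> * r * y (n div 2))" for n
    define z' where "z' n = (if even n then z (n div 2) * r * \<beta> else z (n div 2))" for n
    have sumJ': "(\<Sum>n\<in>J'. g n) = (\<Sum>j\<in>J. g (2 * j)) + (\<Sum>j\<in>J. g (2 * j + 1))" for g :: "nat \<Rightarrow> 'b"
    proof -
      have "(\<Sum>n\<in>J'. g n) = sum g ((\<lambda>j. 2 * j) ` J) + sum g ((\<lambda>j. 2 * j + 1) ` J)"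
        unfolding J'_def using J(1) by (intro sum.union_disjoint) (auto, presburger)
      moreover have "sum g ((\<lambda>j. 2 * j) ` J) = (\<Sum>j\<in>J. g (2 * j))"
        by (subst sum.reindex) (auto simp: inj_on_def)
      moreover have "sum g ((\<lambda>j. 2 * j + 1) ` J) = (\<Sum>j\<in>J. g (2 * j + 1))"
        by (subst sum.reindex) (auto simp: inj_on_def)
      ultimately show ?thesis by simp
    qed
    have val: "(\<Sum>n\<in>J'. y' n * x * z' n) = (\<Sum>j\<in>J. y j * x * z j) * r * \<beta> - \<beta> * r * (\<Sum>j\<in>J. y j * x * z j)" for x
      unfolding sumJ' y'_def z'_def
      by (simp add: sum_distrib_left sum_distrib_right mult.assoc sum_negf)
    have ind': "fam_indep sc (B \<times> J') (\<lambda>(w, j). w * z' j)"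
      unfolding fam_indep_def
    proof (intro allI impI)
      fix c assume 0: "(\<Sum>p\<in>B \<times> J'. sc (c p) (case p of (w, j) \<Rightarrow> w * z' j)) = 0"
      \<comment> \<open>The relation splits into v0 r \<beta> + v1 = 0 with v0 and v1 in
        \<open>span W\<close>; the choice of r makes both vanish.\<close>
      define v0 where "v0 = (\<Sum>p\<in>B \<times> J. sc (c (fst p, 2 * snd p)) (case p of (w, j) \<Rightarrow> w * z j))"
      define v1 where "v1 = (\<Sum>p\<in>B \<times> J. sc (c (fst p, 2 * snd p + 1)) (case p of (w, j) \<Rightarrow> w * z j))"
      have sp: "v0 \<in> span W" "v1 \<in> span W"
        unfolding v0_def v1_def W_def by (intro span_sum span_scale span_base; blast)+
      have "(\<Sum>p\<in>B \<times> J'. sc (c p) (case p of (w, j) \<Rightarrow> w * z' j)) = (\<Sum>w\<in>B. \<Sum>j\<in>J'. sc (c (w, j)) (w * z' j))"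
        by (simp add: sum.cartesian_product')
      also have "\<dots> = (\<Sum>w\<in>B. \<Sum>j\<in>J. sc (c (w, 2 * j)) (w * (z j * r * \<beta>))) + (\<Sum>w\<in>B. \<Sum>j\<in>J. sc (c (w, 2 * j + 1)) (w * z j))"
        unfolding sumJ' sum.distrib z'_def by simp
      also have "\<dots> = v0 * r * \<beta> + v1"
        unfolding v0_def v1_def
        by (simp add: sum.cartesian_product' sum_distrib_right sc_mult mult.assoc)
      finally have e: "v0 * r * \<beta> + v1 = 0" using 0 by simp
      then have "v0 * r * \<beta> = - v1" by (simp add: eq_neg_iff_add_eq_0)
      then have "v0 = 0" using r sp span_neg by metis
      with e have "v1 = 0" by simp
      have "c (fst p, 2 * snd p) = 0" "c (fst p, 2 * snd p + 1) = 0" if "p \<in> B \<times> J" for p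
        using fam_indepD[OF ind \<open>v0 = 0\<close>[unfolded v0_def] that] fam_indepD[OF ind \<open>v1 = 0\<close>[unfolded v1_def] that]
        by auto
      then show "\<forall>p\<in>B \<times> J'. c p = 0" unfolding J'_def by fastforce
    qed
    have "\<forall>x\<in>set (b # bs). (\<Sum>n\<in>J'. y' n * x * z' n) = 0"
    proof
      fix x assume "x \<in> set (b # bs)"
      then show "(\<Sum>n\<in>J'. y' n * x * z' n) = 0"
        using J(4) val[of x] val[of b, folded \<beta>_def] by (cases "x = b") (auto simp: mult.assoc)
    qed
    moreover have "finite J'" "2 * j0 \<in> J'" "y' (2 * j0) = 1" using J unfolding J'_def y'_def by auto
    ultimately show ?thesis using ind'
      by (intro exI[of _ J'] exI[of _ y'] exI[of _ z'] exI[of _ "2 * j0"]) blast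
  qed
qed

end

context cc_prime
begin

text \<open>A variable l is eliminated by substituting x_l y_j for it, multiplying by z_j on the
  right and summing over j. If the tensor annihilates all \<open>a l i\<close>, the terms of l
  disappear. The other right factors become \<open>a k i * z j\<close>, still independent, and the
  index with y_j = 1 recovers the original coefficient. The last variable is settled by
  \<open>tensor_indep_zero\<close>.\<close>

lemma right_free_general:
  fixes E :: "nat \<Rightarrow> nat \<Rightarrow> (nat \<Rightarrow> 'b) \<Rightarrow> 'b" and a :: "nat \<Rightarrow> nat \<Rightarrow> 'b"
  assumes ns: "no_socle"
    and "finite S" "\<And>k. k \<in> S \<Longrightarrow> finite (I k)" "\<And>k. k \<in> S \<Longrightarrow> fam_indep sc (I k) (a k)"
    "\<And>k i. k \<in> S \<Longrightarrow> local_on (S - {k}) (E k i)"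
    "\<And>x. (\<Sum>k\<in>S. \<Sum>i\<in>I k. E k i x * x k * a k i) = 0" "k \<in> S" "i \<in> I k"
  shows "E k i x = 0"
  using assms(2-)
proof (induction "card S" arbitrary: S E a I k i x)
  case 0
  then show ?case by simp
next
  case (Suc m)
  have other: "E k i x = 0" if k: "k \<in> S" and l: "l \<in> S" "l \<noteq> k" and i: "i \<in> I k" for k l i x
  proof -
    let ?S = "S - {l}"
    define W where "W = (\<Union>k\<in>?S. a k ` I k)"
    have "finite W" unfolding W_def using Suc.prems by auto
    \<comment> \<open>\<open>annihilating_tensor\<close> controls products with an independent set,
      so the right factors of the remaining variables are expressed in a basis of their
      span.\<close>
    obtain B where B: "B \<subseteq> W" "independent B" "W \<subseteq> span B"
      using maximal_independent_subset[of W] by blast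
    have fB: "finite B" using B \<open>finite W\<close> finite_subset by blast
    obtain bs where bs: "set bs = a l ` I l"
      using finite_list[OF finite_imageI[OF Suc.prems(2)[OF l(1)], of "a l"]] by blast
    obtain J y z j0 where J: "finite (J :: nat set)" "j0 \<in> J" "y j0 = (1::'b)"
      "\<forall>b\<in>set bs. (\<Sum>j\<in>J. y j * b * z j) = 0" and ind: "fam_indep sc (B \<times> J) (\<lambda>(w, j). w * z j)"
      using annihilating_tensor[OF ns fB B(2), of bs] by (elim exE conjE, intro that)
    \<comment> \<open>The new family is indexed by pairs of an old index and a tensor index; they
      are coded as numbers to fit the induction hypothesis.\<close>
    define I' where "I' k = prod_encode ` (I k \<times> J)" for k
    define a' where "a' k n = a k (fst (prod_decode n)) * z (snd (prod_decode n))" for k n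
    define E' where "E' k n u = E k (fst (prod_decode n)) (u(l := x l * y (snd (prod_decode n))))" for k n u
    have sumI': "(\<Sum>n\<in>I' k. g n) = (\<Sum>i\<in>I k. \<Sum>j\<in>J. g (prod_encode (i, j)))" for k and g :: "nat \<Rightarrow> 'b"
      unfolding I'_def by (subst sum.reindex) (auto simp: sum.cartesian_product' inj_prod_encode)
    have "E' k (prod_encode (i, j0)) x = 0"
    proof (rule Suc.hyps(1)[of ?S I' a' E'])
      show "m = card ?S" using Suc.hyps(2) Suc.prems(1) l by simp
      show "finite ?S" using Suc.prems by simp
      show "finite (I' k)" if "k \<in> ?S" for k using that Suc.prems(2) J(1) unfolding I'_def by simp
      show "local_on (?S - {k}) (E' k n)" if k: "k \<in> ?S" for k n
        unfolding local_on_def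
      proof (intro allI impI)
        fix u j v assume j: "j \<notin> ?S - {k}"
        have loc: "local_on (S - {k}) (E k (fst (prod_decode n)))" using Suc.prems(4) k by blast
        show "E' k n (u(j := v)) = E' k n u"
        proof (cases "j = l")
          case True
          then show ?thesis unfolding E'_def by simp
        next
          case False
          then have "j \<notin> S - {k}" using j by blast
          from fun_upd_twist[OF False] show ?thesis
            unfolding E'_def using local_onD[OF loc \<open>j \<notin> S - {k}\<close>] by metis
        qed
      qed
      show "fam_indep sc (I' k) (a' k)" if k: "k \<in> ?S" for k
        unfolding fam_indep_def
      proof (intro allI impI)
        fix c assume 0: "(\<Sum>n\<in>I' k. sc (c n) (a' k n)) = 0"
        have "\<exists>g. a k i = (\<Sum>w\<in>B. sc (g w) w)" if "i \<in> I k" for i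
        proof -
          have "a k i \<in> span B" using B(3) k that unfolding W_def by blast
          then show ?thesis unfolding span_finite[OF fB] by auto
        qed
        then obtain g where g: "\<And>i. i \<in> I k \<Longrightarrow> a k i = (\<Sum>w\<in>B. sc (g i w) w)" by metis
        have "(\<Sum>p\<in>B \<times> J. sc ((\<lambda>(w, j). \<Sum>i\<in>I k. c (prod_encode (i, j)) * g i w) p) ((\<lambda>(w, j). w * z j) p))
          = (\<Sum>w\<in>B. \<Sum>j\<in>J. \<Sum>i\<in>I k. sc (c (prod_encode (i, j)) * g i w) (w * z j))"
          by (simp add: sum.cartesian_product' scale_sum_left)
        also have "\<dots> = (\<Sum>i\<in>I k. \<Sum>j\<in>J. \<Sum>w\<in>B. sc (c (prod_encode (i, j)) * g i w) (w * z j))"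
          by (subst sum.swap, subst sum.swap, subst (2) sum.swap, subst sum.swap) (rule sum.swap)
        also have "\<dots> = (\<Sum>n\<in>I' k. sc (c n) (a' k n))"
          unfolding sumI' a'_def
          by (intro sum.cong refl) (simp add: g sum_distrib_right scale_sum_right sc_mult)
        finally have z: "(\<Sum>p\<in>B \<times> J. sc ((\<lambda>(w, j). \<Sum>i\<in>I k. c (prod_encode (i, j)) * g i w) p) ((\<lambda>(w, j). w * z j) p)) = 0"
          using 0 by simp
        have "(\<Sum>i\<in>I k. c (prod_encode (i, j)) * g i w) = 0" if "w \<in> B" "j \<in> J" for w j
          using fam_indepD[OF ind z, of "(w, j)"] that by simp
        then have "(\<Sum>w\<in>B. sc (\<Sum>i\<in>I k. c (prod_encode (i, j)) * g i w) w) = 0" if "j \<in> J" for j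
          using that by simp
        moreover have "(\<Sum>w\<in>B. sc (\<Sum>i\<in>I k. c (prod_encode (i, j)) * g i w) w) = (\<Sum>i\<in>I k. sc (c (prod_encode (i, j))) (a k i))" for j
        proof -
          have "(\<Sum>i\<in>I k. sc (c (prod_encode (i, j))) (a k i)) = (\<Sum>i\<in>I k. \<Sum>w\<in>B. sc (c (prod_encode (i, j)) * g i w) w)"
            by (intro sum.cong refl) (simp add: g scale_sum_right)
          also have "\<dots> = (\<Sum>w\<in>B. \<Sum>i\<in>I k. sc (c (prod_encode (i, j)) * g i w) w)" by (rule sum.swap)
          finally show ?thesis by (simp add: scale_sum_left)
        qed
        ultimately have "(\<Sum>i\<in>I k. sc (c (prod_encode (i, j))) (a k i)) = 0" if "j \<in> J" for j
          using that by simp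
        then have "c (prod_encode (i, j)) = 0" if "j \<in> J" "i \<in> I k" for i j
          using fam_indepD[OF Suc.prems(3), of k "\<lambda>i. c (prod_encode (i, j))" i] that k by simp
        then show "\<forall>n\<in>I' k. c n = 0" unfolding I'_def by auto
      qed
      show "(\<Sum>k\<in>?S. \<Sum>n\<in>I' k. E' k n u * u k * a' k n) = 0" for u
      proof -
        let ?u = "\<lambda>j. u(l := x l * y j)"
        have El: "E l i (?u j) = E l i u" for i j
          using local_onD[OF Suc.prems(4)[OF l(1)], of l i] by simp
        have step: "(\<Sum>k\<in>S. \<Sum>i\<in>I k. E k i (?u j) * ?u j k * a k i) * z j =
            (\<Sum>i\<in>I l. E l i u * x l * (y j * a l i * z j)) + (\<Sum>k\<in>?S. \<Sum>i\<in>I k. E k i (?u j) * u k * a k i * z j)" for j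
        proof -
          have "(\<Sum>k\<in>?S. \<Sum>i\<in>I k. E k i (?u j) * ?u j k * a k i) = (\<Sum>k\<in>?S. \<Sum>i\<in>I k. E k i (?u j) * u k * a k i)"
            by (intro sum.cong refl) auto
          then show ?thesis
            unfolding sum.remove[OF Suc.prems(1) l(1)] distrib_right sum_distrib_right El
            by (simp add: mult.assoc sum_distrib_right)
        qed
        have "0 = (\<Sum>j\<in>J. (\<Sum>k\<in>S. \<Sum>i\<in>I k. E k i (?u j) * ?u j k * a k i) * z j)"
          by (simp only: Suc.prems(5) mult_zero_left sum.neutral_const)
        also have "\<dots> = (\<Sum>j\<in>J. \<Sum>i\<in>I l. E l i u * x l * (y j * a l i * z j))
            + (\<Sum>j\<in>J. \<Sum>k\<in>?S. \<Sum>i\<in>I k. E k i (?u j) * u k * a k i * z j)"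
          unfolding step by (rule sum.distrib)
        also have "(\<Sum>j\<in>J. \<Sum>i\<in>I l. E l i u * x l * (y j * a l i * z j)) = 0"
        proof (subst sum.swap, rule sum.neutral, rule ballI)
          fix i assume "i \<in> I l"
          then have "(\<Sum>j\<in>J. y j * a l i * z j) = 0" using J(4) bs by auto
          then show "(\<Sum>j\<in>J. E l i u * x l * (y j * a l i * z j)) = 0"
            by (simp flip: sum_distrib_left)
        qed
        also have "(\<Sum>j\<in>J. \<Sum>k\<in>?S. \<Sum>i\<in>I k. E k i (?u j) * u k * a k i * z j)
            = (\<Sum>k\<in>?S. \<Sum>i\<in>I k. \<Sum>j\<in>J. E k i (?u j) * u k * a k i * z j)"
          by (subst sum.swap, rule sum.cong[OF refl], rule sum.swap)
        also have "\<dots> = (\<Sum>k\<in>?S. \<Sum>n\<in>I' k. E' k n u * u k * a' k n)"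
          unfolding sumI' E'_def a'_def by (simp add: mult.assoc)
        finally show ?thesis by simp
      qed
      show "k \<in> ?S" using k l by simp
      show "prod_encode (i, j0) \<in> I' k" using i J(2) unfolding I'_def by simp
    qed
    then show ?thesis unfolding E'_def by (simp add: J(3))
  qed
  show ?case
  proof (cases "S = {k}")
    case False
    then obtain l where "l \<in> S" "l \<noteq> k" using Suc.prems(6) by blast
    then show ?thesis using other Suc.prems(6,7) by blast
  next
    case True
    have Ek: "E k i (x(k := v)) = E k i x" for i v
      using local_onD[OF Suc.prems(4)[OF Suc.prems(6)], of k i] by simp
    have "(\<Sum>i\<in>I k. E k i x * v * a k i) = 0" for v
      using Suc.prems(5)[of "x(k := v)"] True Ek by simp
    then show ?thesis
      using tensor_indep_zero[OF Suc.prems(2)[OF Suc.prems(6)] Suc.prems(3)[OF Suc.prems(6)], of "\<lambda>i. E k i x"]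
        Suc.prems(7) by blast
  qed
qed

lemma no_socle_right_free:
  assumes "no_socle"
  shows "right_free m TYPE('b)"
  unfolding right_free_def
proof (intro allI impI ballI)
  fix S :: "nat set" and E :: "nat \<Rightarrow> (nat \<Rightarrow> 'b) \<Rightarrow> 'b" and k x
  assume S: "finite S" "\<forall>k\<in>S. local_on (S - {k}) (E k)" "\<forall>x. (\<Sum>k\<in>S. E k x * x k) = 0" "k \<in> S"
  show "E k x = 0"
    by (rule right_free_general[OF assms S(1), of "\<lambda>_. {0}" "\<lambda>_ _. 1" "\<lambda>k _. E k"])
      (use S in \<open>auto simp: fam_indep_def\<close>)
qed

lemma no_socle_right_free_at:
  assumes "no_socle" and T: "\<And>c. T \<noteq> sc c 1"
  shows "right_free_at m T"
  unfolding right_free_at_def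
proof (intro allI impI ballI)
  fix S :: "nat set" and E E' :: "nat \<Rightarrow> (nat \<Rightarrow> 'b) \<Rightarrow> 'b" and k x
  assume S: "finite S" "\<forall>k\<in>S. local_on (S - {k}) (E k) \<and> local_on (S - {k}) (E' k)"
    "\<forall>x. (\<Sum>k\<in>S. E k x * x k + E' k x * x k * T) = 0" "k \<in> S"
  let ?E = "\<lambda>k i. if i = 0 then E k else E' k" and ?a = "\<lambda>_ i. if i = (0::nat) then 1 else T"
  have ind: "fam_indep sc {0, Suc 0} (?a k)" for k :: nat
    unfolding fam_indep_def
  proof (intro allI impI)
    fix c :: "nat \<Rightarrow> 'f" assume "(\<Sum>i\<in>{0, Suc 0}. sc (c i) (?a k i)) = 0"
    then have 0: "sc (c 0) 1 + sc (c (Suc 0)) T = 0" by simp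
    have "c (Suc 0) = 0"
    proof (rule ccontr)
      assume c: "c (Suc 0) \<noteq> 0"
      have "sc (c (Suc 0)) T = - sc (c 0) 1" using 0 by (simp add: eq_neg_iff_add_eq_0 add.commute)
      then have "sc (1 / c (Suc 0)) (sc (c (Suc 0)) T) = sc (- c 0 / c (Suc 0)) 1" by simp
      then have "T = sc (- c 0 / c (Suc 0)) 1" using c by simp
      then show False using T by blast
    qed
    then show "\<forall>i\<in>{0, Suc 0}. c i = 0" using 0 by simp
  qed
  have *: "?E k i x = 0" if "i \<in> {0, Suc 0}" for i
    by (rule right_free_general[OF assms(1) S(1), of "\<lambda>_. {0, Suc 0}" ?a ?E k i x])
      (use S ind that in auto)
  show "E k x = 0 \<and> E' k x = 0" using *[of 0] *[of "Suc 0"] by simp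
qed

end

subsection \<open>The opposite algebra\<close>

text \<open>Left freeness is right freeness of the opposite algebra. As ring operations are attached
  to types, the opposite algebra gets a type of its own.\<close>

typedef 'a opp = "UNIV :: 'a set" morphisms unopp opp ..

setup_lifting type_definition_opp

instantiation opp :: (ring_1) ring_1
begin
lift_definition zero_opp :: "'a opp" is 0 .
lift_definition one_opp :: "'a opp" is 1 .
lift_definition plus_opp :: "'a opp \<Rightarrow> 'a opp \<Rightarrow> 'a opp" is "(+)" .
lift_definition minus_opp :: "'a opp \<Rightarrow> 'a opp \<Rightarrow> 'a opp" is "(-)" .
lift_definition uminus_opp :: "'a opp \<Rightarrow> 'a opp" is uminus .
lift_definition times_opp :: "'a opp \<Rightarrow> 'a opp \<Rightarrow> 'a opp" is "\<lambda>x y. y * x" .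
instance by standard (transfer, simp add: algebra_simps)+
end

lemma unopp_simps [simp]:
  "unopp 0 = 0" "unopp 1 = 1" "unopp (x + y) = unopp x + unopp y" "unopp (- x) = - unopp x"
  "unopp (x * y) = unopp y * unopp x" "unopp (opp a) = a" "opp (unopp x) = x"
  by (simp_all add: zero_opp.rep_eq one_opp.rep_eq plus_opp.rep_eq uminus_opp.rep_eq times_opp.rep_eq
      opp_inverse unopp_inverse)

lemma opp_simps:
  "opp 0 = 0" "opp (a + b) = opp a + opp b" "opp (- a) = - opp a" "opp (a * b) = opp b * opp a"
  by (simp_all add: unopp_inject[symmetric])

lemma unopp_sum: "unopp (sum f A) = (\<Sum>a\<in>A. unopp (f a))"
  by (induction A rule: infinite_finite_induct) auto

context cc_prime
begin

definition scopp :: "'f \<Rightarrow> 'b opp \<Rightarrow> 'b opp" where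
  "scopp c x = opp (sc c (unopp x))"

lemma opposite: "cc_prime scopp"
proof unfold_locales
  fix a b :: 'f and x y :: "'b opp"
  show "scopp a (x + y) = scopp a x + scopp a y" "scopp (a + b) x = scopp a x + scopp b x"
    "scopp a (scopp b x) = scopp (a * b) x" "scopp 1 x = x"
    "scopp a (x * y) = scopp a x * y" "scopp a (x * y) = x * scopp a y"
    by (simp_all add: scopp_def unopp_inject[symmetric] scale_right_distrib scale_left_distrib sc_mult mult_sc)
next
  show "prime_ring TYPE('b opp)"
    unfolding prime_ring_def
  proof (intro allI impI)
    fix a b :: "'b opp" assume 0: "\<forall>r. a * r * b = 0"
    have "unopp b * r * unopp a = 0" for r
      using arg_cong[OF 0[rule_format, of "opp r"], of unopp] by (simp add: mult.assoc)
    then have "unopp b = 0 \<or> unopp a = 0" by (rule primeD)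
    then show "a = 0 \<or> b = 0" by (simp add: unopp_inject[symmetric] disj_commute)
  qed
  show "centrally_closed scopp"
    unfolding centrally_closed_def
  proof (intro allI impI)
    fix I :: "'b opp set" and g
    assume I: "nonzero_ideal I \<and> (\<forall>x\<in>I. \<forall>y\<in>I. g (x + y) = g x + g y) \<and>
      (\<forall>x\<in>I. \<forall>r. g (r * x) = r * g x \<and> g (x * r) = g x * r)"
    let ?g = "\<lambda>x. unopp (g (opp x))"
    have mem: "y \<in> unopp ` I \<longleftrightarrow> opp y \<in> I" for y
      by (metis image_iff unopp_simps(6,7))
    have "\<exists>c. \<forall>x\<in>unopp ` I. ?g x = sc c x"
    proof (rule cc[unfolded centrally_closed_def, rule_format], intro conjI ballI allI)
      have "I \<noteq> {0}" using I unfolding nonzero_ideal_def by blast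
      moreover have "0 \<in> I" using I unfolding nonzero_ideal_def by blast
      ultimately obtain x where "x \<in> I" "x \<noteq> 0" by blast
      then have nz: "unopp ` I \<noteq> {0}" by (metis imageI singletonD unopp_inject unopp_simps(1))
      show "nonzero_ideal (unopp ` I)"
        using I nz unfolding nonzero_ideal_def by (simp add: mem opp_simps Ball_def)
      fix x y r assume x: "x \<in> unopp ` I"
      show "?g (r * x) = r * ?g x" "?g (x * r) = ?g x * r" using I x by (simp_all add: mem opp_simps)
      assume "y \<in> unopp ` I"
      then show "?g (x + y) = ?g x + ?g y" using I x by (simp add: mem opp_simps)
    qed
    then obtain c where c: "\<And>x. opp x \<in> I \<Longrightarrow> ?g x = sc c x" unfolding mem Ball_def by blast
    have "g x = scopp c x" if "x \<in> I" for x
      using c[of "unopp x"] that unfolding scopp_def by (metis unopp_simps(7))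
    then show "\<exists>c. \<forall>x\<in>I. g x = scopp c x" by blast
  qed
qed

lemma no_socle_left_free:
  assumes ns: "no_socle"
  shows "left_free m TYPE('b)"
proof -
  interpret O: cc_prime scopp by (rule opposite)
  have span: "unopp ` O.span R \<subseteq> span (unopp ` R)" for R
  proof
    fix y assume "y \<in> unopp ` O.span R"
    then obtain x where "x \<in> O.span R" "y = unopp x" by blast
    then show "y \<in> span (unopp ` R)"
    proof (induction arbitrary: y rule: O.span_induct_alt)
      case base
      then show ?case by (simp add: span_zero)
    next
      case (step c x z)
      then have "unopp x \<in> span (unopp ` R)" "unopp z \<in> span (unopp ` R)" by (blast intro: span_base)+
      then show ?case using step.prems by (simp add: scopp_def span_add span_scale)
    qed
  qed
  have "O.no_socle"
    unfolding O.no_socle_def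
  proof (intro allI impI)
    fix w b :: "'b opp" and R assume nz: "w \<noteq> 0" "b \<noteq> 0" and R: "finite (R :: 'b opp set)"
    from nz have "unopp b \<noteq> 0" "unopp w \<noteq> 0" by (metis unopp_inject unopp_simps(1))+
    moreover have "finite (unopp ` R)" using R by simp
    ultimately obtain r where r: "unopp b * r * unopp w \<notin> span (unopp ` R)"
      using ns unfolding no_socle_def by blast
    have "unopp (w * opp r * b) = unopp b * r * unopp w" by (simp add: mult.assoc)
    then have "w * opp r * b \<notin> O.span R"
      using r subsetD[OF span imageI[of "w * opp r * b"]] by metis
    then show "\<exists>r. w * r * b \<notin> O.span R" by (rule exI)
  qed
  from O.no_socle_right_free[OF this] have ru: "right_free m TYPE('b opp)" .
  show ?thesis
    unfolding left_free_def
  proof (intro allI impI ballI)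
    fix S :: "nat set" and F :: "nat \<Rightarrow> (nat \<Rightarrow> 'b) \<Rightarrow> 'b" and k x
    assume S: "finite S" "card S \<le> m" "\<forall>k\<in>S. local_on (S - {k}) (F k)"
      "\<forall>x. (\<Sum>k\<in>S. x k * F k x) = 0" "k \<in> S"
    have "opp (F k (\<lambda>i. unopp (opp (x i)))) = 0"
    proof (rule right_freeD[OF ru S(1,2), of "\<lambda>k x. opp (F k (\<lambda>i. unopp (x i)))" k "\<lambda>i. opp (x i)"])
      fix k assume "k \<in> S"
      then have "local_on (S - {k}) (F k)" using S(3) by blast
      then have "F k ((\<lambda>i. unopp (x i))(j := v)) = F k (\<lambda>i. unopp (x i))" if "j \<notin> S - {k}" for x j v
        using that by (rule local_onD)
      moreover have "(\<lambda>i. unopp ((x(j := y)) i)) = (\<lambda>i. unopp (x i))(j := unopp y)" for x :: "nat \<Rightarrow> 'b opp" and j y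
        by auto
      ultimately show "local_on (S - {k}) (\<lambda>x. opp (F k (\<lambda>i. unopp (x i))))"
        unfolding local_on_def by simp
    next
      fix x :: "nat \<Rightarrow> 'b opp"
      have "unopp (\<Sum>k\<in>S. opp (F k (\<lambda>i. unopp (x i))) * x k) = 0"
        using S(4) by (simp add: unopp_sum)
      then show "(\<Sum>k\<in>S. opp (F k (\<lambda>i. unopp (x i))) * x k) = 0"
        by (metis unopp_inject unopp_simps(1))
    qed fact
    from arg_cong[OF this, of unopp] show "F k x = 0" by simp
  qed
qed

end

subsection \<open>Density at a division idempotent\<close>

context falg
begin

lemma subspace_eq_if_dim_le:
  assumes U: "subspace U" "subspace U'" "U \<subseteq> U'" and R: "U' \<subseteq> span R" "finite R" and dim: "dim U' \<le> dim U"
  shows "U = U'"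
proof (rule ccontr)
  assume "U \<noteq> U'"
  then obtain v where v: "v \<in> U'" "v \<notin> U" using U(3) by blast
  obtain B where B: "B \<subseteq> U" "independent B" "U \<subseteq> span B" "card B = dim U"
    using basis_exists by blast
  obtain B' where B': "B' \<subseteq> U'" "independent B'" "U' \<subseteq> span B'" "card B' = dim U'"
    using basis_exists by blast
  have fB': "finite B'" using independent_span_bound[OF R(2) B'(2)] B'(1) R(1) by blast
  have fB: "finite B" using independent_span_bound[OF R(2) B(2)] B(1) U(3) R(1) by blast
  have "v \<notin> span B" using v(2) span_minimal[OF B(1) U(1)] by blast
  then have "independent (insert v B)" "v \<notin> B"
    using B(2) independent_insertI span_base by auto
  moreover have "insert v B \<subseteq> span B'" using v(1) B(1) U(3) B'(3) by blast
  ultimately have "card (insert v B) \<le> card B'" using independent_span_bound[OF fB'] by blast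
  then show False using fB \<open>v \<notin> B\<close> B(4) B'(4) dim by simp
qed

end

definition division_idempotent :: "'b::ring_1 \<Rightarrow> bool" where
  "division_idempotent e \<longleftrightarrow> e \<noteq> 0 \<and> e * e = e \<and>
    (\<forall>x. x \<noteq> 0 \<longrightarrow> e * x * e = x \<longrightarrow> (\<exists>y. e * y * e = y \<and> x * y = e \<and> y * x = e))"

section \<open>Corners of least dimension\<close>

context cc_prime
begin

text \<open>Take a nonzero c with cAc finite-dimensional of least dimension. A nonzero u in cAc has
  uAu inside cAc, hence equal to it; so u lies in uAu, say u = u y u, and e = y u is idempotent. Its
  corner lies in y(cAc), so it is of least dimension too. For nonzero x in eAe this puts e into xAx,
  which yields an inverse of x.\<close>

lemma ex_division_idempotent:
  assumes "\<not> no_socle"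
  obtains e :: 'b where "division_idempotent e"
proof -
  obtain w b R where R: "w \<noteq> 0" "b \<noteq> 0" "finite R" "\<And>r. w * r * b \<in> span R"
    using assms unfolding no_socle_def by blast
  define corner where "corner c = range (\<lambda>r. c * r * c)" for c :: 'b
  \<comment> \<open>Finite dimension is stated through a finite spanning set, since
    \<open>dim\<close> is 0 on infinite-dimensional spaces and these would otherwise win the
    minimality.\<close>
  define small where "small c \<longleftrightarrow> c \<noteq> 0 \<and> (\<exists>R. finite R \<and> corner c \<subseteq> span R)" for c
  have sub: "subspace (corner c)" for c
    unfolding subspace_def corner_def
  proof (intro conjI ballI allI)
    show "0 \<in> range (\<lambda>r. c * r * c)" by (rule range_eqI[of _ _ 0]) simp
    fix x y assume "x \<in> range (\<lambda>r. c * r * c)" "y \<in> range (\<lambda>r. c * r * c)"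
    then obtain r s where "x = c * r * c" "y = c * s * c" by blast
    then show "x + y \<in> range (\<lambda>r. c * r * c)"
      by (intro range_eqI[of _ _ "r + s"]) (simp add: distrib_left distrib_right)
  next
    fix k x assume "x \<in> range (\<lambda>r. c * r * c)"
    then obtain r where "x = c * r * c" by blast
    then show "sc k x \<in> range (\<lambda>r. c * r * c)"
      by (intro range_eqI[of _ _ "sc k r"]) (simp add: mult_sc sc_mult)
  qed
  have "\<exists>c. small c"
  proof -
    \<comment> \<open>From (b r w) s (b r w) = b r (w s b) r w, the corner of the nonzero element b
      r w is finite-dimensional because wAb is.\<close>
    obtain r where r: "b * r * w \<noteq> 0" using primeD[of b w] R(1,2) by blast
    have "corner (b * r * w) \<subseteq> span ((\<lambda>u. b * r * u * (r * w)) ` R)"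
    proof -
      have lin: "b * r * u * (r * w) \<in> span ((\<lambda>u. b * r * u * (r * w)) ` R)" if "u \<in> span R" for u
        using that
        by (induction rule: span_induct_alt)
          (auto simp: span_zero distrib_left distrib_right mult_sc sc_mult
            intro!: span_add span_scale intro: span_base)
      show ?thesis
        unfolding corner_def
      proof (rule image_subsetI)
        fix s
        have "b * r * w * s * (b * r * w) = b * r * (w * s * b) * (r * w)" by (simp add: mult.assoc)
        then show "b * r * w * s * (b * r * w) \<in> span ((\<lambda>u. b * r * u * (r * w)) ` R)"
          using lin[OF R(4), of s] by simp
      qed
    qed
    then show ?thesis using r R(3) unfolding small_def by blast
  qed
  then obtain c where c: "small c" "\<And>c'. small c' \<Longrightarrow> dim (corner c) \<le> dim (corner c')"
    using ex_has_least_nat[of small _ "\<lambda>c. dim (corner c)"] by blast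
  have corner_sub: "corner x \<subseteq> corner y" if xy: "x \<in> corner y" for x y
  proof -
    obtain s where s: "x = y * s * y" using xy unfolding corner_def by blast
    show ?thesis unfolding corner_def
    proof (rule image_subsetI)
      fix r
      have "x * r * x = y * (s * y * r * y * s) * y" unfolding s by (simp add: mult.assoc)
      then show "x * r * x \<in> range (\<lambda>r. y * r * y)" by blast
    qed
  qed
  have corner_eq: "corner x = corner y"
    if y: "small y" "dim (corner y) \<le> dim (corner c)" "x \<in> corner y" "x \<noteq> 0" for x y
  proof -
    obtain R where R: "finite R" "corner y \<subseteq> span R" using y(1) unfolding small_def by blast
    have "small x" using corner_sub[OF y(3)] R y(4) unfolding small_def by blast
    then have "dim (corner y) \<le> dim (corner x)" using c(2) y(2) order_trans by blast
    then show ?thesis using subspace_eq_if_dim_le[OF sub sub corner_sub[OF y(3)] R(2,1)] by blast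
  qed
  obtain u where u: "u \<in> corner c" "u \<noteq> 0"
    using primeD[of c c] c(1) unfolding small_def corner_def by blast
  have cu: "corner u = corner c" using corner_eq[OF c(1) order_refl u] .
  then obtain y where y: "u = u * y * u" using u(1) unfolding corner_def by blast
  define e where "e = y * u"
  have "u * e = u" using y unfolding e_def by (simp add: mult.assoc)
  then have e: "e \<noteq> 0" "e * e = e" using u(2) unfolding e_def by (auto simp: mult.assoc)
  have ce: "corner e \<subseteq> (*) y ` corner c"
  proof -
    have "e * r * e = y * (u * (r * y) * u)" for r unfolding e_def by (simp add: mult.assoc)
    then show ?thesis unfolding cu[symmetric] by (auto simp: corner_def)
  qed
  obtain R' where R': "finite R'" "corner c \<subseteq> span R'" using c(1) unfolding small_def by blast
  have spanR: "(*) y ` corner c \<subseteq> span ((*) y ` R')"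
  proof (rule image_subsetI)
    fix v assume "v \<in> corner c"
    then have "v \<in> span R'" using R'(2) by blast
    then show "y * v \<in> span ((*) y ` R')"
      by (induction rule: span_induct_alt)
        (auto simp: span_zero distrib_left mult_sc intro!: span_add span_scale intro: span_base)
  qed
  have smalle: "small e" using e ce spanR R'(1) unfolding small_def by blast
  have dime: "dim (corner e) \<le> dim (corner c)"
  proof -
    obtain B where B: "B \<subseteq> corner c" "independent B" "corner c \<subseteq> span B" "card B = dim (corner c)"
      using basis_exists by blast
    have fB: "finite B" using independent_span_bound[OF R'(1) B(2)] B(1) R'(2) by blast
    have "corner e \<subseteq> span ((*) y ` B)"
    proof
      fix z assume "z \<in> corner e"
      then obtain v where v: "v \<in> corner c" "z = y * v" using ce by blast
      then have "v \<in> span B" using B(3) by blast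
      then show "z \<in> span ((*) y ` B)" unfolding v(2)
        by (induction rule: span_induct_alt)
          (auto simp: span_zero distrib_left mult_sc intro!: span_add span_scale intro: span_base)
    qed
    then have "dim (corner e) \<le> card ((*) y ` B)" using dim_le_card fB by blast
    then show ?thesis using card_image_le[OF fB, of "(*) y"] B(4) by simp
  qed
  have "division_idempotent e"
    unfolding division_idempotent_def
  proof (intro conjI allI impI e)
    fix x assume x: "x \<noteq> 0" "e * x * e = x"
    have "x \<in> corner e" unfolding corner_def by (rule range_eqI[of _ _ x]) (simp add: x)
    then have "corner x = corner e" using corner_eq[OF smalle dime _ x(1)] by blast
    moreover have "e \<in> corner e" unfolding corner_def by (rule range_eqI[of _ _ 1]) (simp add: e)
    ultimately obtain a where a: "e = x * a * x" unfolding corner_def by blast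
    have ex: "e * x = x" "x * e = x" using x(2) e(2) by (metis mult.assoc)+
    define y z where "y = e * a * x * e" and "z = e * x * a * e"
    have xy: "x * y = e" unfolding y_def using ex a e(2) by (metis mult.assoc)
    have zx: "z * x = e" unfolding z_def using ex a e(2) by (metis mult.assoc)
    have "y = z"
    proof -
      have "y = e * y" unfolding y_def using e(2) by (simp flip: mult.assoc)
      also have "\<dots> = z * (x * y)" unfolding zx[symmetric] by (simp add: mult.assoc)
      also have "\<dots> = z" unfolding xy z_def using e(2) by (simp add: mult.assoc)
      finally show ?thesis .
    qed
    moreover have "e * y * e = y" unfolding y_def using e(2) by (metis mult.assoc)
    ultimately show "\<exists>y. e * y * e = y \<and> x * y = e \<and> y * x = e" using xy zx by blast
  qed
  then show ?thesis using that by blast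
qed

end

text \<open>Closure under the ring operations is left to follow: the last clause puts into L
  everything in eAe that commutes with L, and when eAe is a division ring this makes L a field with
  unit e.\<close>

definition maximal_commuting :: "'b::ring_1 \<Rightarrow> 'b set \<Rightarrow> bool" where
  "maximal_commuting e L \<longleftrightarrow> (\<forall>l\<in>L. e * l * e = l) \<and> (\<forall>l\<in>L. \<forall>m\<in>L. l * m = m * l) \<and>
    (\<forall>x. e * x * e = x \<longrightarrow> (\<forall>l\<in>L. x * l = l * x) \<longrightarrow> x \<in> L)"

lemma ex_maximal_commuting: "\<exists>L. maximal_commuting (e::'b::ring_1) L"
proof -
  define A where "A = {M. (\<forall>l\<in>M. e * l * e = l) \<and> (\<forall>l\<in>M. \<forall>m\<in>M. l * m = m * l)}"
  have "\<exists>M\<in>A. \<forall>X\<in>A. M \<subseteq> X \<longrightarrow> X = M"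
  proof (rule subset_Zorn')
    fix C assume C: "subset.chain A C"
    then have CA: "C \<subseteq> A" by (simp add: subset.chain_def)
    have "l * m = m * l" if "X \<in> C" "l \<in> X" "Y \<in> C" "m \<in> Y" for X Y l m
    proof -
      have "X \<subseteq> Y \<or> Y \<subseteq> X" using C that by (auto simp: subset_chain_def)
      then show ?thesis using CA that unfolding A_def by blast
    qed
    then show "\<Union>C \<in> A" using CA unfolding A_def by blast
  qed
  then obtain L where L: "L \<in> A" "\<And>X. X \<in> A \<Longrightarrow> L \<subseteq> X \<Longrightarrow> X = L" by blast
  have "x \<in> L" if "e * x * e = x" "\<forall>l\<in>L. x * l = l * x" for x
  proof -
    have "insert x L \<in> A" using L(1) that unfolding A_def by auto
    then show ?thesis using L(2) by blast
  qed
  then show ?thesis using L(1) unfolding maximal_commuting_def A_def by blast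
qed

locale cc_corner = cc_prime sc for sc :: "'f::field \<Rightarrow> 'b::ring_1 \<Rightarrow> 'b" +
  fixes e :: 'b and L :: "'b set"
  assumes div_e: "division_idempotent e" and max_L: "maximal_commuting e L"
begin

lemma e_nz: "e \<noteq> 0" and ee: "e * e = e"
  using div_e unfolding division_idempotent_def by auto

lemma L_corner: "l \<in> L \<Longrightarrow> e * l = l" "l \<in> L \<Longrightarrow> l * e = l"
  using max_L ee unfolding maximal_commuting_def by (metis mult.assoc)+

lemma L_comm: "l \<in> L \<Longrightarrow> m \<in> L \<Longrightarrow> l * m = m * l"
  using max_L unfolding maximal_commuting_def by blast

lemma L_max: "e * x * e = x \<Longrightarrow> (\<And>l. l \<in> L \<Longrightarrow> x * l = l * x) \<Longrightarrow> x \<in> L"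
  using max_L unfolding maximal_commuting_def by blast

lemma L_closed:
  "e \<in> L" "0 \<in> L" "l \<in> L \<Longrightarrow> m \<in> L \<Longrightarrow> l + m \<in> L" "l \<in> L \<Longrightarrow> - l \<in> L"
  "l \<in> L \<Longrightarrow> m \<in> L \<Longrightarrow> l * m \<in> L"
proof -
  show "e \<in> L" by (rule L_max) (simp_all add: ee L_corner)
  show "0 \<in> L" by (rule L_max) simp_all
  show "l + m \<in> L" if "l \<in> L" "m \<in> L"
    by (rule L_max) (use that in \<open>simp_all add: L_corner L_comm distrib_left distrib_right\<close>)
  show "- l \<in> L" if "l \<in> L" by (rule L_max) (use that in \<open>simp_all add: L_corner L_comm\<close>)
  show "l * m \<in> L" if "l \<in> L" "m \<in> L"
  proof (rule L_max)
    show "e * (l * m) * e = l * m" using that L_corner by (metis mult.assoc)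
    show "l * m * k = k * (l * m)" if "k \<in> L" for k
      using that \<open>l \<in> L\<close> \<open>m \<in> L\<close> L_comm by (metis mult.assoc)
  qed
qed

lemma L_sum: "(\<And>i. i \<in> I \<Longrightarrow> f i \<in> L) \<Longrightarrow> sum f I \<in> L"
  by (induction I rule: infinite_finite_induct) (auto simp: L_closed)

lemma L_inverse:
  assumes "l \<in> L" "l \<noteq> 0"
  obtains m where "m \<in> L" "l * m = e" "m * l = e"
proof -
  have "e * l * e = l" using L_corner assms by simp
  then obtain m where m: "e * m * e = m" "l * m = e" "m * l = e"
    using div_e assms(2) unfolding division_idempotent_def by metis
  have em: "e * m = m" "m * e = m" using m(1) ee by (metis mult.assoc)+
  have "m \<in> L"
  proof (rule L_max[OF m(1)])
    fix k assume k: "k \<in> L"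
    have "m * k = m * (k * l) * m" using m em L_corner[OF k] by (metis mult.assoc)
    also have "\<dots> = m * l * k * m" using L_comm[OF k assms(1)] by (simp add: mult.assoc)
    also have "\<dots> = k * m" using m L_corner[OF k] by simp
    finally show "m * k = k * m" .
  qed
  then show ?thesis using that m by blast
qed

text \<open>By primeness some e r x is nonzero, and it lies in the division ring eAe, where it can
  be inverted. So Ae is a minimal left ideal.\<close>

lemma minimal_left_ideal:
  assumes "x * e = x" "x \<noteq> 0"
  obtains a where "a * x = e"
proof -
  obtain r where r: "e * r * x \<noteq> 0" using primeD[of e x] e_nz assms(2) by blast
  have "e * (e * r * x) * e = e * r * x" using ee assms(1) by (metis mult.assoc)
  then obtain y where "y * (e * r * x) = e"
    using div_e r unfolding division_idempotent_def by blast
  then show ?thesis using that[of "y * e * r"] by (simp add: mult.assoc)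
qed

text \<open>The algebra generated by left multiplications by A and right multiplications by L. Its
  operators map into Ae and are right L-linear, because L is commutative.\<close>

definition is_op :: "('b \<Rightarrow> 'b) \<Rightarrow> bool" where
  "is_op S \<longleftrightarrow> (\<exists>ps. (\<forall>(a, l)\<in>set ps. l \<in> L) \<and> (\<forall>x. S x = (\<Sum>(a, l)\<leftarrow>ps. a * x * l)))"

lemma is_op_elementary: "l \<in> L \<Longrightarrow> is_op (\<lambda>x. a * x * l)"
  unfolding is_op_def by (intro exI[of _ "[(a, l)]"]) simp

lemma is_op_add: "is_op S \<Longrightarrow> is_op S' \<Longrightarrow> is_op (\<lambda>x. S x + S' x)"
  unfolding is_op_def
  by (elim exE conjE, rule_tac x = "ps @ psa" in exI) auto

lemma is_op_zero: "is_op (\<lambda>x. 0)"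
  unfolding is_op_def by (rule exI[of _ "[]"]) simp

lemma is_op_lmult:
  assumes "is_op S"
  shows "is_op (\<lambda>x. w * S x)"
proof -
  obtain ps where ps: "\<forall>(a, l)\<in>set ps. l \<in> L" "\<And>x. S x = (\<Sum>(a, l)\<leftarrow>ps. a * x * l)"
    using assms unfolding is_op_def by blast
  have "w * (\<Sum>(a, l)\<leftarrow>ps. a * x * l) = (\<Sum>(a, l)\<leftarrow>map (\<lambda>(a, l). (w * a, l)) ps. a * x * l)" for x
    by (induction ps) (auto simp: algebra_simps)
  then show ?thesis unfolding is_op_def
    by (intro exI[of _ "map (\<lambda>(a, l). (w * a, l)) ps"]) (use ps in auto)
qed

lemma is_op_rmult:
  assumes "is_op S" "m \<in> L"
  shows "is_op (\<lambda>x. S x * m)"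
proof -
  obtain ps where ps: "\<forall>(a, l)\<in>set ps. l \<in> L" "\<And>x. S x = (\<Sum>(a, l)\<leftarrow>ps. a * x * l)"
    using assms unfolding is_op_def by blast
  have "(\<Sum>(a, l)\<leftarrow>ps. a * x * l) * m = (\<Sum>(a, l)\<leftarrow>map (\<lambda>(a, l). (a, l * m)) ps. a * x * l)" for x
    by (induction ps) (auto simp: algebra_simps)
  then show ?thesis unfolding is_op_def
    by (intro exI[of _ "map (\<lambda>(a, l). (a, l * m)) ps"]) (use ps assms(2) L_closed(5) in auto)
qed

lemma is_op_diff: "is_op S \<Longrightarrow> is_op S' \<Longrightarrow> is_op (\<lambda>x. S x - S' x)"
  using is_op_add[of S "\<lambda>x. - 1 * S' x"] is_op_lmult[of S' "- 1"] by simp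

lemma is_op_sum: "(\<And>i. i \<in> I \<Longrightarrow> is_op (S i)) \<Longrightarrow> is_op (\<lambda>x. \<Sum>i\<in>I. S i x)"
  by (induction I rule: infinite_finite_induct) (auto simp: is_op_zero is_op_add)

lemma is_op_linear:
  assumes "is_op S"
  shows "S (x + y) = S x + S y" "l \<in> L \<Longrightarrow> S (x * l) = S x * l" "S x * e = S x"
proof -
  obtain ps where ps: "\<forall>(a, l)\<in>set ps. l \<in> L" "\<And>x. S x = (\<Sum>(a, l)\<leftarrow>ps. a * x * l)"
    using assms unfolding is_op_def by blast
  show "S (x + y) = S x + S y" unfolding ps(2)
    by (induction ps) (auto simp: algebra_simps)
  show "S (x * l) = S x * l" if l: "l \<in> L"
    unfolding ps(2) using ps(1)
  proof (induction ps)
    case (Cons p ps)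
    have "a * (x * l) * m = a * x * m * l" if "m \<in> L" for a m
      using L_comm[OF l that] by (simp add: mult.assoc)
    then show ?case using Cons by (auto simp: distrib_right)
  qed simp
  show "S x * e = S x"
    unfolding ps(2) using ps(1)
    by (induction ps) (auto simp: distrib_right mult.assoc L_corner)
qed

lemma is_op_sum_arg: "is_op S \<Longrightarrow> S (\<Sum>i\<in>I. f i) = (\<Sum>i\<in>I. S (f i))"
proof -
  assume S: "is_op S"
  interpret additive S by standard (rule is_op_linear(1)[OF S])
  show ?thesis by (rule sum)
qed

definition in_spanL :: "'i set \<Rightarrow> ('i \<Rightarrow> 'b) \<Rightarrow> 'b \<Rightarrow> bool" where
  "in_spanL I v u \<longleftrightarrow> (\<exists>l. (\<forall>i\<in>I. l i \<in> L) \<and> u = (\<Sum>i\<in>I. v i * l i))"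

lemma in_spanLI: "(\<And>i. i \<in> I \<Longrightarrow> l i \<in> L) \<Longrightarrow> u = (\<Sum>i\<in>I. v i * l i) \<Longrightarrow> in_spanL I v u"
  unfolding in_spanL_def by (rule exI[of _ l]) simp

lemma in_spanLE:
  assumes "in_spanL I v u"
  obtains l where "\<And>i. i \<in> I \<Longrightarrow> l i \<in> L" "u = (\<Sum>i\<in>I. v i * l i)"
  using assms unfolding in_spanL_def by (elim exE conjE, intro that) auto

text \<open>Jacobson density for Ae as a module over A and L; it works because a maximal commuting L is
  its own centralizer in eAe.\<close>
lemma density:
  assumes "finite I" "\<And>i. i \<in> I \<Longrightarrow> v i * e = v i" "u * e = u" "\<not> in_spanL I v u"
  shows "\<exists>S. is_op S \<and> (\<forall>i\<in>I. S (v i) = 0) \<and> S u \<noteq> 0"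
  using assms
proof (induction I arbitrary: u)
  case empty
  then have "u \<noteq> 0" by (simp add: in_spanL_def)
  then show ?case
    using is_op_elementary[OF L_closed(1), of 1] empty.prems by (intro exI[of _ "\<lambda>x. 1 * x * e"]) simp
next
  case (insert k I)
  show ?case
  proof (rule ccontr)
    assume neg: "\<not> ?thesis"
    have kills: "S u = 0" if "is_op S" "\<And>i. i \<in> I \<Longrightarrow> S (v i) = 0" "S (v k) = 0" for S
      using neg that by blast
    have mono: "in_spanL (insert k I) v x" if x: "in_spanL I v (x - v k * m)" and m: "m \<in> L" for x m
    proof -
      obtain l where l: "\<And>i. i \<in> I \<Longrightarrow> l i \<in> L" "x - v k * m = (\<Sum>i\<in>I. v i * l i)"
        using x by (rule in_spanLE) blast
      have "x = (\<Sum>i\<in>insert k I. v i * (l(k := m)) i)"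
      proof -
        have "(\<Sum>i\<in>I. v i * (l(k := m)) i) = (\<Sum>i\<in>I. v i * l i)"
          using insert.hyps by (intro sum.cong) auto
        then show ?thesis using insert.hyps l(2) by (simp add: algebra_simps)
      qed
      then show ?thesis by (rule in_spanLI[rotated]) (use l(1) m in auto)
    qed
    show False
    proof (cases "in_spanL I v (v k)")
      case True
      then obtain l where l: "\<And>i. i \<in> I \<Longrightarrow> l i \<in> L" "v k = (\<Sum>i\<in>I. v i * l i)"
        by (rule in_spanLE) blast
      have "\<not> in_spanL I v u" using mono[of u 0] insert.prems(3) L_closed(2) by auto
      then obtain S where S: "is_op S" "\<forall>i\<in>I. S (v i) = 0" "S u \<noteq> 0"
        using insert.IH[of u] insert.prems by blast
      have "S (v k) = 0"
        unfolding l(2) is_op_sum_arg[OF S(1)] using S(2) l(1) is_op_linear(2)[OF S(1)] by (intro sum.neutral) auto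
      then show False using kills[OF S(1)] S by blast
    next
      case False
      then obtain S1 where S1: "is_op S1" "\<forall>i\<in>I. S1 (v i) = 0" "S1 (v k) \<noteq> 0"
        using insert.IH[of "v k"] insert.prems by blast
      obtain a where a: "a * S1 (v k) = e" using minimal_left_ideal[OF is_op_linear(3)[OF S1(1)] S1(3)] .
      define S0 where "S0 x = a * S1 x" for x
      have S0: "is_op S0" "\<And>i. i \<in> I \<Longrightarrow> S0 (v i) = 0" "S0 (v k) = e"
        unfolding S0_def using is_op_lmult[OF S1(1)] S1 a by auto
      \<comment> \<open>The candidate for the coefficient of u at \<open>v k\<close>. Each operator
        tested below vanishes at the \<open>v i\<close> and at \<open>v k\<close>, hence at u by
        \<open>kills\<close>. This first forces \<delta> into L, and then shows that every operator
        killing the \<open>v i\<close> also kills u - v_k \<delta>.\<close>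
      define \<delta> where "\<delta> = S0 u"
      have "e * S0 u - S0 u = 0"
        by (rule kills[of "\<lambda>x. e * S0 x - S0 x"]) (simp_all add: S0 ee is_op_diff is_op_lmult)
      then have "e * \<delta> * e = \<delta>" using is_op_linear(3)[OF S0(1)] unfolding \<delta>_def by simp
      moreover have "\<delta> * l = l * \<delta>" if l: "l \<in> L" for l
      proof -
        have "S0 u * l - l * S0 u = 0"
          by (rule kills[of "\<lambda>x. S0 x * l - l * S0 x"])
            (simp_all add: S0 is_op_diff is_op_lmult is_op_rmult l L_corner)
        then show ?thesis unfolding \<delta>_def by simp
      qed
      ultimately have \<delta>: "\<delta> \<in> L" by (rule L_max)
      have van: "S (u - v k * \<delta>) = 0" if S: "is_op S" "\<And>i. i \<in> I \<Longrightarrow> S (v i) = 0" for S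
      proof -
        have "S u - S (v k) * S0 u = 0"
          by (rule kills[of "\<lambda>x. S x - S (v k) * S0 x"])
            (simp_all add: S0 S is_op_diff is_op_lmult is_op_linear(3)[OF S(1)])
        moreover have "S u = S (u - v k * \<delta>) + S (v k * \<delta>)" using is_op_linear(1)[OF S(1), of "u - v k * \<delta>" "v k * \<delta>"] by simp
        ultimately show ?thesis using is_op_linear(2)[OF S(1) \<delta>, of "v k"] unfolding \<delta>_def by simp
      qed
      have fix_e: "(u - v k * \<delta>) * e = u - v k * \<delta>"
        using insert.prems(2) L_corner(2)[OF \<delta>] by (simp add: left_diff_distrib mult.assoc)
      have "in_spanL I v (u - v k * \<delta>)"
      proof (rule ccontr)
        assume "\<not> ?thesis"
        from insert.IH[OF insert.prems(1) fix_e this] obtain S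
          where "is_op S" "\<forall>i\<in>I. S (v i) = 0" "S (u - v k * \<delta>) \<noteq> 0" by blast
        then show False using van by blast
      qed
      then show False using mono[OF _ \<delta>] insert.prems(3) by blast
    qed
  qed
qed

section \<open>Linear algebra over L\<close>

definition indepL :: "'i set \<Rightarrow> ('i \<Rightarrow> 'b) \<Rightarrow> bool" where
  "indepL I v \<longleftrightarrow> (\<forall>l. (\<forall>i\<in>I. l i \<in> L) \<longrightarrow> (\<Sum>i\<in>I. v i * l i) = 0 \<longrightarrow> (\<forall>i\<in>I. l i = 0))"

lemma indepLD:
  "indepL I v \<Longrightarrow> (\<And>i. i \<in> I \<Longrightarrow> l i \<in> L) \<Longrightarrow> (\<Sum>i\<in>I. v i * l i) = 0 \<Longrightarrow> i \<in> I \<Longrightarrow> l i = 0"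
  unfolding indepL_def by simp

text \<open>Density separates \<open>v j\<close> from the span of the other vectors; minimality of
  Ae then adjusts the value at \<open>v j\<close> to any w.\<close>

lemma dual_op:
  assumes I: "finite I" "\<And>i. i \<in> I \<Longrightarrow> v i * e = v i" "indepL I v" and j: "j \<in> I" and w: "w * e = w"
  obtains S where "is_op S" "S (v j) = w" "\<And>i. i \<in> I \<Longrightarrow> i \<noteq> j \<Longrightarrow> S (v i) = 0"
proof -
  have "\<not> in_spanL (I - {j}) v (v j)"
  proof
    assume "in_spanL (I - {j}) v (v j)"
    then obtain l where l: "\<And>i. i \<in> I - {j} \<Longrightarrow> l i \<in> L" "v j = (\<Sum>i\<in>I - {j}. v i * l i)"
      by (rule in_spanLE) blast
    have "(\<Sum>i\<in>I. v i * (l(j := - e)) i) = v j * - e + (\<Sum>i\<in>I - {j}. v i * l i)"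
      using I(1) j by (simp add: sum.remove[of I j])
    also have "\<dots> = 0" using l(2) I(2)[OF j] by simp
    finally have "(l(j := - e)) j = 0"
      by (rule indepLD[OF I(3) _ _ j, rotated]) (use l(1) L_closed in auto)
    then show False using e_nz by simp
  qed
  then obtain S where S: "is_op S" "\<forall>i\<in>I - {j}. S (v i) = 0" "S (v j) \<noteq> 0"
    using density[of "I - {j}" v "v j"] I j by blast
  obtain a where a: "a * S (v j) = e" using minimal_left_ideal[OF is_op_linear(3)[OF S(1)] S(3)] .
  show ?thesis
  proof (rule that[of "\<lambda>x. w * a * S x"])
    show "is_op (\<lambda>x. w * a * S x)" by (rule is_op_lmult[OF S(1)])
    show "w * a * S (v j) = w" using a w by (simp add: mult.assoc)
  qed (use S in auto)
qed

text \<open>Gaussian elimination over the field L: a pivot in row k removes one equation and one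
  unknown.\<close>

lemma linear_system:
  assumes "finite K" "finite B" "card K < card B" "\<And>k b. k \<in> K \<Longrightarrow> b \<in> B \<Longrightarrow> c k b \<in> L"
  shows "\<exists>x. (\<forall>b\<in>B. x b \<in> L) \<and> (\<exists>b\<in>B. x b \<noteq> 0) \<and> (\<forall>k\<in>K. (\<Sum>b\<in>B. c k b * x b) = 0)"
  using assms
proof (induction K arbitrary: B c)
  case empty
  then have "B \<noteq> {}" by auto
  then show ?case using L_closed(1) e_nz by (intro exI[of _ "\<lambda>_. e"]) auto
next
  case (insert k K)
  show ?case
  proof (cases "\<forall>b\<in>B. c k b = 0")
    case True
    obtain x where "\<forall>b\<in>B. x b \<in> L" "\<exists>b\<in>B. x b \<noteq> 0" "\<forall>k\<in>K. (\<Sum>b\<in>B. c k b * x b) = 0"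
      using insert.IH[of B c] insert.prems insert.hyps by auto
    then show ?thesis using True by (intro exI[of _ x]) auto
  next
    case False
    then obtain p where p: "p \<in> B" "c k p \<noteq> 0" by blast
    obtain g where g: "g \<in> L" "c k p * g = e" using L_inverse[OF insert.prems(3)[OF _ p(1)] p(2)] by blast
    let ?B = "B - {p}"
    define c' where "c' j b = c j b - c j p * g * c k b" for j b
    have "card K < card ?B" using insert.prems(1,2) insert.hyps p(1) by simp
    moreover have "c' j b \<in> L" if "j \<in> K" "b \<in> ?B" for j b
      unfolding c'_def using L_closed insert.prems(3) that p(1) g(1)
      by (metis DiffD1 add_uminus_conv_diff insertCI)
    ultimately obtain x where x: "\<forall>b\<in>?B. x b \<in> L" "\<exists>b\<in>?B. x b \<noteq> 0" "\<forall>j\<in>K. (\<Sum>b\<in>?B. c' j b * x b) = 0"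
      using insert.IH[of ?B c'] insert.prems(1) by blast
    define s where "s = (\<Sum>b\<in>?B. c k b * x b)"
    have sL: "s \<in> L" unfolding s_def using x(1) insert.prems(3) by (intro L_sum L_closed(5)) auto
    define x' where "x' = x(p := - (g * s))"
    have sum: "(\<Sum>b\<in>B. c j b * x' b) = (\<Sum>b\<in>?B. c j b * x b) - c j p * (g * s)" for j
      using insert.prems(1) p(1) unfolding x'_def by (simp add: sum.remove[of B p])
    show ?thesis
    proof (intro exI[of _ x'] conjI ballI)
      show "x' b \<in> L" if "b \<in> B" for b using that x(1) L_closed g(1) sL unfolding x'_def by auto
      show "\<exists>b\<in>B. x' b \<noteq> 0" using x(2) unfolding x'_def by auto
      fix j assume "j \<in> insert k K"
      then consider "j = k" | "j \<in> K" by blast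
      then show "(\<Sum>b\<in>B. c j b * x' b) = 0"
      proof cases
        case 1
        have "c k p * (g * s) = s" using g(2) L_corner[OF sL] by (simp flip: mult.assoc)
        then show ?thesis unfolding sum 1 by (simp add: s_def)
      next
        case 2
        have "(\<Sum>b\<in>?B. c' j b * x b) = (\<Sum>b\<in>?B. c j b * x b) - c j p * (g * s)"
          unfolding c'_def s_def by (simp add: left_diff_distrib sum_subtractf sum_distrib_left mult.assoc)
        then show ?thesis using x(3) 2 unfolding sum by simp
      qed
    qed
  qed
qed

lemma indepL_or_spanning:
  "(\<exists>v. (\<forall>i<n. v i * e = v i) \<and> indepL {..<n} v) \<or>
    (\<exists>r<n. \<exists>v. (\<forall>i<r. v i * e = v i) \<and> (\<forall>u. u * e = u \<longrightarrow> in_spanL {..<r} v u))" for n :: nat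
proof (induction n)
  case 0
  show ?case by (auto simp: indepL_def)
next
  case (Suc n)
  then consider v where "\<forall>i<n. v i * e = v i" "indepL {..<n} v"
    | r v where "r < n" "\<forall>i<r. v i * e = v i" "\<forall>u. u * e = u \<longrightarrow> in_spanL {..<r} v u" by blast
  then show ?case
  proof cases
    case 2
    then show ?thesis using less_SucI by blast
  next
    case (1 v)
    show ?thesis
    proof (cases "\<forall>u. u * e = u \<longrightarrow> in_spanL {..<n} v u")
      case True
      then show ?thesis using 1 by blast
    next
      case False
      then obtain u where u: "u * e = u" "\<not> in_spanL {..<n} v u" by blast
      have "indepL {..<Suc n} (v(n := u))"
        unfolding indepL_def
      proof (intro allI impI)
        fix l assume l: "\<forall>i\<in>{..<Suc n}. l i \<in> L" "(\<Sum>i<Suc n. (v(n := u)) i * l i) = 0"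
        have s: "(\<Sum>i<n. v i * l i) + u * l n = 0"
          using l(2) by simp
        have "l n = 0"
        proof (rule ccontr)
          assume "l n \<noteq> 0"
          then obtain m where m: "m \<in> L" "l n * m = e" using L_inverse[of "l n"] l(1) by auto
          have "u = u * l n * m" using m(2) u(1) by (simp add: mult.assoc)
          also have "u * l n = - (\<Sum>i<n. v i * l i)" using s by (simp add: eq_neg_iff_add_eq_0 add.commute)
          finally have "u = (\<Sum>i<n. v i * - (l i * m))"
            by (simp add: sum_distrib_right mult.assoc sum_negf)
          moreover have "- (l i * m) \<in> L" if "i \<in> {..<n}" for i using l(1) m(1) L_closed that by auto
          ultimately show False using u(2) in_spanLI[of "{..<n}" "\<lambda>i. - (l i * m)" u v] by blast
        qed
        moreover from this have "\<forall>i\<in>{..<n}. l i = 0"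
          using s indepLD[OF 1(2), of l] l(1) by auto
        ultimately show "\<forall>i\<in>{..<Suc n}. l i = 0" by (auto simp: less_Suc_eq)
      qed
      moreover have "\<forall>i<Suc n. (v(n := u)) i * e = (v(n := u)) i" using 1(1) u(1) by (auto simp: less_Suc_eq)
      ultimately show ?thesis by blast
    qed
  qed
qed

text \<open>Otherwise Ae is spanned over L by r \<le> d vectors, on which the d^2 + 1 elements a_b
  act by r x r matrices over L. An L-dependence x_b between these matrices gives \<Sum> a_b y x_b =
  0 for all y, and a functional dual to one a_b with x_b nonzero yields x_b = 0.\<close>

lemma ex_indepL:
  assumes a: "fam_indep sc {..d^2} (a :: nat \<Rightarrow> 'b)"
  obtains v :: "nat \<Rightarrow> 'b" where "\<And>i. i \<le> d \<Longrightarrow> v i * e = v i" "indepL {..d} v"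
proof -
  have "\<not> (\<exists>r<Suc d. \<exists>v :: nat \<Rightarrow> 'b. (\<forall>i<r. v i * e = v i) \<and> (\<forall>u. u * e = u \<longrightarrow> in_spanL {..<r} v u))"
  proof
    assume "\<exists>r<Suc d. \<exists>v :: nat \<Rightarrow> 'b. (\<forall>i<r. v i * e = v i) \<and> (\<forall>u. u * e = u \<longrightarrow> in_spanL {..<r} v u)"
    then obtain r and v :: "nat \<Rightarrow> 'b" where r: "r < Suc d" and v: "\<And>i. i < r \<Longrightarrow> v i * e = v i"
      and span: "\<And>u. u * e = u \<Longrightarrow> in_spanL {..<r} v u" by blast
    have "\<exists>c. (\<forall>i\<in>{..<r}. c i \<in> L) \<and> a b * v j = (\<Sum>i<r. v i * c i)" if "j < r" for b j
      using span[of "a b * v j"] v[OF that] unfolding in_spanL_def by (simp only: mult.assoc simp_thms)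
    then have "\<forall>b j. \<exists>c. j < r \<longrightarrow> (\<forall>i\<in>{..<r}. c i \<in> L) \<and> a b * v j = (\<Sum>i<r. v i * c i)"
      by blast
    then obtain c where "\<forall>b j. j < r \<longrightarrow> (\<forall>i\<in>{..<r}. c b j i \<in> L) \<and> a b * v j = (\<Sum>i<r. v i * c b j i)"
      unfolding choice_iff by blast
    then have c: "\<And>b j i. j < r \<Longrightarrow> i < r \<Longrightarrow> c b j i \<in> L"
      "\<And>b j. j < r \<Longrightarrow> a b * v j = (\<Sum>i<r. v i * c b j i)"
      by simp_all
    have "card ({..<r} \<times> {..<r}) < card {..d^2}"
    proof -
      have "r * r \<le> d^2" using r mult_le_mono[of r d r d] by (simp add: power2_eq_square)
      then show ?thesis by (simp add: card_cartesian_product)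
    qed
    then have "\<exists>x. (\<forall>b\<in>{..d^2}. x b \<in> L) \<and> (\<exists>b\<in>{..d^2}. x b \<noteq> 0) \<and>
        (\<forall>k\<in>{..<r} \<times> {..<r}. (\<Sum>b\<le>d^2. c b (fst k) (snd k) * x b) = 0)"
      by (intro linear_system) (use c(1) in auto)
    then obtain x where x: "\<forall>b\<in>{..d^2}. x b \<in> L" "\<exists>b\<in>{..d^2}. x b \<noteq> 0"
      "\<forall>k\<in>{..<r} \<times> {..<r}. (\<Sum>b\<le>d^2. c b (fst k) (snd k) * x b) = 0" by blast
    have vj: "(\<Sum>b\<le>d^2. a b * v j * x b) = 0" if "j < r" for j
    proof -
      have "(\<Sum>b\<le>d^2. a b * v j * x b) = (\<Sum>i<r. v i * (\<Sum>b\<le>d^2. c b j i * x b))"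
        using that by (simp add: c(2) sum_distrib_left sum_distrib_right mult.assoc) (rule sum.swap)
      also have "\<dots> = 0" using x(3) that by (intro sum.neutral) auto
      finally show ?thesis .
    qed
    have "(\<Sum>b\<le>d^2. a b * y * x b) = 0" for y
    proof -
      have "y * e * e = y * e" using ee by (simp add: mult.assoc)
      from span[OF this] obtain m where m: "\<And>j. j \<in> {..<r} \<Longrightarrow> m j \<in> L" "y * e = (\<Sum>j<r. v j * m j)"
        by (rule in_spanLE) blast
      have "(\<Sum>b\<le>d^2. a b * y * x b) = (\<Sum>b\<le>d^2. a b * (y * e) * x b)"
        using x(1) L_corner(1) by (intro sum.cong) (simp_all add: mult.assoc)
      also have "\<dots> = (\<Sum>b\<le>d^2. \<Sum>j<r. a b * v j * x b * m j)"
        unfolding m(2) sum_distrib_left sum_distrib_right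
      proof (intro sum.cong refl)
        fix b j assume "b \<in> {..d^2}" "j \<in> {..<r}"
        then have "m j * x b = x b * m j" using x(1) m(1) L_comm by blast
        then show "a b * (v j * m j) * x b = a b * v j * x b * m j" by (simp add: mult.assoc)
      qed
      also have "\<dots> = (\<Sum>j<r. (\<Sum>b\<le>d^2. a b * v j * x b) * m j)"
        unfolding sum_distrib_right by (rule sum.swap)
      also have "\<dots> = 0" using vj by (intro sum.neutral) auto
      finally show ?thesis .
    qed
    then have tf: "(\<Sum>b\<le>d^2. sc (w (a b)) (x b)) = 0" if "functional sc w" for w
      using tensor_functional[of "{..d^2}" a x w] that by simp
    obtain b where b: "b \<le> d^2" "x b \<noteq> 0" using x(2) by auto
    obtain w where w: "functional sc w" "\<And>i. i \<in> {..d^2} \<Longrightarrow> w (a i) = (if i = b then 1 else 0)"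
      using dual_functional[OF _ a, of b] b(1) by auto
    have "(\<Sum>i\<le>d^2. sc (w (a i)) (x i)) = (\<Sum>i\<le>d^2. if i = b then x i else 0)"
      by (rule sum.cong) (auto simp: w(2))
    then show False using tf[OF w(1)] b by simp
  qed
  then obtain v :: "nat \<Rightarrow> 'b" where "\<forall>i<Suc d. v i * e = v i" "indepL {..<Suc d} v"
    using indepL_or_spanning[of "Suc d"] by blast
  then show ?thesis using that[of v] by (simp add: lessThan_Suc_atMost less_Suc_eq_le)
qed

end

subsection \<open>Power series with independent powers\<close>

definition scalar_series :: "('f::field \<Rightarrow> 'b::ring_1 \<Rightarrow> 'b) \<Rightarrow> 'b fps \<Rightarrow> bool" where
  "scalar_series sc f \<longleftrightarrow> (\<forall>n. \<exists>c. fps_nth f n = sc c 1)"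

definition powers_indep :: "('f::field \<Rightarrow> 'b::ring_1 \<Rightarrow> 'b) \<Rightarrow> nat \<Rightarrow> 'b fps \<Rightarrow> bool" where
  "powers_indep sc d T \<longleftrightarrow> (\<forall>f. (\<forall>u. scalar_series sc (f u)) \<longrightarrow> (\<Sum>u\<le>d. f u * T ^ u) = 0 \<longrightarrow> (\<forall>u\<le>d. f u = 0))"

lemma fps_mult_commute_coeffs:
  assumes "\<And>i j. fps_nth f i * fps_nth g j = fps_nth g j * fps_nth f i"
  shows "f * g = g * (f :: 'b::ring_1 fps)"
proof (rule fps_ext)
  fix n
  have "fps_nth (f * g) n = (\<Sum>i=0..n. fps_nth g (n - i) * fps_nth f i)"
    by (simp add: fps_mult_nth assms)
  also have "\<dots> = (\<Sum>i=0..n. fps_nth g i * fps_nth f (n - i))"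
    by (rule sum.reindex_bij_witness[of _ "\<lambda>a. n - a" "\<lambda>a. n - a"]) auto
  finally show "fps_nth (f * g) n = fps_nth (g * f) n" by (simp add: fps_mult_nth)
qed

lemma fps_X_power_central: "fps_X ^ M * f = f * (fps_X ^ M :: 'b::ring_1 fps)"
  by (rule fps_mult_commute_coeffs) (simp add: fps_X_power_nth)

text \<open>For M > j the coefficient at j of the sum is that of w 0. So w 0 = 0, one factor X^M can
  be cancelled, and induction applies. A polynomial with series coefficients is thus determined by
  its values at the powers X^M.\<close>

lemma fps_polynomial_zero:
  fixes w :: "nat \<Rightarrow> 'b::ring_1 fps"
  assumes "\<And>M. M \<ge> 1 \<Longrightarrow> (\<Sum>n<m. w n * fps_X ^ (M * n)) = 0" "n < m"
  shows "w n = 0"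
  using assms
proof (induction m arbitrary: w n)
  case 0
  then show ?case by simp
next
  case (Suc m)
  have split: "(\<Sum>n<Suc m. w n * fps_X ^ (M * n)) = w 0 + (\<Sum>n<m. w (Suc n) * fps_X ^ (M * n)) * fps_X ^ M" for M
    by (simp add: sum.lessThan_Suc_shift sum_distrib_right mult.assoc power_add del: sum.lessThan_Suc flip: power_add)
      (simp add: add.commute)
  have w0: "w 0 = 0"
  proof (rule fps_ext)
    fix j
    have "fps_nth (w 0 + (\<Sum>n<m. w (Suc n) * fps_X ^ (Suc j * n)) * fps_X ^ Suc j) j = 0"
      using Suc.prems(1)[of "Suc j"] split[of "Suc j"] by simp
    then show "fps_nth (w 0) j = fps_nth 0 j" by (simp add: fps_X_power_mult_right_nth del: power_Suc)
  qed
  have "(\<Sum>n<m. w (Suc n) * fps_X ^ (M * n)) = 0" if "M \<ge> 1" for M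
  proof -
    have z: "(\<Sum>n<m. w (Suc n) * fps_X ^ (M * n)) * fps_X ^ M = 0"
      using Suc.prems(1)[OF that] split[of M] w0 by simp
    show ?thesis
    proof (rule fps_ext)
      fix j
      show "fps_nth (\<Sum>n<m. w (Suc n) * fps_X ^ (M * n)) j = fps_nth 0 j"
        using arg_cong[OF z, of "\<lambda>f. fps_nth f (j + M)"] by (simp add: fps_X_power_mult_right_nth)
    qed
  qed
  then have "w (Suc n) = 0" if "n < m" for n using Suc.IH[of "\<lambda>n. w (Suc n)"] that by blast
  then show ?case using w0 Suc.prems(2) by (cases n) auto
qed

text \<open>A determinant-free certificate for the independence of x, Q x, ..., Q^d x: a linear relation among
  these vectors forces alternant Q Y d d x to vanish, for arbitrary linear maps Y k.\<close>
fun alternant :: "('r \<Rightarrow> 'r) \<Rightarrow> (nat \<Rightarrow> 'r \<Rightarrow> 'r) \<Rightarrow> nat \<Rightarrow> nat \<Rightarrow> 'r \<Rightarrow> 'r::ring_1" where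
  "alternant Q Y 0 i x = (Q ^^ i) x"
| "alternant Q Y (Suc k) i x =
    alternant Q Y k i (Y k (alternant Q Y k k x)) - alternant Q Y k k (Y k (alternant Q Y k i x))"

context falg
begin

lemma scalar_series_central:
  assumes "scalar_series sc f"
  shows "f * x = x * f"
proof (rule fps_mult_commute_coeffs)
  fix i j
  obtain c where "fps_nth f i = sc c 1" using assms unfolding scalar_series_def by blast
  then show "fps_nth f i * fps_nth x j = fps_nth x j * fps_nth f i" by (simp only: sc_one_commute)
qed

text \<open>The lowest nonzero coefficient of f is an invertible scalar, which determines the
  coefficients of x one after another.\<close>

lemma scalar_series_torsion_free:
  assumes f: "scalar_series sc f" "f \<noteq> 0" and fx: "f * x = 0"
  shows "x = 0"
proof -
  define m where "m = (LEAST m. fps_nth f m \<noteq> 0)"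
  have ex: "\<exists>m. fps_nth f m \<noteq> 0" using f(2) by (simp add: fps_eq_iff)
  have m: "fps_nth f m \<noteq> 0" unfolding m_def using ex by (rule LeastI_ex)
  have below: "fps_nth f i = 0" if "i < m" for i using not_less_Least that unfolding m_def by blast
  obtain c where c: "fps_nth f m = sc c 1" using f(1) unfolding scalar_series_def by blast
  have "fps_nth x j = 0" for j
  proof (induction j rule: less_induct)
    case (less j)
    have "0 = fps_nth (f * x) (m + j)" using fx by simp
    also have "\<dots> = (\<Sum>i=0..m + j. fps_nth f i * fps_nth x (m + j - i))" by (simp add: fps_mult_nth)
    also have "\<dots> = (\<Sum>i\<in>{m}. fps_nth f i * fps_nth x (m + j - i))"
    proof (rule sum.mono_neutral_right)
      show "\<forall>i\<in>{0..m + j} - {m}. fps_nth f i * fps_nth x (m + j - i) = 0"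
      proof
        fix i assume "i \<in> {0..m + j} - {m}"
        then have "i < m \<or> m + j - i < j" by auto
        then show "fps_nth f i * fps_nth x (m + j - i) = 0" using below less by auto
      qed
    qed auto
    also have "\<dots> = sc c (fps_nth x j)" unfolding c using sc_one_mult by (simp add: c)
    finally show ?case using m c by auto
  qed
  then show ?thesis by (simp add: fps_eq_iff)
qed

end

section \<open>Linear maps and polynomial functions over the series with coefficients in L\<close>

context cc_corner
begin

definition Lser :: "'b fps \<Rightarrow> bool" where "Lser z \<longleftrightarrow> (\<forall>n. fps_nth z n \<in> L)"

definition zlin :: "('b fps \<Rightarrow> 'b fps) \<Rightarrow> bool" where
  "zlin G \<longleftrightarrow> (\<forall>x y. G (x + y) = G x + G y) \<and> (\<forall>x z. Lser z \<longrightarrow> G (x * z) = G x * z)"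

lemma zlinD:
  assumes "zlin G"
  shows "G (x + y) = G x + G y" "Lser z \<Longrightarrow> G (x * z) = G x * z" "G 0 = 0" "G (- x) = - G x"
    "G (sum h A) = (\<Sum>a\<in>A. G (h a))" "G (x - y) = G x - G y"
proof -
  interpret additive G by standard (use assms in \<open>auto simp: zlin_def\<close>)
  show "G (x + y) = G x + G y" "Lser z \<Longrightarrow> G (x * z) = G x * z" "G 0 = 0" "G (- x) = - G x"
    "G (sum h A) = (\<Sum>a\<in>A. G (h a))" "G (x - y) = G x - G y"
    using assms unfolding zlin_def by (auto simp: zero minus sum diff)
qed

lemma Lser_comm: "Lser z \<Longrightarrow> Lser z' \<Longrightarrow> z * z' = z' * z"
  unfolding Lser_def by (intro fps_mult_commute_coeffs L_comm) auto

lemma Lser_mult: "Lser z \<Longrightarrow> Lser z' \<Longrightarrow> Lser (z * z')"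
  unfolding Lser_def fps_mult_nth by (auto intro!: L_sum L_closed)

lemma Lser_const: "l \<in> L \<Longrightarrow> Lser (fps_const l)"
  unfolding Lser_def by (auto simp: L_closed)

lemma Lser_e: "Lser z \<Longrightarrow> z * fps_const e = z" "Lser z \<Longrightarrow> fps_const e * z = z"
  unfolding Lser_def by (auto simp: fps_eq_iff L_corner)

lemma Lser_X: "Lser (fps_X ^ M * fps_const e)"
  unfolding Lser_def by (auto simp: fps_X_power_nth L_closed)

lemma Lser_power: "Lser z \<Longrightarrow> Lser (z ^ Suc n)"
  by (induction n) (auto intro: Lser_mult)

lemma zlin_power: "zlin G \<Longrightarrow> Lser z \<Longrightarrow> G (x * z ^ n) = G x * z ^ n"
  using Lser_power zlinD(2) by (cases n) auto

lemma zlin_funpow: "zlin G \<Longrightarrow> zlin (G ^^ i)"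
  by (induction i) (auto simp: zlin_def)

lemma zlin_alternant:
  assumes "zlin Q" "\<And>k. zlin (Y k)"
  shows "zlin (alternant Q Y k i)"
proof (induction k arbitrary: i)
  case 0
  have "alternant Q Y 0 i = Q ^^ i" by (rule ext) simp
  then show ?case using zlin_funpow[OF assms(1)] by simp
next
  case (Suc k)
  then show ?case
    unfolding zlin_def using zlinD(1,2)[OF Suc] zlinD(1,2)[OF assms(2)]
    by (simp add: left_diff_distrib)
qed

text \<open>At level k the map \<open>Y k\<close> sends v_k back to v_0 and annihilates v_i for i >
  k, so the subtracted term vanishes and the value v_i is passed on.\<close>

lemma alternant_dual:
  assumes Q: "zlin Q" "\<And>k. zlin (Y k)" and shift: "\<And>i. i < d \<Longrightarrow> Q (v i) = v (Suc i)"
    and dual: "\<And>k i. k \<le> d \<Longrightarrow> i \<le> d \<Longrightarrow> Y k (v i) = (if i = k then v 0 else 0)"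
    and "k \<le> i" "i \<le> d"
  shows "alternant Q Y k i (v 0) = v i"
  using \<open>k \<le> i\<close> \<open>i \<le> d\<close>
proof (induction k arbitrary: i)
  case 0
  then show ?case by (induction i) (auto simp: shift)
next
  case (Suc k)
  then show ?case using zlinD(3)[OF zlin_alternant[OF Q]] by (simp add: dual)
qed

text \<open>Elimination without division: passing from level k to k + 1 cancels the term i = k, so
  at level k the relation only has terms with i \<ge> k. If q is the largest index with f q nonzero,
  level q says that \<open>alternant Q Y q q x * f q\<close> is 0. Hence this alternant vanishes
  identically on the elements fixed by e, and all later ones are built from it.\<close>

lemma alternant_dependent:
  fixes Q :: "'b fps \<Rightarrow> 'b fps"
  assumes Q: "zlin Q" "\<And>k. zlin (Y k)" and QV: "\<And>x. x * fps_const e = x \<Longrightarrow> Q x * fps_const e = Q x"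
    and YV: "\<And>k x. Y k x * fps_const e = Y k x"
    and f: "\<And>i. Lser (f i)" and tf: "\<And>i x. f i \<noteq> 0 \<Longrightarrow> x * fps_const e = x \<Longrightarrow> x * f i = 0 \<Longrightarrow> x = 0"
    and dep: "\<And>x. x * fps_const e = x \<Longrightarrow> (\<Sum>i\<le>d. (Q ^^ i) x * f i) = 0"
    and nz: "p \<le> d" "f p \<noteq> 0" and x: "x * fps_const e = x"
  shows "alternant Q Y d d x = 0"
proof -
  let ?A = "alternant Q Y"
  note zA = zlin_alternant[OF Q]
  have AV: "?A k i x * fps_const e = ?A k i x" if "x * fps_const e = x" for k i x
    using that
  proof (induction k arbitrary: i x)
    case 0
    then show ?case by (induction i) (auto simp: QV)
  next
    case (Suc k)
    then show ?case by (simp add: left_diff_distrib YV)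
  qed
  have rel: "(\<Sum>i=k..d. ?A k i x * f i) = 0" if "x * fps_const e = x" "k \<le> d" for k x
    using that
  proof (induction k arbitrary: x)
    case 0
    then show ?case using dep by (simp add: atLeast0AtMost)
  next
    case (Suc k)
    define u where "u = ?A k k x"
    have tail: "(\<Sum>i=Suc k..d. ?A k i y * f i) = - (?A k k y * f k)" if "y * fps_const e = y" for y
      using Suc.IH[OF that] Suc.prems(2) by (simp add: sum.atLeast_Suc_atMost eq_neg_iff_add_eq_0 add.commute)
    have "(\<Sum>i=Suc k..d. ?A (Suc k) i x * f i) =
        (\<Sum>i=Suc k..d. ?A k i (Y k u) * f i) - (\<Sum>i=Suc k..d. ?A k k (Y k (?A k i x)) * f i)"
      unfolding u_def by (simp add: left_diff_distrib sum_subtractf)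
    also have "(\<Sum>i=Suc k..d. ?A k k (Y k (?A k i x)) * f i) = ?A k k (Y k (\<Sum>i=Suc k..d. ?A k i x * f i))"
      by (simp add: zlinD(5)[OF zA] zlinD(5)[OF Q(2)] zlinD(2)[OF zA] zlinD(2)[OF Q(2)] f)
    also have "\<dots> = - (?A k k (Y k u) * f k)"
      unfolding tail[OF Suc.prems(1)] u_def
      by (simp add: zlinD(4)[OF zA] zlinD(4)[OF Q(2)] zlinD(2)[OF zA] zlinD(2)[OF Q(2)] f)
    also have "(\<Sum>i=Suc k..d. ?A k i (Y k u) * f i) = - (?A k k (Y k u) * f k)"
      by (rule tail[OF YV])
    finally show ?case by simp
  qed
  define q where "q = Max {i. i \<le> d \<and> f i \<noteq> 0}"
  have fin: "finite {i. i \<le> d \<and> f i \<noteq> 0}" and ne: "{i. i \<le> d \<and> f i \<noteq> 0} \<noteq> {}" using nz by auto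
  have q: "q \<le> d" "f q \<noteq> 0" using Max_in[OF fin ne] unfolding q_def by auto
  have above: "f i = 0" if "q < i" "i \<le> d" for i
  proof (rule ccontr)
    assume "f i \<noteq> 0"
    then have "i \<le> q" unfolding q_def by (intro Max_ge[OF fin]) (use that in simp)
    then show False using that(1) by simp
  qed
  have qq: "?A q q y = 0" if y: "y * fps_const e = y" for y
  proof -
    have "(\<Sum>i=q..d. ?A q i y * f i) = ?A q q y * f q"
      using q(1) above by (subst sum.atLeast_Suc_atMost) (auto intro!: sum.neutral)
    then show ?thesis using rel[OF y q(1)] tf[OF q(2) AV[OF y]] by simp
  qed
  have later: "?A (q + Suc n) i y = 0" if y: "y * fps_const e = y" for n i y
    using y
  proof (induction n arbitrary: i y)
    case 0
    then show ?case using qq YV zlinD(3)[OF zA] zlinD(3)[OF Q(2)] by simp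
  next
    case (Suc n)
    then show ?case using YV by simp
  qed
  show ?thesis
  proof (cases "d = q")
    case True
    then show ?thesis using qq[OF x] by simp
  next
    case False
    then obtain n where "d = q + Suc n" using q(1) less_imp_Suc_add[of q d] by auto
    then show ?thesis using later[OF x] by simp
  qed
qed

text \<open>The formula is only required on \<open>Lser\<close>, where \<open>zlin\<close> maps can
  be pulled through the powers of z.\<close>

definition polyfun :: "('b fps \<Rightarrow> 'b fps) \<Rightarrow> bool" where
  "polyfun g \<longleftrightarrow> (\<exists>m w. \<forall>z. Lser z \<longrightarrow> g z = (\<Sum>n<m. w n * z ^ n))"

lemma polyfun_const: "polyfun (\<lambda>z. x)"
  unfolding polyfun_def by (rule exI[of _ 1], rule exI[of _ "\<lambda>_. x"]) simp

lemma polyfun_zlin: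
  assumes "zlin G" "polyfun g"
  shows "polyfun (\<lambda>z. G (g z))"
proof -
  obtain m w where "\<And>z. Lser z \<Longrightarrow> g z = (\<Sum>n<m. w n * z ^ n)" using assms(2) unfolding polyfun_def by blast
  then have "G (g z) = (\<Sum>n<m. G (w n) * z ^ n)" if "Lser z" for z
    using that by (simp add: zlinD(5)[OF assms(1)] zlin_power[OF assms(1)])
  then show ?thesis unfolding polyfun_def by (intro exI[of _ m] exI[of _ "\<lambda>n. G (w n)"]) simp
qed

lemma polyfun_add:
  assumes "polyfun g" "polyfun h"
  shows "polyfun (\<lambda>z. g z + h z)"
proof -
  obtain m w where w: "\<And>z. Lser z \<Longrightarrow> g z = (\<Sum>n<m. w n * z ^ n)" using assms(1) unfolding polyfun_def by blast
  obtain k u where u: "\<And>z. Lser z \<Longrightarrow> h z = (\<Sum>n<k. u n * z ^ n)" using assms(2) unfolding polyfun_def by blast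
  define w' u' where "w' n = (if n < m then w n else 0)" and "u' n = (if n < k then u n else 0)" for n
  have "g z + h z = (\<Sum>n<m + k. (w' n + u' n) * z ^ n)" if "Lser z" for z
  proof -
    have "(\<Sum>n<m + k. w' n * z ^ n) = (\<Sum>n<m. w n * z ^ n)"
      by (rule sum.mono_neutral_cong_right) (auto simp: w'_def)
    moreover have "(\<Sum>n<m + k. u' n * z ^ n) = (\<Sum>n<k. u n * z ^ n)"
      by (rule sum.mono_neutral_cong_right) (auto simp: u'_def)
    ultimately show ?thesis using w[OF that] u[OF that] by (simp add: distrib_right sum.distrib)
  qed
  then show ?thesis unfolding polyfun_def by (intro exI[of _ "m + k"] exI[of _ "\<lambda>n. w' n + u' n"]) simp
qed

lemma polyfun_diff: "polyfun g \<Longrightarrow> polyfun h \<Longrightarrow> polyfun (\<lambda>z. g z - h z)"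
  using polyfun_add[of g "\<lambda>z. - h z"] polyfun_zlin[of uminus h] by (simp add: zlin_def)

lemma polyfun_mult:
  assumes "polyfun g"
  shows "polyfun (\<lambda>z. g z * z)"
proof -
  obtain m w where w: "\<And>z. Lser z \<Longrightarrow> g z = (\<Sum>n<m. w n * z ^ n)" using assms(1) unfolding polyfun_def by blast
  have "g z * z = (\<Sum>n<Suc m. (case n of 0 \<Rightarrow> 0 | Suc n \<Rightarrow> w n) * z ^ n)" if "Lser z" for z
    unfolding w[OF that] sum.lessThan_Suc_shift
    by (simp add: sum_distrib_right mult.assoc power_commutes)
  then show ?thesis unfolding polyfun_def
    by (intro exI[of _ "Suc m"] exI[of _ "\<lambda>n. case n of 0 \<Rightarrow> 0 | Suc n \<Rightarrow> w n"]) simp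
qed

lemma polyfun_alternant:
  assumes A: "zlin A" and B: "zlin B" and Y: "\<And>k. zlin (Y k)"
    and g: "polyfun g"
  shows "polyfun (\<lambda>z. alternant (\<lambda>x. A x + B x * z) Y k i (g z))"
  using g
proof (induction k arbitrary: i g)
  case 0
  show ?case
  proof (induction i)
    case 0
    then show ?case using \<open>polyfun g\<close> by simp
  next
    case (Suc i)
    let ?h = "\<lambda>z. alternant (\<lambda>x. A x + B x * z) Y 0 i (g z)"
    have "polyfun (\<lambda>z. A (?h z) + B (?h z) * z)"
      by (intro polyfun_add polyfun_mult polyfun_zlin[OF A] polyfun_zlin[OF B] Suc)
    then show ?case by simp
  qed
next
  case (Suc k)
  show ?case
    unfolding alternant.simps
    by (intro polyfun_diff Suc.IH polyfun_zlin[OF Y] Suc.prems)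
qed

text \<open>If g vanished at all X^M e, its coefficients, cut down by e, would be zero by
  \<open>fps_polynomial_zero\<close>, and with them its value at l.\<close>

lemma polyfun_specialize:
  assumes "polyfun g" "l \<in> L" "g (fps_const l) \<noteq> 0"
  shows "\<exists>M\<ge>1. g (fps_X ^ M * fps_const e) \<noteq> 0"
proof (rule ccontr)
  assume "\<not> ?thesis"
  then have g0: "g (fps_X ^ M * fps_const e) = 0" if "M \<ge> 1" for M using that by blast
  obtain m w where w: "\<And>z. Lser z \<Longrightarrow> g z = (\<Sum>n<m. w n * z ^ n)" using assms(1) unfolding polyfun_def by blast
  \<comment> \<open>z^0 is 1 and not e, so the constant coefficient is not cut down.\<close>
  define w' where "w' n = (if n = 0 then w 0 else w n * fps_const e)" for n
  have pw: "(fps_X ^ M * fps_const e) ^ Suc n = fps_const e * fps_X ^ (M * Suc n)" for M n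
  proof (induction n)
    case 0
    then show ?case by (simp add: fps_X_power_central[of M "fps_const e"])
  next
    case (Suc n)
    have "(fps_X ^ M * fps_const e) ^ Suc (Suc n) = fps_X ^ M * fps_const e * (fps_const e * fps_X ^ (M * Suc n))"
      using Suc by (metis power_Suc)
    also have "\<dots> = fps_X ^ M * (fps_const e * fps_const e) * fps_X ^ (M * Suc n)" by (simp only: mult.assoc)
    also have "\<dots> = fps_const e * (fps_X ^ M * fps_X ^ (M * Suc n))"
    proof -
      have "fps_const e * fps_const e = fps_const e" by (simp add: ee)
      then show ?thesis by (simp only: fps_X_power_central[of M "fps_const e"] mult.assoc)
    qed
    finally show ?case by (simp flip: power_add)
  qed
  have "w' n = 0" if "n < m" for n
  proof (rule fps_polynomial_zero[OF _ that])
    fix M :: nat assume M: "M \<ge> 1"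
    have "(\<Sum>n<m. w' n * fps_X ^ (M * n)) = (\<Sum>n<m. w n * (fps_X ^ M * fps_const e) ^ n)"
    proof (rule sum.cong)
      fix n
      show "w' n * fps_X ^ (M * n) = w n * (fps_X ^ M * fps_const e) ^ n"
        by (cases n) (simp_all add: w'_def pw mult.assoc del: power_Suc mult_Suc_right)
    qed simp
    also have "\<dots> = 0" using g0[OF M] w[OF Lser_X] by simp
    finally show "(\<Sum>n<m. w' n * fps_X ^ (M * n)) = 0" .
  qed
  moreover have "w n * fps_const l ^ n = w' n * fps_const l ^ n" for n
    using Lser_e(2)[OF Lser_power[OF Lser_const[OF assms(2)]]]
    by (cases n) (simp_all add: w'_def mult.assoc del: power_Suc)
  ultimately have "g (fps_const l) = 0" unfolding w[OF Lser_const[OF assms(2)]] by simp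
  then show False using assms(3) by blast
qed

text \<open>Let t be a shift operator on the v_i and write t x - s x e as \<Sum> a_i x l_i. With the
  l_i in place the alternant at v_0 is v_d, hence nonzero. Replacing the l_i one by one by X^M e,
  with M from \<open>polyfun_specialize\<close>, keeps it nonzero. On Ae the operator is then left
  multiplication by T = s + \<Sum> a_i X^(M_i), so a relation between the powers of T would
  contradict \<open>alternant_dependent\<close>.\<close>

lemma ex_powers_indep:
  assumes v: "\<And>i. i \<le> d \<Longrightarrow> v i * e = v i" "indepL {..d} (v :: nat \<Rightarrow> 'b)"
  obtains T where "fps_nth T 0 = s" "powers_indep sc d T"
proof -
  have "\<exists>S. is_op S \<and> S (v j) = w \<and> (\<forall>i\<le>d. i \<noteq> j \<longrightarrow> S (v i) = 0)" if "j \<le> d" "w * e = w" for j w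
    using dual_op[of "{..d}" v j w] v that by auto
  then obtain D where D: "\<And>j w. j \<le> d \<Longrightarrow> w * e = w \<Longrightarrow> is_op (D j w) \<and> D j w (v j) = w \<and> (\<forall>i\<le>d. i \<noteq> j \<longrightarrow> D j w (v i) = 0)"
    by metis
  define t where "t x = (\<Sum>j<d. D j (v (Suc j)) x)" for x
  have t_op: "is_op t" unfolding t_def using D v by (intro is_op_sum) auto
  have t_v: "t (v i) = v (Suc i)" if "i < d" for i
  proof -
    have "t (v i) = (\<Sum>j<d. if j = i then v (Suc i) else 0)"
      unfolding t_def by (rule sum.cong) (use D v that in auto)
    then show ?thesis using that by simp
  qed
  have "is_op (\<lambda>x. t x - s * x * e)" by (rule is_op_diff[OF t_op is_op_elementary[OF L_closed(1)]])
  then obtain ps where ps: "\<forall>(a, l)\<in>set ps. l \<in> L" "\<And>x. t x - s * x * e = (\<Sum>(a, l)\<leftarrow>ps. a * x * l)"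
    unfolding is_op_def by blast
  define m a l where "m = length ps" and "a i = fst (ps ! i)" and "l i = snd (ps ! i)" for i
  have lL: "l i \<in> L" if "i < m" for i using ps(1) that nth_mem unfolding m_def l_def by fastforce
  have t_eq: "t x = s * x * e + (\<Sum>i<m. a i * x * l i)" for x
    using ps(2)[of x] unfolding m_def a_def l_def
    by (simp add: sum_list_sum_nth case_prod_unfold atLeast0LessThan algebra_simps)
  define Y where "Y k x = Abs_fps (\<lambda>n. D k (v 0) (fps_nth x n))" for k x
  \<comment> \<open>The alternants take an infinite sequence of maps; dual operators exist only for
    k \<le> d.\<close>
  define Y' where "Y' k = (if k \<le> d then Y k else (\<lambda>x. 0))" for k
  have Y: "zlin (Y' k)" for k
  proof (cases "k \<le> d")
    case True
    have op: "is_op (D k (v 0))" using D True v by blast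
    have "Y k (x + y) = Y k x + Y k y" for x y
      by (rule fps_ext) (simp add: Y_def is_op_linear(1)[OF op])
    moreover have "Y k (x * z) = Y k x * z" if "Lser z" for x z
      by (rule fps_ext)
        (use that in \<open>simp add: Y_def fps_mult_nth is_op_sum_arg[OF op] is_op_linear(2)[OF op] Lser_def\<close>)
    ultimately show ?thesis unfolding zlin_def Y'_def using True by simp
  qed (simp add: zlin_def Y'_def)
  have YV: "Y' k x * fps_const e = Y' k x" for k x
    using D v(1)[of 0] is_op_linear(3)[of "D k (v 0)"] unfolding Y'_def Y_def by (auto simp: fps_eq_iff)
  define Q where "Q \<kappa> x = fps_const s * x + (\<Sum>i<m. fps_const (a i) * x * \<kappa> i)" for \<kappa> x
  have zlin_Q: "zlin (Q \<kappa>)" if "\<And>i. i < m \<Longrightarrow> Lser (\<kappa> i)" for \<kappa>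
    unfolding zlin_def Q_def
  proof (intro conjI allI impI)
    fix x z assume z: "Lser z"
    have "(\<Sum>i<m. fps_const (a i) * (x * z) * \<kappa> i) = (\<Sum>i<m. fps_const (a i) * x * \<kappa> i) * z"
      unfolding sum_distrib_right
      by (rule sum.cong) (use Lser_comm[OF z that] in \<open>simp_all add: mult.assoc\<close>)
    then show "fps_const s * (x * z) + (\<Sum>i<m. fps_const (a i) * (x * z) * \<kappa> i) =
        (fps_const s * x + (\<Sum>i<m. fps_const (a i) * x * \<kappa> i)) * z" by (simp add: distrib_right mult.assoc)
  qed (simp add: distrib_left distrib_right sum.distrib algebra_simps)
  \<comment> \<open>Stage j of the replacement: indices below j already carry powers of X, the
    others still the elements of L.\<close>
  define K where "K M j i = (if i < j then fps_X ^ M i * fps_const e else fps_const (l i))" for M :: "nat \<Rightarrow> nat" and j i :: nat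
  have K_Lser: "Lser (K M j i)" if "i < m" for M j i unfolding K_def using Lser_X Lser_const lL that by auto
  let ?v = "\<lambda>i. fps_const (v i)"
  have "\<exists>M. (\<forall>i. M i \<ge> 1) \<and> alternant (Q (K M j)) Y' d d (?v 0) \<noteq> 0" if "j \<le> m" for j
    using that
  proof (induction j)
    case 0
    have "alternant (Q (K (\<lambda>_. 1) 0)) Y' d d (?v 0) = ?v d"
    proof (rule alternant_dual[where d = d])
      show "zlin (Q (K (\<lambda>_. 1) 0))" by (rule zlin_Q[OF K_Lser])
      show "Q (K (\<lambda>_. 1) 0) (?v i) = ?v (Suc i)" if "i < d" for i
      proof -
        have "Q (K (\<lambda>_. 1) 0) (?v i) = fps_const (s * v i + (\<Sum>j<m. a j * v i * l j))"
          unfolding Q_def K_def by (simp add: fps_eq_iff fps_sum_nth)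
        also have "s * v i = s * v i * e" using v(1)[of i] that by (simp add: mult.assoc)
        finally show ?thesis using t_eq[of "v i"] t_v[OF that] by simp
      qed
      show "Y' k (?v i) = (if i = k then ?v 0 else 0)" if "k \<le> d" "i \<le> d" for k i
      proof -
        have op: "is_op (D k (v 0))" using D that v by blast
        have "D k (v 0) 0 = 0" using is_op_linear(1)[OF op, of 0 0] by simp
        moreover have "D k (v 0) (v i) = (if i = k then v 0 else 0)" using D[OF that(1) v(1)[of 0]] that by auto
        ultimately show ?thesis
          unfolding Y'_def Y_def using that by (cases "i = k") (simp_all add: fps_eq_iff)
      qed
    qed (use Y in auto)
    moreover have "v d \<noteq> 0"
    proof
      assume 0: "v d = 0"
      have "(\<Sum>i\<le>d. v i * (if i = d then e else 0)) = (\<Sum>i\<le>d. 0)"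
        by (rule sum.cong) (auto simp: 0)
      then have "(if d = d then e else 0) = 0"
        by (intro indepLD[OF v(2), of "\<lambda>i. if i = d then e else 0"]) (auto simp: L_closed)
      then show False using e_nz by simp
    qed
    ultimately show ?case by (intro exI[of _ "\<lambda>_. 1"]) simp
  next
    case (Suc j)
    then obtain M where M: "\<forall>i. M i \<ge> 1" "alternant (Q (K M j)) Y' d d (?v 0) \<noteq> 0" by auto
    define A where "A x = fps_const s * x + (\<Sum>i\<in>{..<m} - {j}. fps_const (a i) * x * K M j i)" for x
    define B where "B x = fps_const (a j) * x" for x
    have j: "j < m" using Suc.prems by simp
    have QAB: "Q ((K M j)(j := z)) = (\<lambda>x. A x + B x * z)" for z
      using j unfolding Q_def A_def B_def by (intro ext) (simp add: sum.remove[of "{..<m}" j] algebra_simps)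
    have zA: "zlin A" unfolding zlin_def A_def
    proof (intro conjI allI impI)
      fix x z assume z: "Lser z"
      have "(\<Sum>i\<in>{..<m} - {j}. fps_const (a i) * (x * z) * K M j i) = (\<Sum>i\<in>{..<m} - {j}. fps_const (a i) * x * K M j i) * z"
        unfolding sum_distrib_right
        by (rule sum.cong) (use Lser_comm[OF z K_Lser] in \<open>simp_all add: mult.assoc\<close>)
      then show "fps_const s * (x * z) + (\<Sum>i\<in>{..<m} - {j}. fps_const (a i) * (x * z) * K M j i) =
          (fps_const s * x + (\<Sum>i\<in>{..<m} - {j}. fps_const (a i) * x * K M j i)) * z"
        by (simp add: distrib_right mult.assoc)
    qed (simp add: distrib_left distrib_right sum.distrib algebra_simps)
    have zB: "zlin B" unfolding zlin_def B_def by (simp add: distrib_left mult.assoc)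
    let ?g = "\<lambda>z. alternant (Q ((K M j)(j := z))) Y' d d (?v 0)"
    have pf: "polyfun ?g" unfolding QAB by (rule polyfun_alternant[OF zA zB Y polyfun_const])
    have "(K M j)(j := fps_const (l j)) = K M j" unfolding K_def by (intro ext) auto
    then have "?g (fps_const (l j)) \<noteq> 0" using M(2) by simp
    from polyfun_specialize[OF pf lL[OF j] this] obtain N where N: "N \<ge> 1" "?g (fps_X ^ N * fps_const e) \<noteq> 0" by blast
    have "(K M j)(j := fps_X ^ N * fps_const e) = K (M(j := N)) (Suc j)" unfolding K_def by (intro ext) auto
    then have "alternant (Q (K (M(j := N)) (Suc j))) Y' d d (?v 0) \<noteq> 0" using N(2) by simp
    moreover have "\<forall>i. (M(j := N)) i \<ge> 1" using M(1) N(1) by simp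
    ultimately show ?case by blast
  qed
  then obtain M where M: "\<And>i. M i \<ge> (1::nat)" "alternant (Q (K M m)) Y' d d (?v 0) \<noteq> 0" by blast
  define T where "T = fps_const s + (\<Sum>i<m. fps_const (a i) * fps_X ^ M i)"
  have QT: "Q (K M m) x = T * x" if "x * fps_const e = x" for x
  proof -
    have "fps_const (a i) * x * K M m i = fps_const (a i) * fps_X ^ M i * x" if "i < m" for i
    proof -
      have "x * (fps_X ^ M i * fps_const e) = fps_X ^ M i * (x * fps_const e)"
        by (metis fps_X_power_central mult.assoc)
      then show ?thesis using that \<open>x * fps_const e = x\<close> unfolding K_def by (simp add: mult.assoc)
    qed
    then show ?thesis unfolding Q_def T_def by (simp add: distrib_right sum_distrib_right)
  qed
  have QTi: "(Q (K M m) ^^ i) x = T ^ i * x" if x: "x * fps_const e = x" for x i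
  proof (induction i)
    case (Suc i)
    have "T ^ i * x * fps_const e = T ^ i * x" using x by (simp add: mult.assoc)
    then show ?case using Suc QT by (simp add: mult.assoc)
  qed simp
  show ?thesis
  proof (rule that)
    show "fps_nth T 0 = s"
    proof -
      have "fps_nth (fps_const (a i) * fps_X ^ M i) 0 = 0" for i
        using M(1)[of i] by (simp add: fps_X_power_nth)
      then show ?thesis unfolding T_def by (simp only: fps_add_nth fps_sum_nth) simp
    qed
    show "powers_indep sc d T"
      unfolding powers_indep_def
    proof (intro allI impI)
      fix f u assume f: "\<forall>u. scalar_series sc (f u)" "(\<Sum>u\<le>d. f u * T ^ u) = 0" and u: "u \<le> d"
      show "f u = 0"
      proof (rule ccontr)
        assume nz: "f u \<noteq> 0"
        \<comment> \<open>Multiplied by e, the scalar series become elements of \<open>Lser\<close>,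
          through which they act on the right of Ae.\<close>
        define g where "g i = f i * fps_const e" for i
        have xg: "x * g i = f i * x" if "x * fps_const e = x" for x i
          unfolding g_def using scalar_series_central[OF f(1)[rule_format], of i x] that
          by (metis mult.assoc scalar_series_central[OF f(1)[rule_format]])
        have gL: "Lser (g i)" for i
          unfolding Lser_def
        proof
          fix n
          obtain c where "fps_nth (f i) n = sc c 1" using f(1) unfolding scalar_series_def by blast
          then have "fps_nth (g i) n = sc c e" unfolding g_def by (simp add: sc_one_mult)
          moreover have "sc c e \<in> L"
            by (rule L_max) (simp_all add: sc_mult mult_sc ee L_corner)
          ultimately show "fps_nth (g i) n \<in> L" by simp
        qed
        have gnz: "f i \<noteq> 0" if "g i \<noteq> 0" for i using that unfolding g_def by auto
        have "g u \<noteq> 0"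
          unfolding g_def using scalar_series_torsion_free[OF f(1)[rule_format] nz, of "fps_const e"] e_nz by auto
        moreover have "x = 0" if "g i \<noteq> 0" "x * fps_const e = x" "x * g i = 0" for i x
          using scalar_series_torsion_free[OF f(1)[rule_format] gnz[OF that(1)]] that xg by simp
        moreover have "(\<Sum>i\<le>d. (Q (K M m) ^^ i) x * g i) = 0" if x: "x * fps_const e = x" for x
        proof -
          have "(Q (K M m) ^^ i) x * g i = f i * T ^ i * x" for i
          proof -
            have "T ^ i * x * fps_const e = T ^ i * x" using x by (simp add: mult.assoc)
            from xg[OF this] show ?thesis unfolding QTi[OF x] by (simp only: mult.assoc)
          qed
          then show ?thesis using f(2) by (simp flip: sum_distrib_right)
        qed
        moreover have "Q (K M m) x * fps_const e = Q (K M m) x" if "x * fps_const e = x" for x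
          using that QT[OF that] by (simp add: mult.assoc)
        moreover have "?v 0 * fps_const e = ?v 0" using v(1)[of 0] by simp
        ultimately have "alternant (Q (K M m)) Y' d d (?v 0) = 0"
          by (intro alternant_dependent[OF zlin_Q[OF K_Lser] Y _ YV gL, where p = u and d = d]) (use u in auto)
        then show False using M(2) by blast
      qed
    qed
  qed
qed

end

text \<open>Trading a variable for a power of T: the identity at x_l = \<xi> T minus T times on the
  right the identity at x_l = \<xi> cancels the terms of l and raises the bound p on the exponents
  by one, which m + p \<le> D pays for. With one variable left, \<open>base\<close> applies.\<close>

lemma right_free_levels:
  fixes T :: "'r::ring_1" and E :: "nat \<Rightarrow> nat \<Rightarrow> (nat \<Rightarrow> 'r) \<Rightarrow> 'r"
  assumes base: "\<And>E. (\<And>x. (\<Sum>u\<le>D. E u * x * T ^ u) = 0) \<Longrightarrow> \<forall>u\<le>D. E u = 0"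
    and "finite S" "card S = Suc m" "m + p \<le> D"
    "\<And>k u. k \<in> S \<Longrightarrow> local_on (S - {k}) (E k u)"
    "\<And>x. (\<Sum>k\<in>S. \<Sum>u\<le>p. E k u x * x k * T ^ u) = 0" "k \<in> S" "u \<le> p"
  shows "E k u x = 0"
  using assms(2-)
proof (induction m arbitrary: S p E k u x)
  case 0
  then have S: "S = {k}" using card_1_singletonE[of S] by auto
  have loc: "E k u (x(k := v)) = E k u x" for u v
    by (rule local_onD[OF "0.prems"(4)[OF "0.prems"(6)]]) simp
  define E0 where "E0 u = (if u \<le> p then E k u x else 0)" for u
  have "(\<Sum>u\<le>D. E0 u * v * T ^ u) = 0" for v
  proof -
    have "(\<Sum>u\<le>D. E0 u * v * T ^ u) = (\<Sum>u\<le>p. E k u x * v * T ^ u)"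
      using "0.prems"(3) by (intro sum.mono_neutral_cong_right) (auto simp: E0_def)
    moreover have "\<dots> = 0"
      using "0.prems"(5)[of "x(k := v)"] unfolding S by (simp add: loc del: fun_upd_apply add: fun_upd_same)
    ultimately show ?thesis by simp
  qed
  from base[OF this] have "E0 u = 0" using "0.prems"(3,7) by auto
  then show ?case using "0.prems"(7) unfolding E0_def by simp
next
  case (Suc m)
  have "S \<noteq> {k}" using Suc.prems(2) by auto
  then obtain l where l: "l \<in> S" "l \<noteq> k" using Suc.prems(6) by blast
  let ?S = "S - {l}"
  have k: "k \<in> ?S" using l Suc.prems(6) by blast
  define E' where "E' \<xi> j u y = (if u \<le> p then E j u (y(l := \<xi> * T)) else 0)
      - (case u of 0 \<Rightarrow> 0 | Suc u \<Rightarrow> E j u (y(l := \<xi>)))" for \<xi> j u y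
  have E': "E' \<xi> k u y = 0" if "u \<le> Suc p" for \<xi> u y
  proof (rule Suc.IH[of ?S "Suc p" "E' \<xi>" k u y])
    show "finite ?S" "card ?S = Suc m" "m + Suc p \<le> D" using Suc.prems l by auto
    show "local_on (?S - {j}) (E' \<xi> j u)" if j: "j \<in> ?S" for j u
      unfolding local_on_def
    proof (intro allI impI)
      fix y i v assume i: "i \<notin> ?S - {j}"
      have loc: "local_on (S - {j}) (E j u)" for u using Suc.prems(4) j by blast
      have "E j u ((y(i := v))(l := c)) = E j u (y(l := c))" for u c
      proof (cases "i = l")
        case False
        then have "i \<notin> S - {j}" using i by blast
        then show ?thesis using local_onD[OF loc] fun_upd_twist[OF False] by metis
      qed simp
      then show "E' \<xi> j u (y(i := v)) = E' \<xi> j u y" unfolding E'_def by (simp split: nat.split)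
    qed
    show "(\<Sum>k\<in>?S. \<Sum>u\<le>Suc p. E' \<xi> k u y * y k * T ^ u) = 0" for y
    proof -
      have El: "E l u (y(l := c)) = E l u y" for u c
        by (rule local_onD[OF Suc.prems(4)[OF l(1)]]) simp
      have sumS: "(\<Sum>k\<in>?S. \<Sum>u\<le>p. E k u (y(l := c)) * y k * T ^ u) = - (\<Sum>u\<le>p. E l u y * c * T ^ u)" for c
      proof -
        have "(\<Sum>k\<in>?S. \<Sum>u\<le>p. E k u (y(l := c)) * (y(l := c)) k * T ^ u) = (\<Sum>k\<in>?S. \<Sum>u\<le>p. E k u (y(l := c)) * y k * T ^ u)"
          by (intro sum.cong refl) auto
        then show ?thesis
          using Suc.prems(5)[of "y(l := c)"] unfolding sum.remove[OF Suc.prems(1) l(1)] El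
          by (simp add: eq_neg_iff_add_eq_0 add.commute)
      qed
      have "(\<Sum>u\<le>Suc p. E' \<xi> k u y * y k * T ^ u) =
          (\<Sum>u\<le>p. E k u (y(l := \<xi> * T)) * y k * T ^ u) - (\<Sum>u\<le>p. E k u (y(l := \<xi>)) * y k * T ^ u) * T" for k
      proof -
        have "(\<Sum>u\<le>Suc p. (if u \<le> p then E k u (y(l := \<xi> * T)) else 0) * y k * T ^ u) = (\<Sum>u\<le>p. E k u (y(l := \<xi> * T)) * y k * T ^ u)"
          by (rule sum.mono_neutral_cong_right) auto
        moreover have "(\<Sum>u\<le>Suc p. (case u of 0 \<Rightarrow> 0 | Suc u \<Rightarrow> E k u (y(l := \<xi>))) * y k * T ^ u)
            = (\<Sum>u\<le>p. E k u (y(l := \<xi>)) * y k * T ^ u) * T"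
          unfolding sum.atMost_Suc_shift by (simp add: sum_distrib_right mult.assoc power_commutes)
        ultimately show ?thesis unfolding E'_def left_diff_distrib sum_subtractf by simp
      qed
      then have "(\<Sum>k\<in>?S. \<Sum>u\<le>Suc p. E' \<xi> k u y * y k * T ^ u) =
          (\<Sum>k\<in>?S. \<Sum>u\<le>p. E k u (y(l := \<xi> * T)) * y k * T ^ u) - (\<Sum>k\<in>?S. \<Sum>u\<le>p. E k u (y(l := \<xi>)) * y k * T ^ u) * T"
        by (simp add: sum_subtractf sum_distrib_right)
      also have "\<dots> = 0"
        unfolding sumS by (simp add: sum_distrib_right mult.assoc power_commutes)
      finally show ?thesis .
    qed
  qed (use k that in auto)
  \<comment> \<open>The new coefficient at exponent q + 1 is the old one at q + 1 minus the old one
    at q, so the old ones vanish from the top downwards. The choice \<xi> = y l makes the latter its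
    value at y.\<close>
  have "E k (p - n) y = 0" if "n \<le> p" for n y
    using that
  proof (induction n arbitrary: y)
    case 0
    show ?case using E'[of "Suc p" "y l" y] by (simp add: E'_def)
  next
    case (Suc n)
    define q where "q = p - Suc n"
    have q: "p - n = Suc q" "Suc q \<le> Suc p" using Suc.prems unfolding q_def by auto
    have "E k (Suc q) z = 0" for z using Suc.IH[of z] Suc.prems q(1) by simp
    then show ?case using E'[OF q(2), of "y l" y] unfolding E'_def q_def[symmetric] by (cases "Suc q \<le> p") simp_all
  qed
  from this[of "p - u" x] show ?case using Suc.prems(7) by simp
qed

text \<open>The mirror image, with x_l = T \<xi> and multiplication by T on the left.\<close>

lemma left_free_levels:
  fixes T :: "'r::ring_1" and F :: "nat \<Rightarrow> nat \<Rightarrow> (nat \<Rightarrow> 'r) \<Rightarrow> 'r"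
  assumes base: "\<And>F. (\<And>x. (\<Sum>u\<le>D. T ^ u * x * F u) = 0) \<Longrightarrow> \<forall>u\<le>D. F u = 0"
    and "finite S" "card S = Suc m" "m + p \<le> D"
    "\<And>k u. k \<in> S \<Longrightarrow> local_on (S - {k}) (F k u)"
    "\<And>x. (\<Sum>k\<in>S. \<Sum>u\<le>p. T ^ u * x k * F k u x) = 0" "k \<in> S" "u \<le> p"
  shows "F k u x = 0"
  using assms(2-)
proof (induction m arbitrary: S p F k u x)
  case 0
  then have S: "S = {k}" using card_1_singletonE[of S] by auto
  have loc: "F k u (x(k := v)) = F k u x" for u v
    by (rule local_onD[OF "0.prems"(4)[OF "0.prems"(6)]]) simp
  define F0 where "F0 u = (if u \<le> p then F k u x else 0)" for u
  have "(\<Sum>u\<le>D. T ^ u * v * F0 u) = 0" for v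
  proof -
    have "(\<Sum>u\<le>D. T ^ u * v * F0 u) = (\<Sum>u\<le>p. T ^ u * v * F k u x)"
      using "0.prems"(3) by (intro sum.mono_neutral_cong_right) (auto simp: F0_def)
    moreover have "\<dots> = 0"
      using "0.prems"(5)[of "x(k := v)"] unfolding S by (simp add: loc del: fun_upd_apply add: fun_upd_same)
    ultimately show ?thesis by simp
  qed
  from base[OF this] have "F0 u = 0" using "0.prems"(3,7) by auto
  then show ?case using "0.prems"(7) unfolding F0_def by simp
next
  case (Suc m)
  have "S \<noteq> {k}" using Suc.prems(2) by auto
  then obtain l where l: "l \<in> S" "l \<noteq> k" using Suc.prems(6) by blast
  let ?S = "S - {l}"
  have k: "k \<in> ?S" using l Suc.prems(6) by blast
  define F' where "F' \<xi> j u y = (if u \<le> p then F j u (y(l := T * \<xi>)) else 0)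
      - (case u of 0 \<Rightarrow> 0 | Suc u \<Rightarrow> F j u (y(l := \<xi>)))" for \<xi> j u y
  have F': "F' \<xi> k u y = 0" if "u \<le> Suc p" for \<xi> u y
  proof (rule Suc.IH[of ?S "Suc p" "F' \<xi>" k u y])
    show "finite ?S" "card ?S = Suc m" "m + Suc p \<le> D" using Suc.prems l by auto
    show "local_on (?S - {j}) (F' \<xi> j u)" if j: "j \<in> ?S" for j u
      unfolding local_on_def
    proof (intro allI impI)
      fix y i v assume i: "i \<notin> ?S - {j}"
      have loc: "local_on (S - {j}) (F j u)" for u using Suc.prems(4) j by blast
      have "F j u ((y(i := v))(l := c)) = F j u (y(l := c))" for u c
      proof (cases "i = l")
        case False
        then have "i \<notin> S - {j}" using i by blast
        then show ?thesis using local_onD[OF loc] fun_upd_twist[OF False] by metis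
      qed simp
      then show "F' \<xi> j u (y(i := v)) = F' \<xi> j u y" unfolding F'_def by (simp split: nat.split)
    qed
    show "(\<Sum>k\<in>?S. \<Sum>u\<le>Suc p. T ^ u * y k * F' \<xi> k u y) = 0" for y
    proof -
      have Fl: "F l u (y(l := c)) = F l u y" for u c
        by (rule local_onD[OF Suc.prems(4)[OF l(1)]]) simp
      have sumS: "(\<Sum>k\<in>?S. \<Sum>u\<le>p. T ^ u * y k * F k u (y(l := c))) = - (\<Sum>u\<le>p. T ^ u * c * F l u y)" for c
      proof -
        have "(\<Sum>k\<in>?S. \<Sum>u\<le>p. T ^ u * (y(l := c)) k * F k u (y(l := c))) = (\<Sum>k\<in>?S. \<Sum>u\<le>p. T ^ u * y k * F k u (y(l := c)))"
          by (intro sum.cong refl) auto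
        then show ?thesis
          using Suc.prems(5)[of "y(l := c)"] unfolding sum.remove[OF Suc.prems(1) l(1)] Fl
          by (simp add: eq_neg_iff_add_eq_0 add.commute)
      qed
      have "(\<Sum>u\<le>Suc p. T ^ u * y k * F' \<xi> k u y) =
          (\<Sum>u\<le>p. T ^ u * y k * F k u (y(l := T * \<xi>))) - T * (\<Sum>u\<le>p. T ^ u * y k * F k u (y(l := \<xi>)))" for k
      proof -
        have "(\<Sum>u\<le>Suc p. T ^ u * y k * (if u \<le> p then F k u (y(l := T * \<xi>)) else 0)) = (\<Sum>u\<le>p. T ^ u * y k * F k u (y(l := T * \<xi>)))"
          by (rule sum.mono_neutral_cong_right) auto
        moreover have "(\<Sum>u\<le>Suc p. T ^ u * y k * (case u of 0 \<Rightarrow> 0 | Suc u \<Rightarrow> F k u (y(l := \<xi>))))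
            = T * (\<Sum>u\<le>p. T ^ u * y k * F k u (y(l := \<xi>)))"
          unfolding sum.atMost_Suc_shift by (simp add: sum_distrib_left mult.assoc)
        ultimately show ?thesis unfolding F'_def right_diff_distrib sum_subtractf by simp
      qed
      then have "(\<Sum>k\<in>?S. \<Sum>u\<le>Suc p. T ^ u * y k * F' \<xi> k u y) =
          (\<Sum>k\<in>?S. \<Sum>u\<le>p. T ^ u * y k * F k u (y(l := T * \<xi>))) - T * (\<Sum>k\<in>?S. \<Sum>u\<le>p. T ^ u * y k * F k u (y(l := \<xi>)))"
        by (simp add: sum_subtractf sum_distrib_left)
      also have "\<dots> = 0"
        unfolding sumS by (simp add: sum_distrib_left power_commutes flip: mult.assoc)
      finally show ?thesis .
    qed
  qed (use k that in auto)
  have "F k (p - n) y = 0" if "n \<le> p" for n y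
    using that
  proof (induction n arbitrary: y)
    case 0
    show ?case using F'[of "Suc p" "y l" y] by (simp add: F'_def)
  next
    case (Suc n)
    define q where "q = p - Suc n"
    have q: "p - n = Suc q" "Suc q \<le> Suc p" using Suc.prems unfolding q_def by auto
    have "F k (Suc q) z = 0" for z using Suc.IH[of z] Suc.prems q(1) by simp
    then show ?case using F'[OF q(2), of "y l" y] unfolding F'_def q_def[symmetric] by (cases "Suc q \<le> p") simp_all
  qed
  from this[of "p - u" x] show ?case using Suc.prems(7) by simp
qed

context cc_prime
begin

text \<open>At constant x the coefficients of the identity are tensor relations in A. A functional w
  applied to all coefficients of the \<open>E u\<close> turns them into a relation between powers of
  T over scalar series; w is chosen not to vanish at a nonzero coefficient.\<close>

lemma powers_indep_right:
  assumes T: "powers_indep sc d T" and E: "\<And>x. (\<Sum>u\<le>d. E u * x * T ^ u) = 0" and u: "u \<le> d"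
  shows "E u = 0"
proof (rule fps_ext, rule ccontr)
  fix i assume "fps_nth (E u) i \<noteq> fps_nth 0 i"
  then obtain w where w: "functional sc w" "w (fps_nth (E u) i) \<noteq> 0"
    using separating_functional[of "fps_nth (E u) i"] by auto
  define z where "z u = Abs_fps (\<lambda>i. sc (w (fps_nth (E u) i)) 1)" for u
  have "(\<Sum>u\<le>d. z u * T ^ u) = 0"
  proof (rule fps_ext)
    fix N :: nat
    let ?I = "{..d} \<times> {0..N}"
    have "(\<Sum>p\<in>?I. fps_nth (E (fst p)) (snd p) * a * fps_nth (T ^ fst p) (N - snd p)) = 0" for a
    proof -
      have "fps_nth (\<Sum>u\<le>d. E u * fps_const a * T ^ u) N = 0" using E[of "fps_const a"] by simp
      moreover have "fps_nth (E u * fps_const a * T ^ u) N = (\<Sum>i=0..N. fps_nth (E u) i * a * fps_nth (T ^ u) (N - i))" for u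
        by (subst fps_mult_nth) simp
      ultimately show ?thesis by (simp add: fps_sum_nth sum.cartesian_product')
    qed
    then have "(\<Sum>p\<in>?I. sc (w (fps_nth (E (fst p)) (snd p))) (fps_nth (T ^ fst p) (N - snd p))) = 0"
      by (intro tensor_functional) (use w(1) in auto)
    then show "fps_nth (\<Sum>u\<le>d. z u * T ^ u) N = fps_nth 0 N"
      by (simp add: fps_sum_nth fps_mult_nth z_def sum.cartesian_product' sc_one_mult)
  qed
  moreover have "scalar_series sc (z u)" for u unfolding scalar_series_def z_def by auto
  ultimately have "z u = 0" using T u unfolding powers_indep_def by blast
  then have "sc (w (fps_nth (E u) i)) 1 = 0" unfolding z_def by (metis fps_nth_Abs_fps fps_zero_nth)
  then show False using w(2) by simp
qed

lemma powers_indep_left: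
  assumes T: "powers_indep sc d T" and F: "\<And>x. (\<Sum>u\<le>d. T ^ u * x * F u) = 0" and u: "u \<le> d"
  shows "F u = 0"
proof (rule fps_ext, rule ccontr)
  fix i assume "fps_nth (F u) i \<noteq> fps_nth 0 i"
  then obtain w where w: "functional sc w" "w (fps_nth (F u) i) \<noteq> 0"
    using separating_functional[of "fps_nth (F u) i"] by auto
  define z where "z u = Abs_fps (\<lambda>i. sc (w (fps_nth (F u) i)) 1)" for u
  have sc: "scalar_series sc (z u)" for u unfolding scalar_series_def z_def by auto
  have "(\<Sum>u\<le>d. T ^ u * z u) = 0"
  proof (rule fps_ext)
    fix N :: nat
    let ?I = "{..d} \<times> {0..N}"
    have "(\<Sum>p\<in>?I. fps_nth (T ^ fst p) (snd p) * a * fps_nth (F (fst p)) (N - snd p)) = 0" for a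
    proof -
      have "fps_nth (\<Sum>u\<le>d. T ^ u * (fps_const a * F u)) N = 0" using F[of "fps_const a"] by (simp add: mult.assoc)
      moreover have "fps_nth (T ^ u * (fps_const a * F u)) N = (\<Sum>i=0..N. fps_nth (T ^ u) i * a * fps_nth (F u) (N - i))" for u
        by (subst fps_mult_nth) (simp add: mult.assoc)
      ultimately show ?thesis by (simp add: fps_sum_nth sum.cartesian_product')
    qed
    then have "(\<Sum>p\<in>?I. sc (w (fps_nth (F (fst p)) (N - snd p))) (fps_nth (T ^ fst p) (snd p))) = 0"
      by (intro tensor_functional_left) (use w(1) in auto)
    then show "fps_nth (\<Sum>u\<le>d. T ^ u * z u) N = fps_nth 0 N"
      by (simp add: fps_sum_nth fps_mult_nth z_def sum.cartesian_product' sc_one_commute sc_one_mult)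
  qed
  then have "(\<Sum>u\<le>d. z u * T ^ u) = 0" by (simp only: scalar_series_central[OF sc])
  then have "z u = 0" using T u sc unfolding powers_indep_def by blast
  then have "sc (w (fps_nth (F u) i)) 1 = 0" unfolding z_def by (metis fps_nth_Abs_fps fps_zero_nth)
  then show False using w(2) by simp
qed

text \<open>Plain freeness starts the trading at p = 0, freeness at T at p = 1. As card S = m + 1
  and m + p \<le> d, the extra power costs one variable.\<close>

lemma powers_indep_unique:
  fixes T :: "'b fps"
  assumes T: "powers_indep sc d T"
  shows "right_free (Suc d) TYPE('b fps)" "left_free (Suc d) TYPE('b fps)" "right_free_at d T"
proof -
  have R: "\<forall>u\<le>d. E u = 0" if "\<And>x. (\<Sum>u\<le>d. E u * x * T ^ u) = 0" for E
    using powers_indep_right[OF T that] by blast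
  have L: "\<forall>u\<le>d. F u = 0" if "\<And>x. (\<Sum>u\<le>d. T ^ u * x * F u) = 0" for F
    using powers_indep_left[OF T that] by blast
  show "right_free (Suc d) TYPE('b fps)"
    unfolding right_free_def
  proof (intro allI impI ballI)
    fix S :: "nat set" and E :: "nat \<Rightarrow> (nat \<Rightarrow> 'b fps) \<Rightarrow> 'b fps" and k x
    assume S: "finite S" "card S \<le> Suc d" "\<forall>k\<in>S. local_on (S - {k}) (E k)"
      "\<forall>x. (\<Sum>k\<in>S. E k x * x k) = 0" "k \<in> S"
    then have "card S > 0" by (metis card_gt_0_iff empty_iff)
    then obtain m where m: "card S = Suc m" using gr0_conv_Suc by blast
    show "E k x = 0"
      by (rule right_free_levels[OF R S(1) m, where p = 0 and E = "\<lambda>k u. E k" and u = 0]) (use S m in auto)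
  qed
  show "left_free (Suc d) TYPE('b fps)"
    unfolding left_free_def
  proof (intro allI impI ballI)
    fix S :: "nat set" and F :: "nat \<Rightarrow> (nat \<Rightarrow> 'b fps) \<Rightarrow> 'b fps" and k x
    assume S: "finite S" "card S \<le> Suc d" "\<forall>k\<in>S. local_on (S - {k}) (F k)"
      "\<forall>x. (\<Sum>k\<in>S. x k * F k x) = 0" "k \<in> S"
    then have "card S > 0" by (metis card_gt_0_iff empty_iff)
    then obtain m where m: "card S = Suc m" using gr0_conv_Suc by blast
    show "F k x = 0"
      by (rule left_free_levels[OF L S(1) m, where p = 0 and F = "\<lambda>k u. F k" and u = 0]) (use S m in auto)
  qed
  show "right_free_at d T"
    unfolding right_free_at_def
  proof (intro allI impI ballI)
    fix S :: "nat set" and E E' :: "nat \<Rightarrow> (nat \<Rightarrow> 'b fps) \<Rightarrow> 'b fps" and k x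
    assume S: "finite S" "card S \<le> d" "\<forall>k\<in>S. local_on (S - {k}) (E k) \<and> local_on (S - {k}) (E' k)"
      "\<forall>x. (\<Sum>k\<in>S. E k x * x k + E' k x * x k * T) = 0" "k \<in> S"
    then have "card S > 0" by (metis card_gt_0_iff empty_iff)
    then obtain m where m: "card S = Suc m" using gr0_conv_Suc by blast
    let ?E = "\<lambda>k u. if u = (0::nat) then E k else E' k"
    have "?E k u x = 0" if "u \<le> Suc 0" for u
      by (rule right_free_levels[OF R S(1) m, where p = "Suc 0" and E = ?E]) (use S m that in auto)
    from this[of 0] this[of "Suc 0"] show "E k x = 0 \<and> E' k x = 0" by simp
  qed
qed

end

subsection \<open>Commutation of an element with the image of its square\<close>

lemma fps_nth_lift_0:
  assumes "finite S"
  shows "fps_nth (lift S G x) 0 = G (\<lambda>k. fps_nth (x k) 0)"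
proof -
  have "comps S 0 = {\<lambda>_. 0}"
    using assms unfolding comps_def by (fastforce simp: fun_eq_iff)
  then show ?thesis by (simp add: lift_def)
qed

lemma fps_nth_power_0: "fps_nth (f ^ n) 0 = (fps_nth f 0 :: 'b::ring_1) ^ n"
  by (induction n) simp_all

lemma fps_nth_kill_lift_0:
  assumes "finite S"
  shows "fps_nth (kill T S (lift S G) x) 0 = kill (fps_nth T 0) S G (\<lambda>k. fps_nth (x k) 0)"
proof -
  have "(\<lambda>k. fps_nth (lsub T U x k) 0) = lsub (fps_nth T 0) U (\<lambda>k. fps_nth (x k) 0)" for U
    by (auto simp: lsub_def)
  then show ?thesis
    by (simp add: kill_def fps_sum_nth fps_nth_power_0 fps_nth_lift_0[OF assms])
qed

lemma sum_Pow_pair: "(\<Sum>U\<in>Pow {0, Suc 0}. h U) = h {} + h {0} + h {Suc 0} + (h {0, Suc 0} :: 'c::comm_monoid_add)"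
proof -
  have "Pow {0, Suc 0} = {{}, {0}, {Suc 0}, {0, Suc 0}}" by (auto simp: Pow_insert)
  moreover have "{0} \<noteq> {Suc 0}" "{0} \<noteq> {0, Suc 0}" "{Suc 0} \<noteq> {0, Suc 0}" by auto
  ultimately show ?thesis by (simp add: add.assoc)
qed

lemma polarize_pair:
  "polarize {0, Suc 0} p x = p (x 0 + x (Suc 0)) - p (x 0) - p (x (Suc 0)) + p 0"
  by (simp add: polarize_def sum_Pow_pair insert_Diff_if algebra_simps)

lemma kill_pair:
  "kill T {0, Suc 0} G (\<lambda>_. 1) = G (lsub T {0, Suc 0} (\<lambda>_. 1)) - T * G (lsub T {0} (\<lambda>_. 1))
    - T * G (lsub T {Suc 0} (\<lambda>_. 1)) + T * T * G (\<lambda>_. 1)"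
proof -
  have "lsub T {} x = x" for x by (simp add: lsub_def fun_eq_iff)
  then show ?thesis by (simp add: kill_def sum_Pow_pair insert_Diff_if algebra_simps power2_eq_square)
qed

context cc_prime
begin

text \<open>Under \<open>no_socle\<close>, A itself is free and the peeling takes T = s, scalar s
  being trivial. Otherwise it runs over power series with fps_nth T 0 = s, and constant coefficients
  are compared at the end.\<close>

lemma kill_polarize_commutes:
  assumes a: "fam_indep sc {..d^2} (a :: nat \<Rightarrow> 'b)" and nr: "n + r \<le> Suc d"
    and nz: "\<exists>i\<le>n. c i \<noteq> 0"
    and b: "\<And>S x. finite S \<Longrightarrow> card S > r \<Longrightarrow> polarize S b x = (0::'b)"
    and id: "\<And>X. (\<Sum>i\<le>n. sc (c i) (X ^ i * b X * X ^ (n - i))) = 0"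
    and S: "finite S" "card S = r"
  shows "kill s S (polarize S b) x * s = s * kill s S (polarize S b) x"
proof -
  define C where "C i = sc (c i) (1::'b)" for i
  have Cc: "C i * z = z * C i" for i z unfolding C_def by (simp add: sc_one_commute)
  have C0: "C i = 0 \<or> (\<forall>z. C i * z = 0 \<longrightarrow> z = 0)" for i
    unfolding C_def by (auto simp: sc_one_mult)
  have Cnz: "\<exists>i\<le>n. C i \<noteq> 0" using nz unfolding C_def by auto
  have id': "(\<Sum>i\<le>n. C i * words (\<lambda>S. polarize S b) i (n - i) S x) = 0"
    if "finite S" "card S = n + r" for S x
    by (rule polarized_identity[OF b _ that]) (use id in \<open>auto simp: C_def sc_one_mult\<close>)
  show ?thesis
  proof (cases "no_socle")
    case True
    show ?thesis
    proof (cases "\<exists>k. s = sc k 1")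
      case True
      then show ?thesis by (metis sc_one_commute)
    next
      case False
      then have ru: "right_free_at (Suc d - 1) s"
        using no_socle_right_free_at[OF \<open>no_socle\<close>] by blast
      show ?thesis
        by (rule peel[OF local_on_polarize no_socle_right_free[OF \<open>no_socle\<close>]
              no_socle_left_free[OF \<open>no_socle\<close>] ru nr Cc C0 Cnz id' S])
    qed
  next
    case False
    then obtain e :: 'b where e: "division_idempotent e" by (rule ex_division_idempotent)
    obtain L where L: "maximal_commuting e L" using ex_maximal_commuting by blast
    interpret cc_corner sc e L by (intro cc_corner.intro cc_prime_axioms cc_corner_axioms.intro e L)
    obtain v where v: "\<And>i. i \<le> d \<Longrightarrow> v i * e = v i" "indepL {..d} (v :: nat \<Rightarrow> 'b)"
      by (rule ex_indepL[OF a]) (rule that, blast+)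
    obtain T where T: "fps_nth T 0 = s" "powers_indep sc d T" by (rule ex_powers_indep[OF v])
    note uniq = powers_indep_unique[OF T(2)]
    have Fc: "fps_const (C i) * z = z * fps_const (C i)" for i z
      by (rule fps_mult_commute_coeffs) (simp add: Cc fps_const_def)
    have F0: "fps_const (C i) = 0 \<or> (\<forall>z. fps_const (C i) * z = 0 \<longrightarrow> z = 0)" for i
      using C0[of i] by (auto simp: fps_eq_iff)
    have Fnz: "\<exists>i\<le>n. fps_const (C i) \<noteq> 0" using Cnz by simp
    have ru: "right_free_at (Suc d - 1) T" using uniq(3) by simp
    have idF: "(\<Sum>i\<le>n. fps_const (C i) * words (\<lambda>S. lift S (polarize S b)) i (n - i) S x) = 0"
      if "finite S" "card S = n + r" for S x
      by (rule lift_identity[OF local_on_polarize that(1) id'[OF that]])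
    let ?x = "\<lambda>k. fps_const (x k)"
    have "kill T S (lift S (polarize S b)) ?x * T = T * kill T S (lift S (polarize S b)) ?x"
      by (rule peel[OF local_on_lift[OF local_on_polarize] uniq(1,2) ru nr Fc F0 Fnz idF S])
    then have "fps_nth (kill T S (lift S (polarize S b)) ?x * T) 0
        = fps_nth (T * kill T S (lift S (polarize S b)) ?x) 0" by simp
    then show ?thesis by (simp add: fps_nth_kill_lift_0[OF S(1)] T(1))
  qed
qed

theorem preserver_commutes_square:
  assumes char: "(2::'f) \<noteq> 0" and d2: "d \<ge> 2"
    and sum0: "(\<Sum>\<sigma>\<in>{\<sigma>. \<sigma> permutes {0..<d}}. lam \<sigma>) = 0"
    and fxy: "\<exists>w. subst_xy d lam w \<noteq> 0"
    and a: "fam_indep sc {..d^2} (a :: nat \<Rightarrow> 'b)"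
    and lin: "Vector_Spaces.linear sc sc \<phi>" and bij: "bij \<phi>"
    and pres: "preserves_zeros sc d lam \<phi>"
  obtains c where "c \<noteq> 0" "\<phi> 1 = sc c 1" "\<And>x. \<phi> (x * x) * \<phi> x = \<phi> x * \<phi> (x * x)"
proof -
  interpret lin: Vector_Spaces.linear sc sc \<phi> by (rule lin)
  define \<psi> where "\<psi> = inv \<phi>"
  have \<phi>\<psi>: "\<phi> (\<psi> X) = X" and \<psi>\<phi>: "\<psi> (\<phi> x) = x" for X x
    using bij unfolding \<psi>_def by (simp_all add: bij_is_surj surj_f_inv_f bij_is_inj)
  have inj: "\<phi> x = \<phi> y \<Longrightarrow> x = y" for x y by (metis \<psi>\<phi>)
  have \<psi>add: "\<psi> (X + Y) = \<psi> X + \<psi> Y" for X Y by (rule inj) (simp add: \<phi>\<psi> lin.add)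
  define n where "n = d - 1"
  \<comment> \<open>n + 2 = d + 1 is exactly the number of variables granted by the independence of
    1, T, ..., T^d.\<close>
  have dn: "{..<d} = {..n}" "n + 0 \<le> Suc d" "n + 2 \<le> Suc d" using d2 unfolding n_def by auto
  have nz: "\<exists>i\<le>n. slot_coeff d lam i \<noteq> 0"
  proof -
    obtain w where "subst_xy d lam w \<noteq> 0" using fxy by blast
    then obtain i where "i < d" "slot_coeff d lam i \<noteq> 0" using slot_coeff_nonzero[of d lam w] d2 by auto
    then show ?thesis unfolding n_def by (intro exI[of _ i]) auto
  qed
  have id: "(\<Sum>i\<le>n. sc (slot_coeff d lam i) (X ^ i * \<phi> y * X ^ (n - i))) = 0"
    if "\<psi> X * y = y * \<psi> X" for X y
    using preserver_identity[OF _ sum0 pres that] d2 unfolding dn(1) n_def[symmetric] \<phi>\<psi> by simp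
  \<comment> \<open>For y = 1 the middle map is constant, of degree r = 0, so peeling ends at the
    empty set of variables.\<close>
  have "\<phi> 1 * s = s * \<phi> 1" for s
  proof -
    have "kill s {} (polarize {} (\<lambda>_. \<phi> 1)) (\<lambda>_. 1) * s = s * kill s {} (polarize {} (\<lambda>_. \<phi> 1)) (\<lambda>_. 1)"
      by (rule kill_polarize_commutes[OF a dn(2) nz]) (use id in \<open>auto intro!: polarize_const\<close>)
    then show ?thesis by (simp add: kill_def polarize_def)
  qed
  then obtain c where c: "\<phi> 1 = sc c 1" by (rule central_imp_scalar)
  have c0: "c \<noteq> 0"
  proof
    assume "c = 0"
    then have "\<phi> 1 = \<phi> 0" using c by (simp add: lin.zero)
    then show False using inj by fastforce
  qed
  define k where "k = 1 / c"
  have \<psi>1: "\<psi> 1 = sc k 1" by (rule inj) (simp add: \<phi>\<psi> lin.scale c k_def c0)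
  define q where "q X = \<phi> (\<psi> X * \<psi> X)" for X
  have qq: "q (X + Y) - q X - q Y + q 0 = \<phi> (\<psi> X * \<psi> Y + \<psi> Y * \<psi> X)" for X Y
  proof -
    have "\<psi> 0 = 0" by (rule inj) (simp add: \<phi>\<psi> lin.zero)
    then show ?thesis unfolding q_def \<psi>add by (simp add: lin.add lin.zero algebra_simps)
  qed
  have \<psi>1Y: "\<phi> (\<psi> 1 * \<psi> Y + \<psi> Y * \<psi> 1) = sc (2 * k) Y" "\<phi> (\<psi> Y * \<psi> 1 + \<psi> 1 * \<psi> Y) = sc (2 * k) Y" for Y
    unfolding \<psi>1 by (simp_all add: sc_one_mult mult_sc lin.add lin.scale \<phi>\<psi> scale_left_distrib[symmetric])
  have comm: "q s * s = s * q s" for s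
  proof -
    \<comment> \<open>With both variables equal to 1, K = B(s, s) - s B(s, 1) - s B(1, s) + s^2 B(1,
      1), where B(X, Y) is the right-hand side of \<open>qq\<close>. Since \<open>\<psi> 1\<close>
      is a scalar, all terms but the first are polynomials in s, and B(s, s) = 2 q(s).\<close>
    let ?K = "kill s {0, Suc 0} (polarize {0, Suc 0} q) (\<lambda>_. 1)"
    have "?K * s = s * ?K"
    proof (rule kill_polarize_commutes[OF a dn(3) nz])
      show "polarize S q x = 0" if "finite S" "card S > 2" for S x
        unfolding q_def by (rule polarize_biadditive_eq_0[OF that, of "\<lambda>X Y. \<phi> (\<psi> X * \<psi> Y)"])
          (simp_all add: \<psi>add lin.add algebra_simps)
      show "(\<Sum>i\<le>n. sc (slot_coeff d lam i) (X ^ i * q X * X ^ (n - i))) = 0" for X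
        unfolding q_def by (rule id) (simp add: mult.assoc)
    qed auto
    moreover have "?K = sc 2 (q s) - (s * sc (2 * k) s + s * sc (2 * k) s) + s * s * sc (2 * k) 1"
    proof -
      have "?K = \<phi> (\<psi> s * \<psi> s + \<psi> s * \<psi> s) - s * \<phi> (\<psi> s * \<psi> 1 + \<psi> 1 * \<psi> s)
          - s * \<phi> (\<psi> 1 * \<psi> s + \<psi> s * \<psi> 1) + s * s * \<phi> (\<psi> 1 * \<psi> 1 + \<psi> 1 * \<psi> 1)"
        unfolding kill_pair polarize_pair qq by (simp add: lsub_def)
      also have "\<phi> (\<psi> s * \<psi> s + \<psi> s * \<psi> s) = sc 2 (q s)"
        unfolding q_def using scale_left_distrib[of 1 1 "\<phi> (\<psi> s * \<psi> s)"] by (simp add: lin.add)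
      finally show ?thesis unfolding \<psi>1Y by simp
    qed
    ultimately have "sc 2 (q s * s) = sc 2 (s * q s)"
      by (simp add: algebra_simps mult_sc sc_mult)
    then show ?thesis using char by simp
  qed
  have "\<phi> (x * x) * \<phi> x = \<phi> x * \<phi> (x * x)" for x
    using comm[of "\<phi> x"] unfolding q_def \<psi>\<phi> .
  then show ?thesis using c0 c by (rule that[rotated 2])
qed

end

subsection \<open>Quadratic elements\<close>

context falg
begin

definition scalar :: "'b \<Rightarrow> bool" where
  "scalar x \<longleftrightarrow> (\<exists>c. x = sc c 1)"

lemma scalarE: "scalar x \<Longrightarrow> (\<And>c. x = sc c 1 \<Longrightarrow> thesis) \<Longrightarrow> thesis"
  unfolding scalar_def by blast

lemma scalar_sc_one: "scalar (sc c 1)"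
  unfolding scalar_def by blast

lemma scalar_closed:
  "scalar 0" "scalar 1" "scalar x \<Longrightarrow> scalar y \<Longrightarrow> scalar (x + y)" "scalar x \<Longrightarrow> scalar (- x)"
  "scalar x \<Longrightarrow> scalar y \<Longrightarrow> scalar (x - y)" "scalar x \<Longrightarrow> scalar (sc k x)" "scalar x \<Longrightarrow> scalar y \<Longrightarrow> scalar (x * y)"
proof -
  show "scalar 0" "scalar 1" unfolding scalar_def by (metis scale_zero_left, metis scale_one)
  show "scalar (x + y)" if "scalar x" "scalar y" for x y
    using that unfolding scalar_def by (metis scale_left_distrib)
  show "scalar (- x)" if "scalar x" for x
    using that unfolding scalar_def by (metis scale_minus_left)
  show "scalar (x - y)" if "scalar x" "scalar y" for x y
    using that unfolding scalar_def by (metis scale_left_diff_distrib)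
  show "scalar (sc k x)" if "scalar x" for x k
    using that unfolding scalar_def by (metis scale_scale)
  show "scalar (x * y)" if "scalar x" "scalar y" for x y
    using that unfolding scalar_def by (metis scale_scale sc_one_mult)
qed

lemma scalar_commute: "scalar x \<Longrightarrow> x * y = y * x"
  unfolding scalar_def by (metis sc_one_commute)

lemma scalar_sc_cancel: "scalar (sc k x) \<Longrightarrow> k \<noteq> 0 \<Longrightarrow> scalar x"
  using scalar_closed(6)[of "sc k x" "1 / k"] by simp

definition quadratic :: "'b \<Rightarrow> bool" where
  "quadratic x \<longleftrightarrow> (\<exists>\<alpha>. scalar (x * x - sc \<alpha> x))"

lemma scalar_quadratic: "scalar x \<Longrightarrow> quadratic x"
  unfolding quadratic_def by (intro exI[of _ 0]) (simp add: scalar_closed)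

text \<open>The trace-zero elements of a quadratic algebra.\<close>
definition pure :: "'b \<Rightarrow> bool" where
  "pure x \<longleftrightarrow> scalar (x * x) \<and> (scalar x \<longrightarrow> x = 0)"

end

context cc_prime
begin

text \<open>If all elements are quadratic, A is the sum of F and the pure elements, on which xy + yx
  is a scalar symmetric form. Primeness gives pure x and y with xy + yx = 0 and nonzero squares. A
  pure z orthogonal to x, y and xy anticommutes with x and y, so it commutes with xy; it also
  anticommutes with xy, hence z = 0. So 1, x, y, xy span A, as for a quaternion algebra, against
  five independent elements.\<close>

lemma ex_not_quadratic:
  assumes char: "(2::'f) \<noteq> 0" and a: "fam_indep sc {..4} (a :: nat \<Rightarrow> 'b)"
  obtains t where "\<not> quadratic t"
proof (rule ccontr)
  assume "\<not> thesis"
  then have quad: "quadratic x" for x using that by blast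
  have two: "sc 2 x = x + x" for x using scale_left_distrib[of 1 1 x] by simp
  have half: "x = 0" if "x + x = 0" for x :: 'b using two[of x] that char by simp
  have halfs: "scalar x" if "scalar (x + x)" for x
    using scalar_sc_cancel[of 2 x] two[of x] that char by simp
  note sc = scalar_closed scalar_sc_one
  have decomp: "\<exists>g z. scalar g \<and> pure z \<and> x = g + z" for x
  proof (cases "scalar x")
    case True
    then show ?thesis by (intro exI[of _ x] exI[of _ 0]) (simp add: pure_def sc)
  next
    case False
    obtain \<alpha> where \<alpha>: "scalar (x * x - sc \<alpha> x)" using quad unfolding quadratic_def by blast
    define h where "h = \<alpha> / 2"
    have "sc \<alpha> x = sc h x + sc h x"
      unfolding h_def scale_left_distrib[symmetric] using char by (simp add: field_simps)
    then have "(x - sc h 1) * (x - sc h 1) = (x * x - sc \<alpha> x) + sc (h * h) 1"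
      by (simp add: algebra_simps mult_sc sc_mult)
    then have "scalar ((x - sc h 1) * (x - sc h 1))" using \<alpha> by (simp add: sc)
    moreover have "\<not> scalar (x - sc h 1)" using False sc(3)[of "x - sc h 1" "sc h 1"] by (auto simp: sc)
    ultimately show ?thesis by (intro exI[of _ "sc h 1"] exI[of _ "x - sc h 1"]) (simp add: pure_def sc)
  qed
  have pureD: "scalar (x * x)" "scalar x \<Longrightarrow> x = 0" if "pure x" for x
    using that unfolding pure_def by auto
  have dep_anti: "scalar (x * y + y * x)" if x: "pure x" and y: "pure y" and s: "scalar (y - sc s x)" for x y s
  proof -
    from s obtain g where "y - sc s x = sc g 1" by (rule scalarE)
    then have g: "y = sc s x + sc g 1" by (simp add: algebra_simps)
    have "y * y = sc (s * s) (x * x) + sc (s * g) x + sc (s * g) x + sc (g * g) 1"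
      unfolding g by (simp add: algebra_simps mult_sc sc_mult)
    then have "sc (s * g) x + sc (s * g) x = y * y - sc (s * s) (x * x) - sc (g * g) 1" by simp
    moreover have "scalar (y * y - sc (s * s) (x * x) - sc (g * g) 1)" by (intro sc pureD(1) x y)
    ultimately have "scalar (sc (s * g) x + sc (s * g) x)" by simp
    then have "s * g = 0 \<or> x = 0" using halfs scalar_sc_cancel pureD(2)[OF x] by blast
    then consider "x = 0" | "s = 0" | "g = 0" by auto
    then show ?thesis
    proof cases
      case 1 then show ?thesis by (simp add: sc)
    next
      case 2
      then have "y = 0" using g pureD(2)[OF y] by (simp add: sc)
      then show ?thesis by (simp add: sc)
    next
      case 3
      then show ?thesis using pureD(1)[OF x] by (simp add: g mult_sc sc_mult sc)
    qed
  qed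
  have anti: "scalar (x * y + y * x)" if x: "pure x" and y: "pure y" for x y
  proof -
    \<comment> \<open>The quadratic relations of x + y and x - y give two linear relations modulo F.
      Unless both coefficients vanish, x and y are dependent modulo F, which is the case of
      \<open>dep_anti\<close>, or x is a scalar.\<close>
    obtain \<alpha> \<beta> where \<alpha>: "scalar ((x + y) * (x + y) - sc \<alpha> (x + y))"
      and \<beta>: "scalar ((x - y) * (x - y) - sc \<beta> (x - y))" using quad unfolding quadratic_def by meson
    note xy = pureD(1)[OF x] pureD(1)[OF y]
    have "scalar ((x * x + x * x + y * y + y * y) - (((x + y) * (x + y) - sc \<alpha> (x + y)) + ((x - y) * (x - y) - sc \<beta> (x - y))))"
      (is "scalar ?L") by (intro sc \<alpha> \<beta> xy)
    moreover have "?L = sc (\<alpha> + \<beta>) x + sc (\<alpha> - \<beta>) y"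
      by (simp add: algebra_simps scale_left_distrib)
    ultimately have plus: "scalar (sc (\<alpha> + \<beta>) x + sc (\<alpha> - \<beta>) y)" by simp
    have "scalar (((x + y) * (x + y) - sc \<alpha> (x + y)) - ((x - y) * (x - y) - sc \<beta> (x - y)))"
      (is "scalar ?L") by (intro sc \<alpha> \<beta> xy)
    moreover have "?L = ((x * y + y * x) + (x * y + y * x)) - sc (\<alpha> - \<beta>) x - sc (\<alpha> + \<beta>) y"
      by (simp add: algebra_simps scale_left_distrib)
    ultimately have minus: "scalar (((x * y + y * x) + (x * y + y * x)) - sc (\<alpha> - \<beta>) x - sc (\<alpha> + \<beta>) y)"
      by simp
    show ?thesis
    proof (cases "\<alpha> - \<beta> = 0")
      case False
      have "scalar (sc (1 / (\<alpha> - \<beta>)) (sc (\<alpha> + \<beta>) x + sc (\<alpha> - \<beta>) y))" by (intro sc plus)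
      then have "scalar (y - sc (- ((\<alpha> + \<beta>) / (\<alpha> - \<beta>))) x)"
        using False by (simp add: scale_right_distrib scale_minus_left add.commute)
      then show ?thesis by (rule dep_anti[OF x y])
    next
      case True
      show ?thesis
      proof (cases "\<alpha> + \<beta> = 0")
        case True
        then show ?thesis using minus \<open>\<alpha> - \<beta> = 0\<close> by (auto intro: halfs[of "x * y + y * x"])
      next
        case False
        then have "scalar x" using plus True scalar_sc_cancel[of "\<alpha> + \<beta>" x] by simp
        then show ?thesis using pureD(2)[OF x] by (simp add: sc)
      qed
    qed
  qed
  have padd: "pure (x + y)" if x: "pure x" and y: "pure y" for x y
    unfolding pure_def
  proof
    have "scalar (x * x + (x * y + y * x) + y * y)" by (intro sc anti x y pureD(1))
    then show "scalar ((x + y) * (x + y))" by (simp add: algebra_simps)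
    show "scalar (x + y) \<longrightarrow> x + y = 0"
    proof
      assume "scalar (x + y)"
      then obtain g where "x + y = sc g 1" by (rule scalarE)
      then have g: "y = sc g 1 - x" by (simp add: algebra_simps)
      have "y * y = x * x + sc (g * g) 1 - (sc g x + sc g x)"
        unfolding g by (simp add: algebra_simps mult_sc sc_mult)
      then have "sc g x + sc g x = x * x + sc (g * g) 1 - y * y" by simp
      moreover have "scalar (x * x + sc (g * g) 1 - y * y)" by (intro sc pureD(1) x y)
      ultimately have "scalar (sc g x)" using halfs[of "sc g x"] by simp
      then consider "g = 0" | "x = 0" using scalar_sc_cancel pureD(2)[OF x] by blast
      then show "x + y = 0"
      proof cases
        case 1 then show ?thesis using g by simp
      next
        case 2 then show ?thesis using g pureD(2)[OF y] by (simp add: sc)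
      qed
    qed
  qed
  have pscale: "pure (sc k x)" if "pure x" for k x
    using that scalar_sc_cancel[of k x] unfolding pure_def
    by (cases "k = 0") (auto simp: mult_sc sc_mult sc)
  have pdiff: "pure (x - y)" if "pure x" "pure y" for x y
    using padd[OF that(1) pscale[OF that(2), of "- 1"]] by (simp add: scale_minus_left)
  have no_span: "\<exists>u. u \<notin> span (set xs)" if "length xs \<le> 4" for xs
  proof (rule ccontr)
    assume "\<not> ?thesis"
    then have "a ` {..4} \<subseteq> span (set xs)" by blast
    from independent_span_bound[OF _ fam_indep_independent(2)[OF _ a] this]
    have "card (a ` {..4}) \<le> card (set xs)" by simp
    then show False using card_image[OF fam_indep_independent(1)[OF _ a]] card_length[of xs] that by simp
  qed
  have orth: "\<exists>k. (z - sc k x) * x + x * (z - sc k x) = 0" if x: "pure x" "x * x \<noteq> 0" and z: "pure z" for x z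
  proof -
    obtain b where b: "x * x = sc b 1" using pureD(1)[OF x(1)] by (rule scalarE)
    obtain m where m: "z * x + x * z = sc m 1" using anti[OF z x(1)] by (rule scalarE)
    have "b \<noteq> 0" using x(2) b by auto
    have "(z - sc k x) * x + x * (z - sc k x) = sc (m - k * b - k * b) 1" for k
    proof -
      have "(z - sc k x) * x + x * (z - sc k x) = (z * x + x * z) - sc k (x * x) - sc k (x * x)"
        by (simp add: algebra_simps mult_sc sc_mult)
      then show ?thesis unfolding m b by (simp only: scale_left_diff_distrib scale_scale)
    qed
    moreover have "m - m / (2 * b) * b - m / (2 * b) * b = 0"
      using \<open>b \<noteq> 0\<close> char by (simp add: field_simps)
    ultimately have "(z - sc (m / (2 * b)) x) * x + x * (z - sc (m / (2 * b)) x) = 0"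
      by (simp only: scale_zero_left)
    then show ?thesis by blast
  qed
  \<comment> \<open>If all pure squares vanished, pure elements would anticommute, so x r x = 0 for
    all r, which forces x = 0 in a prime algebra.\<close>
  have "\<exists>x. pure x \<and> x * x \<noteq> 0"
  proof (rule ccontr)
    assume no: "\<not> ?thesis"
    then have sq: "pure x \<Longrightarrow> x * x = 0" for x by blast
    obtain u where u: "u \<notin> span (set [1])" using no_span[of "[1]"] by auto
    obtain g x where x: "scalar g" "pure x" "u = g + x" using decomp[of u] by blast
    have "x * r * x = 0" for r
    proof -
      obtain h z where z: "scalar h" "pure z" "r = h + z" using decomp[of r] by blast
      have "x * z + z * x = 0" using sq[OF padd[OF x(2) z(2)]] sq[OF x(2)] sq[OF z(2)]
        by (simp add: algebra_simps)
      then have "x * z * x = - (z * (x * x))" by (simp add: eq_neg_iff_add_eq_0 mult.assoc[symmetric] distrib_right[symmetric])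
      then have "x * z * x = 0" using sq[OF x(2)] by simp
      moreover have "x * h * x = h * (x * x)" using scalar_commute[OF z(1)] by (simp add: mult.assoc)
      ultimately show ?thesis using sq[OF x(2)] z(3) by (simp add: algebra_simps)
    qed
    then have "x = 0" using primeD by blast
    then show False using u x(1,3) by (auto simp: span_singleton scalar_def)
  qed
  then obtain x where x: "pure x" "x * x \<noteq> 0" by blast
  have "\<exists>y. pure y \<and> y * x + x * y = 0 \<and> y * y \<noteq> 0"
  proof (rule ccontr)
    assume no: "\<not> ?thesis"
    then have sq: "y * y = 0" if "pure y" "y * x + x * y = 0" for y using that by blast
    obtain u where u: "u \<notin> span (set [1, x])" using no_span[of "[1, x]"] by auto
    obtain g v where v: "scalar g" "pure v" "u = g + v" using decomp[of u] by blast
    obtain k where k: "(v - sc k x) * x + x * (v - sc k x) = 0" using orth[OF x v(2)] by blast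
    define w where "w = v - sc k x"
    have w: "pure w" "w * x + x * w = 0" using k v(2) x(1) unfolding w_def by (auto intro: pdiff pscale)
    have "w * r * w = 0" for r
    proof -
      obtain h z where z: "scalar h" "pure z" "r = h + z" using decomp[of r] by blast
      obtain l where l: "(z - sc l x) * x + x * (z - sc l x) = 0" using orth[OF x z(2)] by blast
      define y where "y = z - sc l x"
      have y: "pure y" "y * x + x * y = 0" using l z(2) x(1) unfolding y_def by (auto intro: pdiff pscale)
      have "(w + y) * x + x * (w + y) = (w * x + x * w) + (y * x + x * y)" by (simp add: algebra_simps)
      then have "(w + y) * x + x * (w + y) = 0" using w(2) y(2) by simp
      from sq[OF padd[OF w(1) y(1)] this] have "w * y + y * w = 0" using sq[OF w] sq[OF y]
        by (simp add: algebra_simps)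
      then have "w * y * w = - (y * (w * w))" by (simp add: eq_neg_iff_add_eq_0 mult.assoc[symmetric] distrib_right[symmetric])
      then have 1: "w * y * w = 0" using sq[OF w] by simp
      have "w * x * w = - (x * (w * w))" using w(2) by (simp add: eq_neg_iff_add_eq_0 mult.assoc[symmetric] distrib_right[symmetric])
      then have 2: "w * x * w = 0" using sq[OF w] by simp
      have "w * h * w = h * (w * w)" using scalar_commute[OF z(1)] by (simp add: mult.assoc)
      then have 3: "w * h * w = 0" using sq[OF w] by simp
      have "r = h + y + sc l x" using z(3) y_def by simp
      then show ?thesis using 1 2 3 by (simp add: distrib_left distrib_right mult_sc sc_mult)
    qed
    then have "w = 0" using primeD by blast
    then have "u = g + sc k x" using v(3) w_def by simp
    moreover obtain \<gamma> where \<gamma>: "g = sc \<gamma> 1" using v(1) by (rule scalarE)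
    have "g + sc k x \<in> span (set [1, x])"
      unfolding \<gamma> by (rule span_add span_scale | (rule span_base, simp))+
    ultimately show False using u by simp
  qed
  then obtain y where y: "pure y" "y * x + x * y = 0" "y * y \<noteq> 0" by blast
  obtain b where b: "x * x = sc b 1" using pureD(1)[OF x(1)] by (rule scalarE)
  obtain c where c: "y * y = sc c 1" using pureD(1)[OF y(1)] by (rule scalarE)
  have bc: "b \<noteq> 0" "c \<noteq> 0" using b c x y by auto
  have yx: "y * x = - (x * y)" using y(2) by (simp add: eq_neg_iff_add_eq_0)
  have "x * y * (x * y) = x * (y * x) * y" by (simp add: mult.assoc)
  also have "\<dots> = - (x * x * (y * y))" unfolding yx by (simp add: mult.assoc)
  also have "\<dots> = sc (- (b * c)) 1" unfolding b c by (simp add: mult_sc sc_mult scale_minus_left)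
  finally have xyxy: "x * y * (x * y) = sc (- (b * c)) 1" .
  have "\<not> scalar (x * y)"
  proof
    assume "scalar (x * y)"
    from scalar_commute[OF this, of x] have "x * (y * x) = x * (x * y)" by (simp add: mult.assoc)
    then have "x * x * y = - (x * x * y)" unfolding yx by (simp add: mult.assoc)
    then have "x * x * y + x * x * y = 0" by (metis add.right_inverse)
    then have "x * x * y = 0" by (rule half)
    then have "y = 0" using bc unfolding b by (simp add: sc_one_mult)
    then show False using y(3) by simp
  qed
  then have p: "pure (x * y)" unfolding pure_def xyxy by (auto simp: sc)
  have pnz: "x * y * (x * y) \<noteq> 0" unfolding xyxy using bc by simp
  obtain u where u: "u \<notin> span (set [1, x, y, x * y])" using no_span[of "[1, x, y, x * y]"] by auto
  obtain g v where v: "scalar g" "pure v" "u = g + v" using decomp[of u] by blast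
  obtain k where k: "(v - sc k x) * x + x * (v - sc k x) = 0" using orth[OF x v(2)] by blast
  obtain l where l: "(v - sc l y) * y + y * (v - sc l y) = 0" using orth[OF y(1,3) v(2)] by blast
  obtain m where m: "(v - sc m (x * y)) * (x * y) + (x * y) * (v - sc m (x * y)) = 0"
    using orth[OF p pnz v(2)] by blast
  define z where "z = v - sc k x - sc l y - sc m (x * y)"
  have xxy: "x * y * x = - (x * (x * y))" "y * (x * y) = - (x * y * y)" using yx by (simp_all add: mult.assoc) (simp add: mult.assoc[symmetric])
  have "z * x + x * z = ((v - sc k x) * x + x * (v - sc k x)) - sc l (y * x + x * y) - sc m (x * y * x + x * (x * y))"
    unfolding z_def by (simp add: algebra_simps mult_sc sc_mult)
  then have zx: "z * x = - (x * z)" unfolding k y(2) xxy by (simp add: eq_neg_iff_add_eq_0)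
  have "z * y + y * z = ((v - sc l y) * y + y * (v - sc l y)) - sc k (y * x + x * y) - sc m (x * y * y + y * (x * y))"
    unfolding z_def by (simp add: algebra_simps mult_sc sc_mult)
  then have zy: "z * y = - (y * z)" unfolding l y(2) xxy by (simp add: eq_neg_iff_add_eq_0)
  have "z * (x * y) + x * y * z = ((v - sc m (x * y)) * (x * y) + (x * y) * (v - sc m (x * y)))
      - sc k (x * (x * y) + x * y * x) - sc l (y * (x * y) + x * y * y)"
    unfolding z_def by (simp add: algebra_simps mult_sc sc_mult)
  then have zxy: "z * (x * y) + x * y * z = 0" unfolding m xxy by simp
  have "z * (x * y) = x * y * z" using zx zy by (simp add: mult.assoc[symmetric]) (simp add: mult.assoc)
  then have "x * y * z = 0" using zxy half[of "x * y * z"] by simp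
  then have "x * y * (x * y) * z = 0" by (metis mult.assoc mult_zero_right \<open>z * (x * y) = x * y * z\<close>)
  then have "z = 0" using bc unfolding xyxy by (simp add: sc_one_mult)
  then have "u = g + sc k x + sc l y + sc m (x * y)" using v(3) by (simp add: z_def algebra_simps)
  moreover obtain \<gamma> where \<gamma>: "g = sc \<gamma> 1" using v(1) by (rule scalarE)
  have "g + sc k x + sc l y + sc m (x * y) \<in> span (set [1, x, y, x * y])"
    unfolding \<gamma> by (rule span_add span_scale | (rule span_base, simp))+
  ultimately show False using u by simp
qed

end

subsection \<open>Commuting bilinear maps and Jordan automorphisms\<close>

text \<open>For p outside P and q outside Q, the sum p + q lies in neither.\<close>

lemma covering_by_two_subgroups:
  fixes P Q :: "'a::ab_group_add \<Rightarrow> bool"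
  assumes cov: "\<And>x. P x \<or> Q x"
    and P: "\<And>x y. P x \<Longrightarrow> P y \<Longrightarrow> P (x - y)" and Q: "\<And>x y. Q x \<Longrightarrow> Q y \<Longrightarrow> Q (x - y)"
  shows "(\<forall>x. P x) \<or> (\<forall>x. Q x)"
proof (rule ccontr)
  assume "\<not> ?thesis"
  then obtain p q where pq: "\<not> P p" "\<not> Q q" by blast
  then have "Q p" "P q" using cov by blast+
  moreover have "p + q - q = p" "p + q - p = q" by simp_all
  ultimately show False using cov[of "p + q"] P[of "p + q" q] Q[of "p + q" p] pq by auto
qed

context falg
begin

lemma scale_two: "sc 2 x = x + x"
  using scale_left_distrib[of 1 1 x] by simp

lemma two_torsion_free:
  fixes x y :: 'b
  assumes "(2::'f) \<noteq> 0"
  shows "x + x = 0 \<longleftrightarrow> x = 0" "x + x = y + y \<longleftrightarrow> x = y"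
  using assms scale_eq_0_iff[of 2 x] scale_left_imp_eq[of 2 x y] by (auto simp: scale_two)

lemma not_quadraticD:
  assumes "\<not> quadratic t" "scalar (sc a (t * t) + sc b t)"
  shows "a = 0" "b = 0"
proof -
  show a: "a = 0"
  proof (rule ccontr)
    assume "a \<noteq> 0"
    then have "t * t - sc (- b / a) t = sc (1 / a) (sc a (t * t) + sc b t)"
      by (simp add: scale_right_distrib scale_minus_left)
    then show False using assms scalar_closed(6) unfolding quadratic_def by metis
  qed
  show "b = 0"
  proof (rule ccontr)
    assume "b \<noteq> 0"
    then have "scalar t" using assms(2) a scalar_sc_cancel by simp
    then show False using assms(1) scalar_quadratic by blast
  qed
qed

text \<open>Adding the quadratic relations of T + X and T - X and subtracting twice that of X
  expresses a multiple of X as a quadratic polynomial in T modulo F. The multiple is nonzero because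
  T is not quadratic, so X commutes with all that commutes with T.\<close>

lemma quadratic_line:
  assumes char: "(2::'f) \<noteq> 0" and T: "\<not> quadratic T"
    and X: "quadratic X" and p: "quadratic (T + X)" and m: "quadratic (T - X)" and Y: "T * Y = Y * T"
  shows "X * Y = Y * X"
proof -
  obtain \<alpha> \<beta> \<gamma> where abc: "scalar ((T + X) * (T + X) - sc \<alpha> (T + X))"
    "scalar ((T - X) * (T - X) - sc \<beta> (T - X))" "scalar (X * X - sc \<gamma> X)"
    using p m X unfolding quadratic_def by meson
  have "scalar (((T + X) * (T + X) - sc \<alpha> (T + X)) + ((T - X) * (T - X) - sc \<beta> (T - X))
      - ((X * X - sc \<gamma> X) + (X * X - sc \<gamma> X)))" (is "scalar ?L")
    by (intro scalar_closed abc)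
  moreover have "?L = sc 2 (T * T) + sc (- (\<alpha> + \<beta>)) T + sc (\<gamma> * 2 - \<alpha> + \<beta>) X"
  proof -
    have "sc (\<gamma> * 2) X = sc \<gamma> X + sc \<gamma> X" by (simp only: mult_2_right scale_left_distrib)
    then show ?thesis unfolding scale_two by (simp add: algebra_simps)
  qed
  ultimately have s: "scalar (sc 2 (T * T) + sc (- (\<alpha> + \<beta>)) T + sc (\<gamma> * 2 - \<alpha> + \<beta>) X)" (is "scalar (?P + sc ?k X)")
    by simp
  have k: "?k \<noteq> 0"
  proof
    assume "?k = 0"
    then have "scalar ?P" using s by simp
    then show False using not_quadraticD(1)[OF T] char by blast
  qed
  have PY: "?P * Y = Y * ?P"
  proof -
    have "T * T * Y = Y * (T * T)" using Y by (metis mult.assoc)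
    then show ?thesis using Y by (simp add: distrib_left distrib_right mult_sc sc_mult)
  qed
  have "(?P + sc ?k X) * Y = Y * (?P + sc ?k X)" by (rule scalar_commute[OF s])
  then have "sc ?k X * Y = Y * sc ?k X" unfolding distrib_right[of ?P] distrib_left[of Y ?P] PY by simp
  then have "sc ?k (X * Y) = sc ?k (Y * X)" by (simp only: mult_sc sc_mult)
  then show ?thesis using k by simp
qed

end

context cc_prime
begin

text \<open>The tensor a \<otimes> b + b \<otimes> a is zero. A functional w with w(a) nonzero gives
  w(a) b + w(b) a = 0; a second application gives 2 w(a) w(b) = 0, so w(b) = 0 and b = 0.\<close>

lemma symmetric_sandwich_zero:
  assumes char: "(2::'f) \<noteq> 0" and z: "\<And>z. a * z * b + b * z * a = (0::'b)"
  shows "a = 0 \<or> b = 0"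
proof (rule ccontr)
  assume "\<not> ?thesis"
  then have ab: "a \<noteq> 0" "b \<noteq> 0" by auto
  obtain w where w: "functional sc w" "w a \<noteq> 0" using ab(1) by (rule separating_functional)
  let ?e = "\<lambda>i::nat. if i = 0 then a else b" and ?b = "\<lambda>i::nat. if i = 0 then b else a"
  have "(\<Sum>i\<in>{0, Suc 0}. ?e i * x * ?b i) = 0" for x using z[of x] by simp
  from tensor_functional[OF _ this w(1)] have eq: "sc (w a) b + sc (w b) a = 0" by simp
  from arg_cong[OF this, of w] have "w a * w b + w b * w a = 0"
    by (simp add: functional_simps[OF w(1)])
  then have "2 * (w a * w b) = 0" by (simp add: mult.commute)
  then have "w b = 0" using char w(2) by simp
  then show False using eq w(2) ab(2) by simp
qed

text \<open>The two defects \<open>\<theta> (x * y) - \<theta> x * \<theta> y\<close> and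
  \<open>\<theta> (x * y) - \<theta> y * \<theta> x\<close> satisfy the identity of
  \<open>symmetric_sandwich_zero\<close>, so one of them vanishes for each pair. The alternatives
  define subgroups, first in y for fixed x and then in x, so one alternative holds
  throughout.\<close>

theorem jordan_automorphism:
  assumes char: "(2::'f) \<noteq> 0"
    and add: "\<And>x y :: 'b. \<theta> (x + y) = \<theta> x + (\<theta> y :: 'b)" and surj: "surj \<theta>"
    and jordan: "\<And>x y. \<theta> (x * y + y * x) = \<theta> x * \<theta> y + \<theta> y * \<theta> x"
  shows "(\<forall>x y. \<theta> (x * y) = \<theta> x * \<theta> y) \<or> (\<forall>x y. \<theta> (x * y) = \<theta> y * \<theta> x)"
proof -
  interpret additive \<theta> by standard (rule add)
  note half = two_torsion_free[OF char]
  have sq: "\<theta> (x * x) = \<theta> x * \<theta> x" for x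
    using jordan[of x x] unfolding add half .
  have xyx: "\<theta> (x * y * x) = \<theta> x * \<theta> y * \<theta> x" for x y
  proof -
    have "x * y * x + x * y * x = (x * (x * y + y * x) + (x * y + y * x) * x) - (x * x * y + y * (x * x))"
      by (simp add: algebra_simps)
    then have "\<theta> (x * y * x + x * y * x) = (\<theta> x * (\<theta> x * \<theta> y + \<theta> y * \<theta> x) + (\<theta> x * \<theta> y + \<theta> y * \<theta> x) * \<theta> x)
        - (\<theta> x * \<theta> x * \<theta> y + \<theta> y * (\<theta> x * \<theta> x))"
      by (simp only: diff jordan sq)
    also have "\<dots> = \<theta> x * \<theta> y * \<theta> x + \<theta> x * \<theta> y * \<theta> x" by (simp add: algebra_simps)
    finally show ?thesis unfolding add half .
  qed
  have xyz: "\<theta> (x * y * z + z * y * x) = \<theta> x * \<theta> y * \<theta> z + \<theta> z * \<theta> y * \<theta> x" for x y z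
  proof -
    have "x * y * z + z * y * x = (x + z) * y * (x + z) - x * y * x - z * y * z" by (simp add: algebra_simps)
    then have "\<theta> (x * y * z + z * y * x) = (\<theta> x + \<theta> z) * \<theta> y * (\<theta> x + \<theta> z) - \<theta> x * \<theta> y * \<theta> x - \<theta> z * \<theta> y * \<theta> z"
      by (simp only: diff xyx add)
    then show ?thesis by (simp add: algebra_simps)
  qed
  have "\<theta> (x * y) - \<theta> x * \<theta> y = 0 \<or> \<theta> (x * y) - \<theta> y * \<theta> x = 0" for x y
  proof (rule symmetric_sandwich_zero[OF char])
    fix Z
    obtain z where Z: "Z = \<theta> z" using surj by blast
    have yx: "\<theta> (y * x) = \<theta> x * \<theta> y + \<theta> y * \<theta> x - \<theta> (x * y)"
      using jordan[of x y] unfolding add by (simp add: algebra_simps)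
    \<comment> \<open>The same element is evaluated by nested use of \<open>xyx\<close> and by
      \<open>xyz\<close> applied to the outer factors xy and yx.\<close>
    have "x * y * z * (y * x) + y * x * z * (x * y) = x * (y * z * y) * x + y * (x * z * x) * y"
      by (simp add: mult.assoc)
    then have "\<theta> (x * y * z * (y * x) + y * x * z * (x * y))
        = \<theta> x * (\<theta> y * \<theta> z * \<theta> y) * \<theta> x + \<theta> y * (\<theta> x * \<theta> z * \<theta> x) * \<theta> y"
      by (simp only: add xyx)
    moreover have "\<theta> (x * y * z * (y * x) + y * x * z * (x * y))
        = \<theta> (x * y) * \<theta> z * \<theta> (y * x) + \<theta> (y * x) * \<theta> z * \<theta> (x * y)" by (rule xyz)
    ultimately show "(\<theta> (x * y) - \<theta> x * \<theta> y) * Z * (\<theta> (x * y) - \<theta> y * \<theta> x)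
        + (\<theta> (x * y) - \<theta> y * \<theta> x) * Z * (\<theta> (x * y) - \<theta> x * \<theta> y) = 0"
      unfolding yx Z by (simp add: algebra_simps)
  qed
  then have "(\<forall>y. \<theta> (x * y) = \<theta> x * \<theta> y) \<or> (\<forall>y. \<theta> (x * y) = \<theta> y * \<theta> x)" for x
    by (intro covering_by_two_subgroups) (auto simp: diff algebra_simps)
  then show ?thesis
    by (intro covering_by_two_subgroups) (auto simp: diff algebra_simps)
qed

text \<open>The difficulty is that y occurs inside B. In the combination of J formed in
  \<open>key\<close>, y only occurs between left and right factors. There B x z is a right factor
  with left factor - t^2 alone, so a functional vanishing on 1 and t isolates it.\<close>

lemma bilinear_commuting_form:
  fixes B :: "'b \<Rightarrow> 'b \<Rightarrow> 'b"
  assumes char: "(2::'f) \<noteq> 0" and t: "\<not> quadratic t"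
    and sym: "\<And>x y. B x y = B y x" and add: "\<And>x y z. B x (y + z) = B x y + B x z"
    and scale: "\<And>c x y. B x (sc c y) = sc c (B x y)"
    and J: "\<And>x y z. (B x y * z - z * B x y) + (B y z * x - x * B y z) + (B x z * y - y * B x z) = 0"
  obtains k \<mu> where "functional sc \<mu>"
    "\<And>x z. scalar (B x z - sc k (x * z + z * x) - sc (\<mu> z) x - sc (\<mu> x) z)"
proof -
  define g where "g = B t"
  define Q where "Q = sc (1 / 2) (g t)"
  have QQ: "g t = Q + Q" unfolding Q_def scale_two[symmetric] using char by simp
  \<comment> \<open>Moving t to the left past B y u costs terms with g y, and moving it past g y
    costs terms in which y stands free. After two moves y is no longer inside B, which is why the
    combination in \<open>key\<close> is of second order in t.\<close>
  have r1: "B y u * (t * w) = t * (B y u * w) - (g y * u - u * g y) * w - (g u * y - y * g u) * w" for y u w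
  proof -
    have "B y u * t - t * B y u = - (g y * u - u * g y) - (g u * y - y * g u)"
      using J[of y u t] sym[of u t] sym[of y t] unfolding g_def by (simp add: algebra_simps eq_neg_iff_add_eq_0)
    then have "(B y u * t - t * B y u) * w = (- (g y * u - u * g y) - (g u * y - y * g u)) * w" by simp
    then show ?thesis by (simp add: algebra_simps)
  qed
  have r2: "g y * (t * w) = t * (g y * w) + y * (Q * w) - Q * (y * w)" for y w
  proof -
    have "(g y * t - t * g y) + (g y * t - t * g y) = (y * Q - Q * y) + (y * Q - Q * y)"
      using J[of t y t] sym[of y t] QQ unfolding g_def by (simp add: algebra_simps)
    then have "g y * t - t * g y = y * Q - Q * y" by (simp only: two_torsion_free(2)[OF char])
    then have "(g y * t - t * g y) * w = (y * Q - Q * y) * w" by simp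
    then show ?thesis by (simp add: algebra_simps)
  qed
  define \<gamma> where "\<gamma> z = g (t * z) - t * g z" for z
  define D where "D x z = B (t * x) (t * z) - t * B x (t * z) - t * B (t * x) z + t * t * B x z" for x z
  have key: "D x z * y * 1 + Q * y * (z * x + x * z) + (- \<gamma> z) * y * x + (- \<gamma> x) * y * z
      + 1 * y * (g (t * z) * x + g (t * x) * z - Q * (z * x + x * z) - B (t * x) (t * z))
      + t * y * (B x (t * z) + B (t * x) z - g z * x - g x * z) + (- (t * t)) * y * B x z = 0" for x y z
  proof -
    let ?J = "\<lambda>x z. (B y x * z - z * B y x) + (B x z * y - y * B x z) + (B y z * x - x * B y z)"
    have "?J (t * x) (t * z) - t * ?J x (t * z) - t * ?J (t * x) z + t * t * ?J x z = 0"
      unfolding J by simp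
    then show ?thesis
      unfolding D_def \<gamma>_def by (simp add: algebra_simps r1 r2)
  qed
  have indep: "fam_indep sc {..2} (\<lambda>i. t ^ i)"
    unfolding fam_indep_def
  proof (intro allI impI)
    fix c assume 0: "(\<Sum>i\<le>2. sc (c i) (t ^ i)) = 0"
    then have eq: "sc (c 2) (t * t) + sc (c 1) t = - sc (c 0) 1"
      by (simp add: numeral_2_eq_2 eq_neg_iff_add_eq_0 algebra_simps)
    have "scalar (sc (c 2) (t * t) + sc (c 1) t)" unfolding eq by (intro scalar_closed)
    note c = not_quadraticD[OF t this]
    with eq have "c 0 = 0" by simp
    then show "\<forall>i\<in>{..2}. c i = 0" using c by (auto simp: numeral_2_eq_2 le_Suc_eq)
  qed
  obtain w where w: "functional sc w" "\<And>i. i \<in> {..2} \<Longrightarrow> w (t ^ i) = (if i = 2 then 1 else 0)"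
    by (rule dual_functional[OF _ indep, of 2]) auto
  have w': "w 1 = 0" "w t = 0" "w (t * t) = 1"
    using w(2)[of 0] w(2)[of 1] w(2)[of 2] by (simp_all add: power2_eq_square)
  note ws = functional_simps[OF w(1)]
  show ?thesis
  proof (rule that[of "\<lambda>z. - w (\<gamma> z)" "w Q"])
    have g_add: "g (x + y) = g x + g y" for x y unfolding g_def by (rule add)
    have g_scale: "g (sc c x) = sc c (g x)" for c x unfolding g_def by (rule scale)
    have "\<gamma> (x + y) = \<gamma> x + \<gamma> y" "\<gamma> (sc c x) = sc c (\<gamma> x)" for x y c
      unfolding \<gamma>_def by (simp_all add: g_add g_scale mult_sc scale_right_diff_distrib algebra_simps)
    then show "functional sc (\<lambda>z. - w (\<gamma> z))" unfolding functional_def by (simp add: ws)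
    fix x z
    let ?e = "\<lambda>i::nat. [D x z, Q, - \<gamma> z, - \<gamma> x, 1, t, - (t * t)] ! i"
    let ?b = "\<lambda>i::nat. [1, z * x + x * z, x, z, g (t * z) * x + g (t * x) * z - Q * (z * x + x * z) - B (t * x) (t * z),
      B x (t * z) + B (t * x) z - g z * x - g x * z, B x z] ! i"
    have set7: "(\<Sum>i<7. h i) = h 0 + h 1 + h 2 + h 3 + h 4 + h 5 + h 6" for h :: "nat \<Rightarrow> 'b"
      by (simp add: eval_nat_numeral lessThan_Suc)
    have "(\<Sum>i<7. ?e i * y * ?b i) = 0" for y
      unfolding set7 using key[of x z y] by simp
    from tensor_functional[OF _ this w(1)]
    have "sc (w (D x z)) 1 + sc (w Q) (z * x + x * z) + sc (- w (\<gamma> z)) x + sc (- w (\<gamma> x)) z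
        + sc (- 1) (B x z) = 0"
      unfolding set7 by (simp add: ws w')
    then have "B x z - sc (w Q) (x * z + z * x) - sc (- w (\<gamma> z)) x - sc (- w (\<gamma> x)) z = sc (w (D x z)) 1"
      by (simp add: scale_minus_left algebra_simps)
    then show "scalar (B x z - sc (w Q) (x * z + z * x) - sc (- w (\<gamma> z)) x - sc (- w (\<gamma> x)) z)"
      by (simp add: scalar_sc_one)
  qed
qed

end

context falg
begin

lemma dim_gt_fam_indep:
  assumes "dim_gt sc n" "m \<le> n"
  obtains a :: "nat \<Rightarrow> 'b" where "fam_indep sc {..m} a"
proof -
  have "\<exists>B. independent B \<and> finite B \<and> card B = Suc m"
  proof (cases "\<exists>B. independent B \<and> infinite B")
    case True
    then obtain B where B: "independent B" "infinite B" by blast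
    obtain B' where "finite B'" "card B' = Suc m" "B' \<subseteq> B"
      using infinite_arbitrarily_large[OF B(2)] by blast
    then show ?thesis using independent_mono[OF B(1)] by blast
  next
    case False
    then have "dim UNIV > n" using assms(1) unfolding dim_gt_def by blast
    moreover obtain B where B: "independent B" "card B = dim UNIV"
      using basis_exists[of UNIV] by blast
    ultimately have "Suc m \<le> card B" using assms(2) by simp
    then obtain B' where "B' \<subseteq> B" "card B' = Suc m" "finite B'"
      by (rule obtain_subset_with_card_n)
    then show ?thesis using independent_mono[OF B(1)] by blast
  qed
  then obtain B where B: "independent B" "finite B" "card B = Suc m" by blast
  obtain h where "bij_betw h {0..<card B} B" using ex_bij_betw_nat_finite[OF B(2)] by blast
  moreover have "{0..<card B} = {..m}" unfolding B(3) by auto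
  ultimately have h: "bij_betw h {..m} B" by simp
  have "fam_indep sc {..m} h"
    unfolding fam_indep_def
  proof (intro allI impI ballI)
    fix c i assume 0: "(\<Sum>i\<le>m. sc (c i) (h i)) = 0" and i: "i \<in> {..m}"
    let ?k = "the_inv_into {..m} h"
    have k: "?k (h j) = j" if "j \<in> {..m}" for j
      using the_inv_into_f_f[OF bij_betw_imp_inj_on[OF h] that] .
    have "(\<Sum>b\<in>B. sc (c (?k b)) b) = (\<Sum>i\<le>m. sc (c (?k (h i))) (h i))"
      by (rule sum.reindex_bij_betw[OF h, symmetric])
    also have "\<dots> = 0" using 0 k by simp
    finally have "c (?k (h i)) = 0"
      by (rule fam_indepD[OF independent_fam_indep[OF B(2,1)]]) (use h i in \<open>auto simp: bij_betw_def\<close>)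
    then show "c i = 0" using k[OF i] by simp
  qed
  then show ?thesis by (rule that)
qed

end

section \<open>From the commuting square to a Jordan homomorphism\<close>

context cc_prime
begin

lemma commuting_square_jordan_mod_scalars:
  assumes char: "(2::'f) \<noteq> 0" and t: "\<not> quadratic t"
    and lin: "Vector_Spaces.linear sc sc \<phi>" and bij: "bij \<phi>" and one: "\<phi> 1 = 1"
    and comm: "\<And>x. \<phi> (x * x) * \<phi> x = \<phi> x * \<phi> (x * x)"
  obtains k \<theta> \<omega> where "Vector_Spaces.linear sc sc \<theta>" "bij \<theta>" "\<theta> 1 = 1" "functional sc \<omega>"
    "\<And>x. \<phi> x = sc k (\<theta> x) + sc (\<omega> x) 1"
    "\<And>x z. scalar (\<theta> (x * z + z * x) - (\<theta> x * \<theta> z + \<theta> z * \<theta> x))"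
proof -
  interpret lin: Vector_Spaces.linear sc sc \<phi> by (rule lin)
  define \<psi> where "\<psi> = inv \<phi>"
  have \<phi>\<psi>: "\<phi> (\<psi> X) = X" and \<psi>\<phi>: "\<psi> (\<phi> x) = x" for X x
    using bij unfolding \<psi>_def by (simp_all add: bij_is_surj surj_f_inv_f bij_is_inj)
  have inj: "\<phi> x = \<phi> y \<Longrightarrow> x = y" for x y by (metis \<psi>\<phi>)
  have \<psi>add: "\<psi> (X + Y) = \<psi> X + \<psi> Y" and \<psi>scale: "\<psi> (sc c X) = sc c (\<psi> X)" for X Y c
    by (rule inj, simp add: \<phi>\<psi> lin.add lin.scale)+
  have \<phi>sc: "\<phi> (sc c 1) = sc c 1" for c by (simp add: lin.scale one)
  have scal: "scalar x" if x: "scalar (\<phi> x)" for x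
  proof -
    obtain c where "\<phi> x = sc c 1" using x by (rule scalarE)
    then have "x = sc c 1" using \<phi>sc[of c] inj[of x "sc c 1"] by simp
    then show ?thesis by (simp add: scalar_sc_one)
  qed
  define B where "B X Z = \<phi> (\<psi> X * \<psi> Z + \<psi> Z * \<psi> X)" for X Z
  define q where "q X = \<phi> (\<psi> X * \<psi> X)" for X
  define F where "F X = q X * X - X * q X" for X
  have F0: "F X = 0" for X using comm[of "\<psi> X"] unfolding F_def q_def \<phi>\<psi> by simp
  have qadd: "q (X + Y) = q X + q Y + B X Y" for X Y
    unfolding q_def B_def by (simp add: \<psi>add lin.add algebra_simps)
  have Badd: "B X (Y + Z) = B X Y + B X Z" "B (X + Y) Z = B X Z + B Y Z" for X Y Z
    unfolding B_def by (simp_all add: \<psi>add lin.add algebra_simps)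
  have Bsym: "B X Y = B Y X" for X Y unfolding B_def by (simp add: add.commute)
  have Bscale: "B X (sc c Y) = sc c (B X Y)" for c X Y
    unfolding B_def by (simp add: \<psi>scale mult_sc sc_mult lin.scale lin.add scale_right_distrib)
  have J: "(B X Y * Z - Z * B X Y) + (B Y Z * X - X * B Y Z) + (B X Z * Y - Y * B X Z) = 0" for X Y Z
  proof -
    \<comment> \<open>Complete linearization of the cubic map \<open>F\<close> by inclusion and
      exclusion.\<close>
    have "(B X Y * Z - Z * B X Y) + (B Y Z * X - X * B Y Z) + (B X Z * Y - Y * B X Z)
        = F (X + Y + Z) - F (X + Y) - F (X + Z) - F (Y + Z) + F X + F Y + F Z"
      unfolding F_def by (simp add: qadd Badd algebra_simps)
    then show ?thesis by (simp add: F0)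
  qed
  obtain k \<mu> where \<mu>: "functional sc \<mu>"
    and form: "\<And>X Z. scalar (B X Z - sc k (X * Z + Z * X) - sc (\<mu> Z) X - sc (\<mu> X) Z)"
    by (rule bilinear_commuting_form[OF char t Bsym Badd(1) Bscale J]) (rule that, assumption+)
  note \<mu>s = functional_simps[OF \<mu>]
  have form': "scalar (\<phi> (x * z + z * x) - sc k (\<phi> x * \<phi> z + \<phi> z * \<phi> x)
      - sc (\<mu> (\<phi> z)) (\<phi> x) - sc (\<mu> (\<phi> x)) (\<phi> z))" for x z
    using form[of "\<phi> x" "\<phi> z"] unfolding B_def \<psi>\<phi> .
  have k: "k \<noteq> 0"
  proof
    assume "k = 0"
    have "quadratic x" for x
    proof -
      let ?y = "x * x - sc (\<mu> (\<phi> x)) x"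
      have "scalar (\<phi> (?y + ?y))"
        using form'[of x x] \<open>k = 0\<close> by (simp add: lin.add lin.diff lin.scale algebra_simps)
      then have "scalar (sc 2 ?y)" unfolding scale_two by (rule scal)
      then have "scalar ?y" using char by (rule scalar_sc_cancel)
      then show ?thesis unfolding quadratic_def by blast
    qed
    then show False using t by blast
  qed
  define h where "h x = \<mu> (\<phi> x) / 2" for x
  have \<mu>h: "\<mu> (\<phi> x) = h x + h x" for x unfolding h_def using char by (simp add: field_simps)
  have h: "functional sc h"
    unfolding functional_def h_def by (simp add: lin.add lin.scale \<mu>s add_divide_distrib)
  note hs = functional_simps[OF h]
  \<comment> \<open>Completing the square: up to the factor k, the terms with \<mu> are the mixed
    terms of (k \<phi> x + h x) (k \<phi> z + h z) and its reverse.\<close>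
  define \<theta> where "\<theta> x = sc k (\<phi> x) + sc (h x) 1" for x
  have \<theta>add: "\<theta> (x + y) = \<theta> x + \<theta> y" and \<theta>scale: "\<theta> (sc c x) = sc c (\<theta> x)" for x y c
    unfolding \<theta>_def
    by (simp_all add: lin.add lin.scale hs scale_right_distrib scale_left_distrib mult.commute algebra_simps)
  have \<theta>lin: "Vector_Spaces.linear sc sc \<theta>"
    unfolding Vector_Spaces.linear_iff using vector_space_axioms \<theta>add \<theta>scale by blast
  interpret T: Vector_Spaces.linear sc sc \<theta> by (rule \<theta>lin)
  have jord: "scalar (\<theta> (x * z + z * x) - (\<theta> x * \<theta> z + \<theta> z * \<theta> x))" for x z
  proof -
    let ?L = "\<phi> (x * z + z * x) - sc k (\<phi> x * \<phi> z + \<phi> z * \<phi> x)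
      - sc (\<mu> (\<phi> z)) (\<phi> x) - sc (\<mu> (\<phi> x)) (\<phi> z)"
    have "\<theta> (x * z + z * x) - (\<theta> x * \<theta> z + \<theta> z * \<theta> x)
        = sc k ?L + sc (h (x * z + z * x)) 1 - sc (h x * h z) 1 - sc (h x * h z) 1"
    proof -
      have "\<theta> x * \<theta> z = sc k (sc k (\<phi> x * \<phi> z) + sc (h z) (\<phi> x) + sc (h x) (\<phi> z)) + sc (h x * h z) 1" for x z
        unfolding \<theta>_def by (simp add: algebra_simps mult_sc sc_mult)
      from this[of x z] this[of z x] show ?thesis
        unfolding \<mu>h scale_left_distrib by (simp add: \<theta>_def[of "x * z + z * x"] algebra_simps)
    qed
    then show ?thesis using scalar_closed(5,6,3) scalar_sc_one form' by simp
  qed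
  have \<theta>scal: "scalar x" if "scalar (\<theta> x)" for x
  proof -
    have "scalar (\<theta> x - sc (h x) 1)" by (intro scalar_closed scalar_sc_one that)
    then have "scalar (sc k (\<phi> x))" unfolding \<theta>_def by simp
    then show ?thesis using k scalar_sc_cancel scal by blast
  qed
  define c where "c = k + h 1"
  have \<theta>1: "\<theta> 1 = sc c 1" unfolding \<theta>_def c_def by (simp add: one scale_left_distrib)
  \<comment> \<open>The relation for the pair t, 1 makes (1 - c) \<theta>(t + t) a scalar, so c
    \<noteq> 1 would make t a scalar.\<close>
  have "c = 1"
  proof (rule ccontr)
    assume "c \<noteq> 1"
    have "\<theta> (t * 1 + 1 * t) - (\<theta> t * \<theta> 1 + \<theta> 1 * \<theta> t) = sc (1 - c) (\<theta> (t + t))"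
      unfolding \<theta>1 by (simp add: sc_one_commute sc_one_mult T.add scale_right_distrib scale_left_diff_distrib)
    then have "scalar (sc (1 - c) (\<theta> (t + t)))" using jord[of t 1] by simp
    then have "scalar (\<theta> (t + t))" by (rule scalar_sc_cancel) (use \<open>c \<noteq> 1\<close> in simp)
    then have "scalar (t + t)" by (rule \<theta>scal)
    then have "scalar t" using scalar_sc_cancel[of 2 t] char by (simp add: scale_two)
    then show False using t scalar_quadratic by blast
  qed
  then have \<theta>one: "\<theta> 1 = 1" using \<theta>1 by simp
  have bij': "bij \<theta>"
  proof (rule bijI)
    show "inj \<theta>"
    proof (rule injI)
      fix x y assume "\<theta> x = \<theta> y"
      then have "\<theta> (x - y) = 0" by (simp add: T.diff)
      then obtain d where d: "x - y = sc d 1" using \<theta>scal[of "x - y"] scalar_closed(1) scalarE by metis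
      then have "\<theta> (x - y) = sc d 1" by (simp add: T.scale \<theta>one)
      then show "x = y" using \<open>\<theta> (x - y) = 0\<close> d by simp
    qed
    show "surj \<theta>"
      unfolding surj_def
    proof
      fix Y
      let ?x = "\<psi> (sc (1 / k) Y)"
      have "\<theta> ?x = Y + sc (h ?x) 1" unfolding \<theta>_def \<phi>\<psi> using k by simp
      then have "Y = \<theta> (?x - sc (h ?x) 1)" by (simp add: T.diff T.scale \<theta>one)
      then show "\<exists>x. Y = \<theta> x" by blast
    qed
  qed
  show ?thesis
  proof (rule that[OF \<theta>lin bij' \<theta>one _ _ jord])
    show "functional sc (\<lambda>x. - h x / k)"
      unfolding functional_def by (simp add: hs add_divide_distrib diff_divide_distrib)
    show "\<phi> x = sc (1 / k) (\<theta> x) + sc (- h x / k) 1" for x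
      unfolding \<theta>_def using k by (simp add: scale_right_distrib scale_minus_left)
  qed
qed

text \<open>Let E be the scalar defect. Expanding the Jordan identity (x^2 \<circ> y) \<circ> x =
  x^2 \<circ> (x \<circ> y) puts -2 E(x, y) X^2 + 2 E(x^2, y) X with X = \<theta> x into F, so E(x,
  y) = 0 unless X is quadratic. If E(x, z) is nonzero, then for every non-quadratic T the elements T
  + \<theta> x and T - \<theta> x are quadratic as well, because E(., z) vanishes at the preimage of
  T. By \<open>quadratic_line\<close> this makes \<theta> x central, so x is a scalar, and scalars
  have no defect.\<close>

lemma jordan_mod_scalars_imp_jordan:
  assumes char: "(2::'f) \<noteq> 0" and t: "\<not> quadratic t"
    and lin: "Vector_Spaces.linear sc sc \<theta>" and bij: "bij \<theta>" and one: "\<theta> 1 = 1"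
    and jord: "\<And>x z. scalar (\<theta> (x * z + z * x) - (\<theta> x * \<theta> z + \<theta> z * \<theta> x))"
  shows "\<theta> (x * z + z * x) = \<theta> x * \<theta> z + \<theta> z * \<theta> x"
proof -
  interpret T: Vector_Spaces.linear sc sc \<theta> by (rule lin)
  have "\<forall>x z. \<exists>c. \<theta> (x * z + z * x) - (\<theta> x * \<theta> z + \<theta> z * \<theta> x) = sc c 1"
    using jord unfolding scalar_def by blast
  then obtain E where E0: "\<And>x z. \<theta> (x * z + z * x) - (\<theta> x * \<theta> z + \<theta> z * \<theta> x) = sc (E x z) 1" by metis
  then have E: "\<theta> (x * z + z * x) = \<theta> x * \<theta> z + \<theta> z * \<theta> x + sc (E x z) 1" for x z
    using E0[of x z] by (simp add: diff_eq_eq add.commute)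
  have E_left: "E (x + y) z = E x z + E y z" "E (x - y) z = E x z - E y z" for x y z
  proof -
    have "sc (E x z + E y z) 1 = sc (E (x + y) z) (1::'b)" "sc (E x z - E y z) 1 = sc (E (x - y) z) (1::'b)"
      unfolding scale_left_distrib scale_left_diff_distrib E0[symmetric]
      by (simp_all add: T.add T.diff algebra_simps)
    then show "E (x + y) z = E x z + E y z" "E (x - y) z = E x z - E y z"
      by (simp_all add: scale_cancel_right)
  qed
  have nonquad: "E x y = 0" if X: "\<not> quadratic (\<theta> x)" for x y
  proof -
    define X Y where "X = \<theta> x" and "Y = \<theta> y"
    define u e f h where "u = x * x * y + y * (x * x)" and "e = E x y" and "f = E (x * x) y" and "h = E x x / 2"
    have "\<theta> (x * x) + \<theta> (x * x) = (X * X + sc h 1) + (X * X + sc h 1)"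
    proof -
      have "sc (E x x) 1 = sc h 1 + sc h (1::'b)"
        unfolding h_def scale_left_distrib[symmetric] using char by (simp add: field_simps)
      then show ?thesis using E[of x x] unfolding T.add X_def by (simp add: algebra_simps)
    qed
    then have xx: "\<theta> (x * x) = X * X + sc h 1" by (simp only: two_torsion_free(2)[OF char])
    have xy: "\<theta> (x * y + y * x) = X * Y + Y * X + sc e 1" unfolding X_def Y_def e_def by (rule E)
    have u: "\<theta> u = (X * X + sc h 1) * Y + Y * (X * X + sc h 1) + sc f 1"
      unfolding u_def f_def Y_def xx[symmetric] by (rule E)
    have "u * x + x * u = x * x * (x * y + y * x) + (x * y + y * x) * (x * x)"
      unfolding u_def by (simp add: algebra_simps)
    then have "\<theta> (u * x + x * u) = \<theta> (x * x * (x * y + y * x) + (x * y + y * x) * (x * x))" by simp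
    then have "((X * X + sc h 1) * Y + Y * (X * X + sc h 1) + sc f 1) * X
        + X * ((X * X + sc h 1) * Y + Y * (X * X + sc h 1) + sc f 1) + sc (E u x) 1
      = (X * X + sc h 1) * (X * Y + Y * X + sc e 1) + (X * Y + Y * X + sc e 1) * (X * X + sc h 1)
        + sc (E (x * x) (x * y + y * x)) 1"
      unfolding E[of u x] E[of "x * x" "x * y + y * x"] u xx xy X_def[symmetric] .
    then have "- (sc e (X * X) + sc e (X * X)) + (sc f X + sc f X)
        = sc (E (x * x) (x * y + y * x)) 1 - sc (E u x) 1 + (sc (e * h) 1 + sc (e * h) 1)"
      by (simp add: algebra_simps mult_sc sc_mult)
    then have "sc (- (e + e)) (X * X) + sc (f + f) X
        = sc (E (x * x) (x * y + y * x)) 1 - sc (E u x) 1 + (sc (e * h) 1 + sc (e * h) 1)"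
      by (simp only: scale_minus_left scale_left_distrib)
    moreover have "scalar \<dots>" by (intro scalar_closed scalar_sc_one)
    ultimately have "scalar (sc (- (e + e)) (X * X) + sc (f + f) X)" by simp
    from not_quadraticD(1)[OF X[folded X_def] this] have "2 * e = 0" by (simp only: mult_2 neg_equal_0_iff_equal)
    then show ?thesis using char unfolding e_def by simp
  qed
  have "E x z = 0"
  proof (rule ccontr)
    assume nz: "E x z \<noteq> 0"
    have q: "quadratic (\<theta> x)" using nz nonquad by blast
    have comm: "\<theta> x * T = T * \<theta> x" if T: "\<not> quadratic T" for T
    proof -
      obtain s where s: "T = \<theta> s" using bij by (metis bij_pointE)
      have "E s z = 0" using nonquad T unfolding s by blast
      then have "quadratic (\<theta> (s + x))" "quadratic (\<theta> (s - x))"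
        using nz nonquad[of "s + x" z] nonquad[of "s - x" z] unfolding E_left by auto
      then have "quadratic (T + \<theta> x)" "quadratic (T - \<theta> x)" unfolding s by (simp_all add: T.add T.diff)
      from quadratic_line[OF char T q this refl] show ?thesis .
    qed
    \<comment> \<open>If Y does not commute with \<theta> x, neither do t + Y and t - Y, so all
      three are quadratic; then Y commutes with all that commutes with t, in particular with
      \<theta> x.\<close>
    have "\<theta> x * Y = Y * \<theta> x" for Y
    proof (rule ccontr)
      assume Y: "\<theta> x * Y \<noteq> Y * \<theta> x"
      have "\<theta> x * (t + Y) \<noteq> (t + Y) * \<theta> x" "\<theta> x * (t - Y) \<noteq> (t - Y) * \<theta> x"
        using Y comm[OF t] by (simp_all add: algebra_simps)
      then have "quadratic Y" "quadratic (t + Y)" "quadratic (t - Y)" using comm Y by blast+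
      from quadratic_line[OF char t this comm[OF t, symmetric]] show False using Y by simp
    qed
    then obtain c where "\<theta> x = sc c 1" by (rule central_imp_scalar)
    moreover have "\<theta> (sc c 1) = sc c 1" by (simp add: T.scale one)
    ultimately have "x = sc c 1" using bij by (metis bij_pointE)
    then have "\<theta> (x * z + z * x) = sc c (\<theta> z) + sc c (\<theta> z)"
      by (simp add: sc_one_mult sc_one_commute T.add T.scale)
    moreover have "\<theta> x * \<theta> z + \<theta> z * \<theta> x = sc c (\<theta> z) + sc c (\<theta> z)"
      unfolding \<open>\<theta> x = sc c 1\<close> by (simp add: sc_one_mult sc_one_commute)
    ultimately have "sc (E x z) (1::'b) = 0"
      using E[of x z] by simp
    then show False using nz by simp
  qed
  then show ?thesis using E[of x z] by simp
qed

end

theorem theorem3p6: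
  fixes sc :: "'f::field \<Rightarrow> 'b::ring_1 \<Rightarrow> 'b"
    and d :: nat and lam :: "(nat \<Rightarrow> nat) \<Rightarrow> 'f" and \<phi> :: "'b \<Rightarrow> 'b"
  assumes char: "(2::'f) \<noteq> 0" "(3::'f) \<noteq> 0"
    and d2: "d \<ge> 2"
    and sum0: "(\<Sum>\<sigma>\<in>{\<sigma>. \<sigma> permutes {0..<d}}. lam \<sigma>) = 0"
    and fxy: "\<exists>w. subst_xy d lam w \<noteq> 0"
    and alg: "F_algebra sc"
    and prime: "prime_ring TYPE('b)"
    and cc: "centrally_closed sc"
    and dim: "dim_gt sc (d^2)"
    and lin: "Vector_Spaces.linear sc sc \<phi>"
    and bij: "bij \<phi>"
    and pres: "preserves_zeros sc d lam \<phi>"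
  shows "\<exists>(\<alpha>::'f) (\<theta>::'b \<Rightarrow> 'b) (\<omega>::'b \<Rightarrow> 'f).
           Vector_Spaces.linear sc sc \<theta> \<and> bij \<theta> \<and>
           ((\<forall>a b. \<theta> (a * b) = \<theta> a * \<theta> b) \<or> (\<forall>a b. \<theta> (a * b) = \<theta> b * \<theta> a)) \<and>
           Vector_Spaces.linear sc (*) \<omega> \<and>
           (\<forall>a. \<phi> a = sc \<alpha> (\<theta> a) + sc (\<omega> a) 1)"
proof -
  interpret vector_space sc using alg unfolding F_algebra_def by blast
  interpret cc_prime sc
  proof
    show "sc c (a * b) = sc c a * b" "sc c (a * b) = a * sc c b" for c a b
      using alg unfolding F_algebra_def by blast+
  qed (use prime cc in blast)+
  interpret lin: Vector_Spaces.linear sc sc \<phi> by (rule lin)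
  have F: "vector_space ((*) :: 'f \<Rightarrow> 'f \<Rightarrow> 'f)" by standard (auto simp: algebra_simps)
  obtain a where a: "fam_indep sc {..d^2} (a :: nat \<Rightarrow> 'b)" by (rule dim_gt_fam_indep[OF dim order_refl])
  \<comment> \<open>This provides five independent elements, which is what a non-quadratic element
    requires.\<close>
  have "4 \<le> d^2" using power_mono[OF d2, of 2] by simp
  from dim_gt_fam_indep[OF dim this] obtain a' where a': "fam_indep sc {..4} (a' :: nat \<Rightarrow> 'b)" .
  obtain t where t: "\<not> quadratic t" by (rule ex_not_quadratic[OF char(1) a'])
  obtain c where c: "c \<noteq> 0" "\<phi> 1 = sc c 1" "\<And>x. \<phi> (x * x) * \<phi> x = \<phi> x * \<phi> (x * x)"
    by (rule preserver_commutes_square[OF char(1) d2 sum0 fxy a lin bij pres]) (rule that, assumption+)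
  \<comment> \<open>Division by c makes the image of 1 equal to 1; the factor c returns in both
    terms of the final formula.\<close>
  define \<phi>1 where "\<phi>1 x = sc (1 / c) (\<phi> x)" for x
  have \<phi>: "\<phi> x = sc c (\<phi>1 x)" for x unfolding \<phi>1_def using c(1) by simp
  have lin1: "Vector_Spaces.linear sc sc \<phi>1"
    unfolding Vector_Spaces.linear_iff \<phi>1_def
    using vector_space_axioms by (simp add: lin.add lin.scale scale_right_distrib mult.commute)
  have bij1: "bij \<phi>1"
  proof (rule bijI)
    show "inj \<phi>1" using c(1) bij_is_inj[OF bij] unfolding \<phi>1_def inj_def by simp
    show "surj \<phi>1"
      unfolding surj_def
    proof
      fix y
      obtain x where "sc c y = \<phi> x" using bij by (metis bij_pointE)
      then have "y = \<phi>1 x" unfolding \<phi> using c(1) by simp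
      then show "\<exists>x. y = \<phi>1 x" by blast
    qed
  qed
  have one1: "\<phi>1 1 = 1" and comm1: "\<phi>1 (x * x) * \<phi>1 x = \<phi>1 x * \<phi>1 (x * x)" for x
    unfolding \<phi>1_def using c by (simp_all add: mult_sc sc_mult)
  obtain k \<theta> \<omega> where \<theta>: "Vector_Spaces.linear sc sc \<theta>" "bij \<theta>" "\<theta> 1 = 1" "functional sc \<omega>"
    "\<And>x. \<phi>1 x = sc k (\<theta> x) + sc (\<omega> x) 1"
    "\<And>x z. scalar (\<theta> (x * z + z * x) - (\<theta> x * \<theta> z + \<theta> z * \<theta> x))"
    by (rule commuting_square_jordan_mod_scalars[where \<phi> = \<phi>1, OF char(1) t lin1 bij1 one1 comm1]) (rule that, assumption+)
  interpret T: Vector_Spaces.linear sc sc \<theta> by (rule \<theta>(1))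
  have "(\<forall>a b. \<theta> (a * b) = \<theta> a * \<theta> b) \<or> (\<forall>a b. \<theta> (a * b) = \<theta> b * \<theta> a)"
    by (rule jordan_automorphism[where \<theta> = \<theta>, OF char(1) T.add bij_is_surj[OF \<theta>(2)]
          jordan_mod_scalars_imp_jordan[where \<theta> = \<theta>, OF char(1) t \<theta>(1,2,3,6)]])
  moreover have "Vector_Spaces.linear sc (*) (\<lambda>x. c * \<omega> x)"
    unfolding Vector_Spaces.linear_iff using vector_space_axioms F
    by (simp add: functional_simps[OF \<theta>(4)] algebra_simps)
  moreover have "\<phi> x = sc (c * k) (\<theta> x) + sc (c * \<omega> x) 1" for x
    unfolding \<phi> \<theta>(5) by (simp add: scale_right_distrib)
  ultimately show ?thesis using \<theta>(1,2) by blast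
qed

end
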